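(* Let $\Delta$ be a finite irreducible reduced root system that is not simply-laced, with positive system $\Delta_+$ and Weyl group $W$, and let $\Delta=\Delta_l\cup\Delta_s$ be the decomposition into long and short roots. Let $(\Delta_1,\Delta_2)=(\Delta_l,\Delta_s)$ or $(\Delta_s,\Delta_l)$ and $\Delta_{j+}=\Delta_j\cap\Delta_+$ ($j=1,2$). Then $\Delta_{j+}$ ($j=1,2$) is a root set. Moreover, for $k\in2\mathbb N$, $\mathbf k_1=(k_\alpha)_{\alpha\in\Delta_{1+}}$ with $k_\alpha=k$ for all $\alpha\in\Delta_{1+}$, and $\nu\in P^\vee$, $$\zeta_r(\mathbf k_1,\nu;\Delta_{1+})=\frac{(-1)^{|\Delta_+|}}{|W|}\mathcal P_{\Delta_{1+}}(\mathbf k_1,\nu;\Delta)\prod_{\alpha\in\Delta_{1+}}\frac{(2\pi i)^{k_\alpha}}{k_\alpha!}.$$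
   Context: Let $V$ be an $r$-dimensional real inner product space, $\Delta\subset V$ a finite irreducible reduced root system, $\Delta_+$ a fixed positive system, $\{\alpha_1,\ldots,\alpha_r\}$ the fundamental system, $\alpha^\vee=2\alpha/\langle\alpha,\alpha\rangle$, $Q^\vee=\bigoplus\mathbb Z\alpha_i^\vee$, $\lambda_j$ the fundamental weights ($\langle\alpha_i^\vee,\lambda_j\rangle=\delta_{ij}$), $\lambda_j^\vee$ the fundamental coweights ($\langle\lambda_i^\vee,\alpha_j\rangle=\delta_{ij}$), $P^\vee=\bigoplus\mathbb Z\lambda_i^\vee$, $P_{++}=\bigoplus\mathbb N\lambda_i$. A root set is a subset $\Delta^*\subset\Delta_+$ such that for each $j$ some $\alpha\in\Delta^*$ has $\langle\alpha,\lambda_j\rangle\ne0$; for $\mathbf s=(s_\alpha)_{\alpha\in\Delta^*}$ and $\mathbf y\in V$, $\zeta_r(\mathbf s,\mathbf y;\Delta^* )=\sum_{\lambda\in P_{++}}e^{2\pi i\langle\mathbf y,\lambda\rangle}\prod_{\alpha\in\Delta^*}\langle\alpha^\vee,\lambda\rangle^{-s_\alpha}$. Let $\mathscr V$ be the set of subsets $\mathbf V\subset\Delta_+$ that are bases of $V$; $\{\mu^{\mathbf V}_\beta\}$ the basis dual to $\{\beta^\vee\}_{\beta\in\mathbf V}$; $L(\mathbf V^\vee)=\bigoplus_{\beta\in\mathbf V}\mathbb Z\beta^\vee$. Fix $\phi\in V$ with all $\langle\phi,\mu^{\mathbf V}_\beta\rangle\ne0$; $\{\mathbf y\}_{\mathbf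 V,\beta}=\{\langle\mathbf y,\mu^{\mathbf V}_\beta\rangle\}$ if $\langle\phi,\mu^{\mathbf V}_\beta\rangle>0$, $=1-\{-\langle\mathbf y,\mu^{\mathbf V}_\beta\rangle\}$ otherwise. For a root set $\Delta^*$, let $A=\Delta_+\setminus\Delta^*=\{\nu_1,\ldots,\nu_N\}$ (fixed ordering), $A_0=\emptyset$, $A_j=\{\nu_1,\ldots,\nu_j\}$, $\mathscr V_A=\{\mathbf V\in\mathscr V:\nu_{j+1}\notin\mathrm{L.h.}[\mathbf V\cap A_j],\ 0\le j\le N-1\}$, and $$F_{\Delta^*}(\mathbf t_{\Delta^*},\mathbf y;\Delta)=\sum_{\mathbf V\in\mathscr V_A}(-1)^{|A\setminus\mathbf V|}\Bigl(\prod_{\gamma\in\Delta_+\setminus(\mathbf V\cup A)}\frac{t_\gamma}{t_\gamma-\sum_{\beta\in\mathbf V\setminus A}t_\beta\langle\gamma^\vee,\mu^{\mathbf V}_\beta\rangle}\Bigr)\frac{1}{|Q^\vee/L(\mathbf V^\vee)|}\sum_{q\in Q^\vee/L(\mathbf V^\vee)}\prod_{\beta\in\mathbf V\setminus A}\frac{t_\beta e^{t_\beta\{\mathbf y+q\}_{\mathbf V,\beta}}}{e^{t_\beta}-1},$$ holomorphic in $\mathbf t_{\Delta^*}=(t_\alpha)_{\alpha\in\Delta^*}$ near $0$; $\mathcal P_{\Delta^*}(\mathbf k_{\Delta^*},\mathbf y;\Delta)$ are its Taylor coefficients: $F_{\Delta^*}=\sum_{\mathbf k_{\Delta^*}}\mathcal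 P_{\Delta^*}(\mathbf k_{\Delta^*},\mathbf y;\Delta)\prod_{\alpha\in\Delta^*}t_\alpha^{k_\alpha}/k_\alpha!$. *)

theory Defs
  imports "HOL-Analysis.Analysis"
begin

definition rs_coroot :: "'a::euclidean_space \<Rightarrow> 'a" where
  "rs_coroot \<alpha> = (2 / (\<alpha> \<bullet> \<alpha>)) *\<^sub>R \<alpha>"

definition rs_refl :: "'a::euclidean_space \<Rightarrow> 'a \<Rightarrow> 'a" where
  "rs_refl \<alpha> x = x - (rs_coroot \<alpha> \<bullet> x) *\<^sub>R \<alpha>"

definition root_system :: "'a::euclidean_space set \<Rightarrow> bool" where
  "root_system D \<longleftrightarrow> finite D \<and> 0 \<notin> D \<and> span D = UNIV \<and>
     (\<forall>\<alpha>\<in>D. \<forall>\<beta>\<in>D. rs_refl \<alpha> \<beta> \<in> D) \<and>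
     (\<forall>\<alpha>\<in>D. \<forall>\<beta>\<in>D. rs_coroot \<alpha> \<bullet> \<beta> \<in> \<int>)"

definition reduced_rs :: "'a::euclidean_space set \<Rightarrow> bool" where
  "reduced_rs D \<longleftrightarrow> (\<forall>\<alpha>\<in>D. \<forall>c::real. c *\<^sub>R \<alpha> \<in> D \<longrightarrow> c = 1 \<or> c = -1)"

definition irreducible_rs :: "'a::euclidean_space set \<Rightarrow> bool" where
  "irreducible_rs D \<longleftrightarrow> \<not> (\<exists>D1 D2. D1 \<noteq> {} \<and> D2 \<noteq> {} \<and> D1 \<union> D2 = D \<and>
       (\<forall>a\<in>D1. \<forall>b\<in>D2. a \<bullet> b = 0))"

definition fundamental_system :: "'a::euclidean_space set \<Rightarrow> 'a set \<Rightarrow> bool" where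
  "fundamental_system D S \<longleftrightarrow> S \<subseteq> D \<and> independent S \<and>
     (\<forall>\<alpha>\<in>D. \<exists>n::'a \<Rightarrow> int. \<alpha> = (\<Sum>s\<in>S. of_int (n s) *\<^sub>R s) \<and>
        ((\<forall>s\<in>S. n s \<ge> 0) \<or> (\<forall>s\<in>S. n s \<le> 0)))"

definition pos_roots :: "'a::euclidean_space set \<Rightarrow> 'a set \<Rightarrow> 'a set" where
  "pos_roots D S = {\<alpha>\<in>D. \<exists>n::'a \<Rightarrow> nat. \<alpha> = (\<Sum>s\<in>S. of_nat (n s) *\<^sub>R s)}"

definition fund_weight :: "'a::euclidean_space set \<Rightarrow> 'a \<Rightarrow> 'a" where
  "fund_weight S s = (THE l. \<forall>s'\<in>S. rs_coroot s' \<bullet> l = (if s' = s then 1 else 0))"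

definition fund_coweight :: "'a::euclidean_space set \<Rightarrow> 'a \<Rightarrow> 'a" where
  "fund_coweight S s = (THE v. \<forall>s'\<in>S. v \<bullet> s' = (if s' = s then 1 else 0))"

definition P_pp :: "'a::euclidean_space set \<Rightarrow> 'a set" where
  "P_pp S = {(\<Sum>s\<in>S. of_nat (m s) *\<^sub>R fund_weight S s) | m. \<forall>s\<in>S. m s \<ge> 1}"

definition coweight_lattice :: "'a::euclidean_space set \<Rightarrow> 'a set" where
  "coweight_lattice S = {(\<Sum>s\<in>S. of_int (m s) *\<^sub>R fund_coweight S s) | m. True}"

definition coroot_lattice :: "'a::euclidean_space set \<Rightarrow> 'a set" where
  "coroot_lattice S = {(\<Sum>s\<in>S. of_int (m s) *\<^sub>R rs_coroot s) | m. True}"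

inductive_set weyl_group :: "'a::euclidean_space set \<Rightarrow> ('a \<Rightarrow> 'a) set" for D where
  weyl_id: "id \<in> weyl_group D"
| weyl_step: "w \<in> weyl_group D \<Longrightarrow> \<alpha> \<in> D \<Longrightarrow> rs_refl \<alpha> \<circ> w \<in> weyl_group D"

definition long_roots :: "'a::euclidean_space set \<Rightarrow> 'a set" where
  "long_roots D = {\<alpha>\<in>D. \<forall>\<beta>\<in>D. norm \<beta> \<le> norm \<alpha>}"

definition short_roots :: "'a::euclidean_space set \<Rightarrow> 'a set" where
  "short_roots D = {\<alpha>\<in>D. \<forall>\<beta>\<in>D. norm \<alpha> \<le> norm \<beta>}"

definition simply_laced :: "'a::euclidean_space set \<Rightarrow> bool" where
  "simply_laced D \<longleftrightarrow> (\<forall>\<alpha>\<in>D. \<forall>\<beta>\<in>D. norm \<alpha> = norm \<beta>)"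

definition root_set :: "'a::euclidean_space set \<Rightarrow> 'a set \<Rightarrow> 'a set \<Rightarrow> bool" where
  "root_set D S Ds \<longleftrightarrow> Ds \<subseteq> pos_roots D S \<and>
     (\<forall>s\<in>S. \<exists>\<alpha>\<in>Ds. \<alpha> \<bullet> fund_weight S s \<noteq> 0)"

definition zeta_term :: "'a::euclidean_space set \<Rightarrow> ('a \<Rightarrow> nat) \<Rightarrow> 'a \<Rightarrow> 'a \<Rightarrow> complex" where
  "zeta_term Ds s y l = exp (2 * pi * \<i> * complex_of_real (y \<bullet> l)) *
      (\<Prod>\<alpha>\<in>Ds. 1 / (complex_of_real (rs_coroot \<alpha> \<bullet> l)) ^ s \<alpha>)"

definition bases_V :: "'a::euclidean_space set \<Rightarrow> 'a set \<Rightarrow> 'a set set" where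
  "bases_V D S = {B. B \<subseteq> pos_roots D S \<and> independent B \<and> span B = UNIV}"

definition mu_V :: "'a::euclidean_space set \<Rightarrow> 'a \<Rightarrow> 'a" where
  "mu_V B \<beta> = (THE m. \<forall>\<beta>'\<in>B. rs_coroot \<beta>' \<bullet> m = (if \<beta>' = \<beta> then 1 else 0))"

definition lattice_V :: "'a::euclidean_space set \<Rightarrow> 'a set" where
  "lattice_V B = {(\<Sum>\<beta>\<in>B. of_int (m \<beta>) *\<^sub>R rs_coroot \<beta>) | m. True}"

definition cosets_V :: "'a::euclidean_space set \<Rightarrow> 'a set \<Rightarrow> 'a set set" where
  "cosets_V S B = (\<lambda>q. (\<lambda>x. q + x) ` lattice_V B) ` coroot_lattice S"

definition frac_V :: "'a::euclidean_space \<Rightarrow> 'a set \<Rightarrow> 'a \<Rightarrow> 'a \<Rightarrow> real" where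
  "frac_V \<phi> B \<beta> y = (if \<phi> \<bullet> mu_V B \<beta> > 0 then frac (y \<bullet> mu_V B \<beta>)
                      else 1 - frac (- (y \<bullet> mu_V B \<beta>)))"

text \<open>V_A for A = set of the list ns (the ordering nu_1,...,nu_N).\<close>
definition bases_VA :: "'a::euclidean_space set \<Rightarrow> 'a set \<Rightarrow> 'a list \<Rightarrow> 'a set set" where
  "bases_VA D S ns = {B\<in>bases_V D S. \<forall>j<length ns. ns ! j \<notin> span (B \<inter> set (take j ns))}"

definition F_gen :: "'a::euclidean_space set \<Rightarrow> 'a set \<Rightarrow> 'a list \<Rightarrow> 'a \<Rightarrow>
    ('a \<Rightarrow> complex) \<Rightarrow> 'a \<Rightarrow> complex" where
  "F_gen D S ns \<phi> t y =
    (\<Sum>B\<in>bases_VA D S ns.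
       (-1) ^ card (set ns - B) *
       (\<Prod>\<gamma>\<in>pos_roots D S - (B \<union> set ns).
           t \<gamma> / (t \<gamma> - (\<Sum>\<beta>\<in>B - set ns. t \<beta> * complex_of_real (rs_coroot \<gamma> \<bullet> mu_V B \<beta>)))) *
       (1 / of_nat (card (cosets_V S B))) *
       (\<Sum>C\<in>cosets_V S B.
          \<Prod>\<beta>\<in>B - set ns.
            t \<beta> * exp (t \<beta> * complex_of_real (frac_V \<phi> B \<beta> (y + (SOME q. q \<in> C))))
              / (exp (t \<beta>) - 1)))"

definition F_regular :: "'a::euclidean_space set \<Rightarrow> 'a set \<Rightarrow> 'a list \<Rightarrow> 'a set \<Rightarrow>
    ('a \<Rightarrow> complex) \<Rightarrow> bool" where
  "F_regular D S ns Ds t \<longleftrightarrow> (\<forall>\<alpha>\<in>Ds. t \<alpha> \<noteq> 0 \<and> exp (t \<alpha>) \<noteq> 1) \<and>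
     (\<forall>B\<in>bases_VA D S ns. \<forall>\<gamma>\<in>pos_roots D S - (B \<union> set ns).
        t \<gamma> - (\<Sum>\<beta>\<in>B - set ns. t \<beta> * complex_of_real (rs_coroot \<gamma> \<bullet> mu_V B \<beta>)) \<noteq> 0)"

definition multi_indices :: "'a set \<Rightarrow> ('a \<Rightarrow> nat) set" where
  "multi_indices Ds = {k. \<forall>\<alpha>. \<alpha> \<notin> Ds \<longrightarrow> k \<alpha> = 0}"

text \<open>Taylor coefficients P_{Ds}(k, y; D): the (unique) coefficients c of the expansion
  F = sum_k c_k prod_{alpha in Ds} t_alpha^{k_alpha}/k_alpha! valid on a polydisc around 0
  (at the points where the defining formula of F is regular).\<close>
definition P_coeffs :: "'a::euclidean_space set \<Rightarrow> 'a set \<Rightarrow> 'a set \<Rightarrow> 'a list \<Rightarrow> 'a \<Rightarrow>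
    'a \<Rightarrow> ('a \<Rightarrow> nat) \<Rightarrow> complex" where
  "P_coeffs D S Ds ns \<phi> y = (THE c.
     (\<forall>k. k \<notin> multi_indices Ds \<longrightarrow> c k = 0) \<and>
     (\<exists>r>0. \<forall>t. (\<forall>\<alpha>\<in>Ds. norm (t \<alpha>) < r) \<and> F_regular D S ns Ds t \<longrightarrow>
        ((\<lambda>k. c k * (\<Prod>\<alpha>\<in>Ds. t \<alpha> ^ k \<alpha> / fact (k \<alpha>))) has_sum F_gen D S ns \<phi> t y)
          (multi_indices Ds)))"

definition generic_phi :: "'a::euclidean_space set \<Rightarrow> 'a set \<Rightarrow> 'a \<Rightarrow> bool" where
  "generic_phi D S \<phi> \<longleftrightarrow> (\<forall>B\<in>bases_V D S. \<forall>\<beta>\<in>B. \<phi> \<bullet> mu_V B \<beta> \<noteq> 0)"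

end

theory Submission
  imports Defs
begin

text \<open>
Write $X$ for the chosen positive roots and $A = \Delta_+ \setminus X$.  Formally, $F(t, y)$ is the Fourier series
$(-1)^{|A|} \sum_l e^{2 \pi i \langle y, l \rangle} \prod_{\alpha \in X} t_\alpha / (t_\alpha - 2 \pi i \langle \alpha^\vee, l \rangle)$
over the weights $l$ that are orthogonal to no root of $A$: the product is split by partial fractions over bases
$\mathbf V$, each resulting sum factors into one-dimensional Bernoulli kernels after averaging over the characters of
$Q^\vee / L(\mathbf V^\vee)$, and the condition on $A$ is an inclusion-exclusion over no-broken-circuit sets.

The one-dimensional series converge only conditionally.  Therefore everything is averaged over a small box
$y + \epsilon \phi + \{\sum_{\alpha \in X} s_\alpha \alpha^\vee : 0 \le s_\alpha \le \epsilon \delta\}$,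
on which all fractional parts are affine; this makes the identity absolutely convergent.  As $\epsilon \to 0$, uniform
convergence on a generic torus and Cauchy's estimates show that $F$ has a power series at $0$ whose coefficients are
the limits of the smoothed ones, and for exponents $k \ge 2$ the limit can be taken term by term.

Finally, the sum over the regular weights is $|W|$ times the sum over the strictly dominant ones, because $k$ is even,
$\nu \in P^\vee$, and $W$ permutes the chambers simply transitively.
\<close>

section \<open>Fourier series of the smoothed Bernoulli kernel\<close>

text \<open>The box serves two ends. Averaging in the direction of a root in X supplies one more
  power of the pairing of its coroot with l in the denominator, so every factor decays
  quadratically, and since X spans, the product is summable over the weights. The offset along
  \<phi> settles the case where a coordinate of y + q is an integer: \<phi> pairs to a nonzero
  number with every dual vector, so a small box stays on one side of the wall, and
  \<open>frac_V\<close> is the limit of the fractional part from that side.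

  The obstacle in the limit is that the formula for F has denominators vanishing on hyperplanes
  through t = 0, although F is holomorphic there. Convergence is therefore controlled on a torus
  where all denominators are bounded below, and Cauchy's estimates carry it to the coefficients. The
  same device shows that the values of F at regular points determine the coefficients, so that the
  description in \<open>P_coeffs\<close> has exactly one solution.

  That X spans comes from irreducibility: a nonempty set of roots stable under all reflections
  spans, and the long roots, like the short ones, form such a set.\<close>

inductive trig_poly :: "(real \<Rightarrow> complex) \<Rightarrow> bool" where
  trig_poly_monom: "trig_poly (\<lambda>x. c * cis (2 * pi * of_int n * x))"
| trig_poly_add: "trig_poly p \<Longrightarrow> trig_poly q \<Longrightarrow> trig_poly (\<lambda>x. p x + q x)"

lemma trig_poly_const: "trig_poly (\<lambda>x. c)"
  using trig_poly_monom[of c 0] by simp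

lemma trig_poly_mult:
  assumes "trig_poly p" "trig_poly q"
  shows "trig_poly (\<lambda>x. p x * q x)"
  using assms
proof (induction p rule: trig_poly.induct)
  case (trig_poly_monom c n)
  from trig_poly_monom(1) show ?case
  proof (induction q rule: trig_poly.induct)
    case (trig_poly_monom d m)
    have "(\<lambda>x. c * cis (2 * pi * real_of_int n * x) * (d * cis (2 * pi * real_of_int m * x)))
        = (\<lambda>x. (c * d) * cis (2 * pi * real_of_int (n + m) * x))"
    proof
      fix x :: real
      have "cis (2 * pi * real_of_int (n + m) * x) = cis (2 * pi * real_of_int n * x) * cis (2 * pi * real_of_int m * x)"
        unfolding cis_mult by (rule arg_cong[of _ _ cis]) (simp add: algebra_simps)
      then show "c * cis (2 * pi * real_of_int n * x) * (d * cis (2 * pi * real_of_int m * x))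
        = (c * d) * cis (2 * pi * real_of_int (n + m) * x)"
        by (simp only: mult_ac)
    qed
    then show ?case
      using trig_poly.trig_poly_monom[of "c * d" "n + m"] by simp
  next
    case (trig_poly_add p q)
    then show ?case
      by (simp add: distrib_left trig_poly.trig_poly_add)
  qed
next
  case (trig_poly_add p p')
  then show ?case
    by (simp add: distrib_right trig_poly.trig_poly_add)
qed

text \<open>Polynomials on the plane are polynomials in real-linear coordinates; on the circle these
  are trigonometric, which ties Stone-Weierstrass to \<open>trig_poly\<close>.\<close>

lemma trig_poly_real_polynomial_function:
  fixes p :: "complex \<Rightarrow> real"
  assumes "real_polynomial_function p"
  shows "trig_poly (\<lambda>x. of_real (p (cis (2 * pi * x))))"
  using assms
proof (induction p rule: real_polynomial_function.induct)
  case (linear f)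
  interpret bounded_linear f by fact
  \<comment> \<open>A real-linear f sends cis \<theta> to cos \<theta> f(1) + sin \<theta> f(i), and
    Euler's formulas split this into the frequencies 1 and -1.\<close>
  have "of_real (f (cis (2 * pi * x))) =
      (of_real (f 1) / 2 + of_real (f \<i>) / (2 * \<i>)) * cis (2 * pi * of_int 1 * x) +
      (of_real (f 1) / 2 - of_real (f \<i>) / (2 * \<i>)) * cis (2 * pi * of_int (-1) * x)" for x
  proof -
    have "cis (2 * pi * x) = cos (2 * pi * x) *\<^sub>R 1 + sin (2 * pi * x) *\<^sub>R \<i>"
      by (simp add: complex_eq_iff)
    then have "f (cis (2 * pi * x)) = cos (2 * pi * x) * f 1 + sin (2 * pi * x) * f \<i>"
      by (simp only: add scaleR) simp
    then show ?thesis
      by (simp add: complex_eq_iff)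
  qed
  then show ?case
    using trig_poly_add[OF trig_poly_monom trig_poly_monom] by (metis (no_types, lifting) ext)
next
  case (const c)
  then show ?case by (rule trig_poly_const)
next
  case (add f g)
  then show ?case by (simp add: trig_poly.trig_poly_add)
next
  case (mult f g)
  then show ?case by (simp add: trig_poly_mult)
qed

lemma trig_poly_polynomial_function:
  fixes p :: "complex \<Rightarrow> complex"
  assumes "polynomial_function p"
  shows "trig_poly (\<lambda>x. p (cis (2 * pi * x)))"
proof -
  have "real_polynomial_function (\<lambda>z. Re (p z))" "real_polynomial_function (\<lambda>z. Im (p z))"
    using assms bounded_linear_Re bounded_linear_Im
    by (auto simp: polynomial_function_def o_def)
  then have "trig_poly (\<lambda>x. of_real (Re (p (cis (2 * pi * x)))) + \<i> * of_real (Im (p (cis (2 * pi * x)))))"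
    by (intro trig_poly_add trig_poly_mult trig_poly_const trig_poly_real_polynomial_function)
  moreover have "of_real (Re z) + \<i> * of_real (Im z) = z" for z
    using complex_eq[of z] by simp
  ultimately show ?thesis by simp
qed

lemma periodic_int:
  fixes D :: "real \<Rightarrow> 'a"
  assumes "\<And>x. D (x + 1) = D x"
  shows "D (x + of_int n) = D x"
proof -
  have nat: "D (x + of_nat k) = D x" for x k
  proof (induction k)
    case (Suc k)
    then show ?case using assms[of "x + of_nat k"] by (simp add: add_ac)
  qed simp
  show ?thesis
  proof (cases "n \<ge> 0")
    case True
    then show ?thesis using nat[of x "nat n"] by simp
  next
    case False
    then show ?thesis using nat[of "x + of_int n" "nat (- n)"] by simp
  qed
qed

lemma periodic_Arg_cis:
  fixes D :: "real \<Rightarrow> 'a"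
  assumes "\<And>x. D (x + 1) = D x"
  shows "D (Arg (cis (2 * pi * x)) / (2 * pi)) = D x"
proof -
  have "cis (Arg (cis (2 * pi * x))) = cis (2 * pi * x)"
    by (simp add: cis_Arg sgn_div_norm)
  then obtain n :: int where "Arg (cis (2 * pi * x)) = 2 * pi * x + 2 * pi * of_int n"
    using sin_cos_eq_iff[of "Arg (cis (2 * pi * x))" "2 * pi * x"] by (auto simp: complex_eq_iff)
  then have "Arg (cis (2 * pi * x)) / (2 * pi) = x + of_int n"
    by (simp add: field_simps)
  then show ?thesis using periodic_int[of D, OF assms] by simp
qed

text \<open>\<open>Arg\<close> jumps on the negative real axis. Since D has period 1,
  \<open>Arg (- w) / (2 * pi) + 1/2\<close> may replace \<open>Arg w / (2 * pi)\<close> inside D,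
  and the former is continuous there.\<close>

lemma continuous_on_periodic_Arg:
  fixes D :: "real \<Rightarrow> complex"
  assumes per: "\<And>x. D (x + 1) = D x" and cont: "continuous_on UNIV D"
  shows "continuous_on (sphere 0 1) (\<lambda>z. D (Arg z / (2 * pi)))"
proof -
  have D: "isCont D x" for x
    using cont by (simp add: continuous_on_eq_continuous_at)
  have "isCont (\<lambda>z. D (Arg z / (2 * pi))) z" if "z \<noteq> 0" for z
  proof (cases "z \<in> \<real>\<^sub>\<le>\<^sub>0")
    case False
    then show ?thesis
      by (intro continuous_intros isCont_o2[OF _ D] continuous_at_Arg) auto
  next
    case True
    have eq: "D (Arg w / (2 * pi)) = D (Arg (- w) / (2 * pi) + 1/2)" if "w \<noteq> 0" for w
    proof (cases "Arg w \<le> 0")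
      case True
      then have "Arg (- w) / (2 * pi) + 1/2 = Arg w / (2 * pi) + 1"
        using Arg_minus[OF that] by (simp add: field_simps)
      then show ?thesis using per by simp
    next
      case False
      then have "Arg (- w) / (2 * pi) + 1/2 = Arg w / (2 * pi)"
        using Arg_minus[OF that] by (simp add: field_simps)
      then show ?thesis by simp
    qed
    have "- z \<notin> \<real>\<^sub>\<le>\<^sub>0"
      using True that by (auto simp: complex_nonpos_Reals_iff complex_eq_iff)
    then have "isCont (\<lambda>z. Arg (- z) / (2 * pi) + 1/2) z"
      by (intro continuous_intros isCont_o2[OF _ continuous_at_Arg, of _ "\<lambda>z. - z"]) auto
    then have "isCont (\<lambda>z. D (Arg (- z) / (2 * pi) + 1/2)) z"
      by (rule isCont_o2[OF _ D])
    moreover have ev: "eventually (\<lambda>w. D (Arg (- w) / (2 * pi) + 1/2) = D (Arg w / (2 * pi))) (nhds z)"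
      by (rule eventually_mono[OF t1_space_nhds[OF that]]) (use eq in auto)
    ultimately show ?thesis
      using isCont_cong[OF ev] by blast
  qed
  then show ?thesis
    by (intro continuous_at_imp_continuous_on) (metis dist_0_norm mem_sphere norm_zero zero_neq_one)
qed

text \<open>Vanishing coefficients make D orthogonal to all trigonometric polynomials. Approximating
  the conjugate of D uniformly by these shows that the integral of |D|^2 is zero, and continuity
  gives D = 0.\<close>

lemma fourier_unique:
  fixes D :: "real \<Rightarrow> complex"
  assumes per: "\<And>x. D (x + 1) = D x" and cont: "continuous_on UNIV D"
    and coef: "\<And>n::int. ((\<lambda>x. D x * cis (2 * pi * of_int n * x)) has_integral 0) {0..1}"
  shows "D x = 0"
proof -
  note cD = continuous_on_subset[OF cont subset_UNIV]
  have trig0: "((\<lambda>x. D x * p x) has_integral 0) {0..1}" if "trig_poly p" for p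
    using that
  proof (induction p rule: trig_poly.induct)
    case (trig_poly_monom c n)
    then show ?case
      using has_integral_mult_right[OF coef[of n], of c] by (simp add: mult_ac)
  next
    case (trig_poly_add p q)
    then show ?case
      using has_integral_add[OF trig_poly_add.IH] by (simp add: algebra_simps)
  qed
  have "bounded (D ` {0..1})"
    by (intro compact_imp_bounded compact_continuous_image cD compact_Icc)
  then obtain B where B: "\<And>x. x \<in> {0..1} \<Longrightarrow> norm (D x) \<le> B" and B0: "B > 0"
    unfolding bounded_pos by blast
  have cint: "(\<lambda>x. D x * cnj (D x)) integrable_on {0..1}"
    by (intro integrable_continuous_real continuous_intros cD)
  have bound: "norm (integral {0..1} (\<lambda>x. D x * cnj (D x))) \<le> B * e" if e: "e > 0" for e
  proof -
    have "continuous_on (sphere 0 1) (\<lambda>z. cnj (D (Arg z / (2 * pi))))"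
      by (intro continuous_on_cnj continuous_on_periodic_Arg per cont)
    from Stone_Weierstrass_polynomial_function[OF compact_sphere this e]
    obtain g where g: "polynomial_function g"
      and ge: "\<And>z. z \<in> sphere 0 1 \<Longrightarrow> norm (cnj (D (Arg z / (2 * pi))) - g z) < e" by blast
    have tg: "trig_poly (\<lambda>x. g (cis (2 * pi * x)))"
      by (rule trig_poly_polynomial_function[OF g])
    have ge': "norm (cnj (D x) - g (cis (2 * pi * x))) < e" for x
      using ge[of "cis (2 * pi * x)"] periodic_Arg_cis[of D, OF per] by simp
    have "((\<lambda>x. D x * cnj (D x) - D x * g (cis (2 * pi * x))) has_integral
        (integral {0..1} (\<lambda>x. D x * cnj (D x)) - 0)) {0..1}"
      by (intro has_integral_diff integrable_integral cint trig0 tg)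
    then have "((\<lambda>x. D x * (cnj (D x) - g (cis (2 * pi * x)))) has_integral
        integral {0..1} (\<lambda>x. D x * cnj (D x))) {0..1}"
      by (simp add: algebra_simps)
    then have "((\<lambda>x. D x * (cnj (D x) - g (cis (2 * pi * x)))) has_integral
        integral {0..1} (\<lambda>x. D x * cnj (D x))) (cbox 0 1)" by (simp add: cbox_interval)
    then have "norm (integral {0..1} (\<lambda>x. D x * cnj (D x))) \<le> (B * e) * measure lborel (cbox 0 (1::real))"
    proof (rule has_integral_bound[rotated])
      show "0 \<le> B * e" using B0 e by simp
      fix x :: real assume "x \<in> cbox 0 1"
      then have "norm (D x) \<le> B" using B by (simp add: cbox_interval)
      then show "norm (D x * (cnj (D x) - g (cis (2 * pi * x)))) \<le> B * e"
        using ge'[of x] B0 by (auto simp: norm_mult intro!: mult_mono)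
    qed
    then show ?thesis by simp
  qed
  have "integral {0..1} (\<lambda>x. D x * cnj (D x)) = 0"
  proof (rule ccontr)
    assume "\<not> ?thesis"
    then have "norm (integral {0..1} (\<lambda>x. D x * cnj (D x))) > 0" by simp
    then show False
      using bound[of "norm (integral {0..1} (\<lambda>x. D x * cnj (D x))) / (2 * B)"] B0
      by (simp add: field_simps)
  qed
  then have "((\<lambda>x. D x * cnj (D x)) has_integral 0) {0..1}"
    using cint by (metis integrable_integral)
  from has_integral_Re[OF this]
  have int0: "((\<lambda>x. (norm (D x))\<^sup>2) has_integral 0) (cbox 0 1)"
    by (simp add: complex_mult_cnj cmod_power2 cbox_interval)
  have *: "(norm (D x))\<^sup>2 = 0" if "x \<in> {0..1}" for x
    by (rule has_integral_0_cbox_imp_0[OF _ _ int0])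
       (use that cD in \<open>auto simp: cbox_interval box_real intro!: continuous_on_power continuous_on_norm\<close>)
  have "D (frac x) = D x"
    using periodic_int[of D "frac x" "\<lfloor>x\<rfloor>", OF per] by (simp add: frac_def)
  moreover have "D (frac x) = 0"
    using *[of "frac x"] frac_lt_1[of x] by simp
  ultimately show ?thesis by simp
qed


section \<open>The Bernoulli kernel and the Fourier series of its antiderivative\<close>

definition quad_decay :: "real \<Rightarrow> real" where
  "quad_decay x = 1 / (1 + x\<^sup>2)"

lemma quad_decay_pos: "quad_decay x > 0"
  by (simp add: quad_decay_def add_pos_nonneg)

lemma quad_decay_le_1: "quad_decay x \<le> 1"
  by (simp add: quad_decay_def divide_le_eq add_pos_nonneg)

lemma quad_decay_summable: "(\<lambda>n::int. quad_decay (of_int n)) summable_on UNIV"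
proof -
  have "summable (\<lambda>n::nat. quad_decay (real n))"
  proof (rule summable_comparison_test[OF _ inverse_power_summable[of 2]])
    have "norm (quad_decay (real n)) \<le> inverse ((real n)\<^sup>2)" if "n \<ge> 1" for n
      using that by (simp add: quad_decay_def divide_simps add_pos_nonneg)
    then show "\<exists>N. \<forall>n\<ge>N. norm (quad_decay (real n)) \<le> inverse ((real n)\<^sup>2)" by blast
  qed simp
  then have nat: "(\<lambda>n::nat. quad_decay (real n)) summable_on UNIV"
    by (rule summable_nonneg_imp_summable_on) (simp add: less_imp_le[OF quad_decay_pos])
  have "(\<lambda>n. quad_decay (of_int n)) summable_on range int"
    by (subst summable_on_reindex) (simp_all add: o_def nat)
  moreover have "(\<lambda>n. quad_decay (of_int n)) summable_on range (\<lambda>n. - int n)"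
    by (subst summable_on_reindex) (use nat in \<open>simp_all add: o_def inj_def quad_decay_def\<close>)
  ultimately have "(\<lambda>n. quad_decay (of_int n)) summable_on (range int \<union> range (\<lambda>n. - int n))"
    by (rule summable_on_union)
  also have "range int \<union> range (\<lambda>n. - int n) = UNIV"
    using int_cases2 by blast
  finally show ?thesis .
qed

text \<open>Fourier coefficients of $x \mapsto$ bern_U $t\;x - x$ below; the division by zero makes the coefficient at $m = 0$ vanish, so the constant term is kept separately.\<close>

definition bern_coeff :: "complex \<Rightarrow> int \<Rightarrow> complex" where
  "bern_coeff t m = t / ((2 * pi * \<i> * of_int m) * (t - 2 * pi * \<i> * of_int m))"

text \<open>As 2 pi > 6 and |t| < 1 \<le> |m|, at least 6|m| - |m| remains.\<close>

lemma norm_pole_ge: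
  fixes m :: int
  assumes "norm t < 1" "m \<noteq> 0"
  shows "norm (t - 2 * pi * \<i> * of_int m) \<ge> 5 * \<bar>of_int m\<bar>"
proof -
  have m: "\<bar>real_of_int m\<bar> \<ge> 1" using assms(2) by linarith
  have "norm (2 * pi * \<i> * of_int m) = 2 * pi * \<bar>of_int m\<bar>"
    by (simp add: norm_mult)
  moreover have "2 * pi * \<bar>real_of_int m\<bar> \<ge> 6 * \<bar>of_int m\<bar>"
    using pi_gt3 by (intro mult_right_mono) auto
  moreover have "norm (2 * pi * \<i> * of_int m) - norm t \<le> norm (2 * pi * \<i> * of_int m - t)"
    by (rule norm_triangle_ineq2)
  ultimately show ?thesis
    using assms(1) m by (simp add: norm_minus_commute)
qed

lemma pole_nonzero:
  fixes m :: int
  assumes "norm t < 1" "t \<noteq> 0"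
  shows "t \<noteq> 2 * pi * \<i> * of_int m"
  using norm_pole_ge[OF assms(1), of m] assms(2) by (cases "m = 0") auto

lemma exp_minus_1_nonzero:
  assumes "norm t < 1" "t \<noteq> 0"
  shows "exp t - 1 \<noteq> (0::complex)"
proof
  assume "exp t - 1 = 0"
  then obtain n :: int where "t = of_int (2 * n) * pi * \<i>"
    using exp_eq_1[of t] by (auto simp: complex_eq_iff mult_ac)
  then have "t = 2 * pi * \<i> * of_int n" by simp
  then show False using pole_nonzero[OF assms] by blast
qed

lemma norm_bern_coeff_le:
  assumes "norm t < 1"
  shows "norm (bern_coeff t m) \<le> quad_decay (of_int m)"
proof (cases "m = 0")
  case False
  then have m: "\<bar>real_of_int m\<bar> \<ge> 1" by linarith
  have *: "norm (2 * pi * \<i> * of_int m) = 2 * pi * \<bar>of_int m\<bar>"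
    by (simp add: norm_mult)
  have **: "2 * pi * \<bar>of_int m\<bar> \<ge> 6 * \<bar>real_of_int m\<bar>"
    using pi_gt3 by (intro mult_right_mono) auto
  have "norm ((2 * pi * \<i> * of_int m) * (t - 2 * pi * \<i> * of_int m)) \<ge> (6 * \<bar>of_int m\<bar>) * (5 * \<bar>of_int m\<bar>)"
    unfolding norm_mult[of "2 * pi * \<i> * of_int m"] *
    by (intro mult_mono norm_pole_ge[OF assms False] **) auto
  moreover have "(6 * \<bar>real_of_int m\<bar>) * (5 * \<bar>of_int m\<bar>) \<ge> 1 + (of_int m)\<^sup>2"
  proof -
    have "(real_of_int m)\<^sup>2 \<ge> 1" using m by (simp add: abs_le_square_iff[of 1, simplified])
    then show ?thesis by (simp add: power2_eq_square)
  qed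
  ultimately show ?thesis
    unfolding bern_coeff_def quad_decay_def norm_divide using assms
    by (intro frac_le) (auto simp: add_pos_nonneg)
qed (simp add: bern_coeff_def quad_decay_def)

text \<open>An antiderivative in $x$ of the Bernoulli kernel $t e^{t \{x\}} / (e^t - 1)$.  Unlike the kernel, it is continuous, which is why difference quotients of it have absolutely convergent Fourier series.\<close>

definition bern_U :: "complex \<Rightarrow> real \<Rightarrow> complex" where
  "bern_U t x = exp (t * of_real (frac x)) / (exp t - 1) + of_int \<lfloor>x\<rfloor>"

text \<open>At an integer n the left piece, with floor n - 1, and the right piece, with floor n,
  meet with the values g 1 and g 0.\<close>

lemma continuous_on_periodized:
  fixes g :: "real \<Rightarrow> complex"
  assumes g: "continuous_on UNIV g" and "g 0 = g 1"
  shows "continuous_on UNIV (\<lambda>x. g (frac x))"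
proof -
  have gc: "isCont g x" for x using g by (simp add: continuous_on_eq_continuous_at)
  have "isCont (\<lambda>x. g (frac x)) x" for x
  proof (cases "x \<in> \<int>")
    case False
    then show ?thesis
      by (intro isCont_o2[OF _ gc] continuous_frac)
  next
    case True
    then obtain n where n: "x = of_int n" by (auto elim: Ints_cases)
    have "continuous_on ({..x} \<union> {x..}) (\<lambda>y. if y \<le> x then g (y - of_int (n - 1)) else g (y - of_int n))"
      by (intro continuous_on_If continuous_on_compose2[OF g] continuous_intros)
         (use assms(2) n in auto)
    then have "isCont (\<lambda>y. if y \<le> x then g (y - of_int (n - 1)) else g (y - of_int n)) x"
      by (simp add: Un_def continuous_on_eq_continuous_at linear)
    moreover have ev: "eventually (\<lambda>y. (if y \<le> x then g (y - of_int (n - 1)) else g (y - of_int n)) = g (frac y)) (nhds x)"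
    proof (rule eventually_nhds_in_open[THEN eventually_mono])
      fix y assume y: "y \<in> {x - 1 <..< x + 1}"
      show "(if y \<le> x then g (y - of_int (n - 1)) else g (y - of_int n)) = g (frac y)"
      proof (cases "y < x")
        case True
        then have "\<lfloor>y\<rfloor> = n - 1" using y n by (intro floor_unique) auto
        then show ?thesis using True by (simp add: frac_def)
      next
        case False
        then have "\<lfloor>y\<rfloor> = n" using y n by (intro floor_unique) auto
        then show ?thesis using False n assms(2) by (auto simp: frac_def)
      qed
    qed auto
    ultimately show ?thesis using isCont_cong[OF ev] by blast
  qed
  then show ?thesis by (simp add: continuous_on_eq_continuous_at)
qed

lemma cis_int_integral:
  "((\<lambda>x. cis (2 * pi * of_int n * x)) has_integral (if n = 0 then 1 else 0)) {0..1}"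
proof (cases "n = 0")
  case True
  then show ?thesis using has_integral_const_real[of "1::complex" 0 1] by simp
next
  case False
  define a where "a = 2 * pi * \<i> * of_int n"
  have a: "a \<noteq> 0" using False by (simp add: a_def)
  have cis: "cis (2 * pi * of_int n * x) = exp (a * of_real x)" for x
    by (simp add: cis_conv_exp a_def mult_ac)
  have "((\<lambda>x. exp (a * of_real x)) has_integral (exp (a * of_real 1) / a - exp (a * of_real 0) / a)) {0..1}"
    by (rule fundamental_theorem_of_calculus)
       (use a in \<open>auto intro!: derivative_eq_intros has_vector_derivative_real_field\<close>)
  moreover have "exp (a * of_real 1) = 1"
    using cis[of 1] cis_2pi sin_int_2pin cos_int_2pin by (simp add: complex_eq_iff)
  ultimately show ?thesis using False by (simp add: cis)
qed

text \<open>The constant -1/t + 1/2 normalizes the mean over a period to 0, in accordance with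
  \<open>bern_coeff t 0 = 0\<close>. For n nonzero the boundary values of an explicit antiderivative
  leave 1/(t + a) - 1/a with a = 2 pi i n; integrating against the frequency n picks out the
  coefficient of index -n.\<close>

lemma bern_integral:
  assumes t: "norm t < 1" "t \<noteq> 0"
  shows "((\<lambda>x. (exp (t * of_real x) / (exp t - 1) - of_real x - 1 / t + 1 / 2) * cis (2 * pi * of_int n * x))
     has_integral bern_coeff t (- n)) {0..1}"
proof (cases "n = 0")
  case True
  note e = exp_minus_1_nonzero[OF t]
  define G where "G = (\<lambda>x::complex. (1 / (t * (exp t - 1))) * exp (t * x) - (1 / 2) * (x * x) - (1 / t - 1 / 2) * x)"
  have G: "(G has_field_derivative (exp (t * x) / (exp t - 1) - x - 1 / t + 1 / 2)) (at x within A)" for x A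
    unfolding G_def
    by (rule DERIV_cong[OF DERIV_diff[OF DERIV_diff[OF DERIV_cmult DERIV_cmult] DERIV_cmult_Id]],
        (rule derivative_intros)+) (use e t in \<open>simp add: divide_simps, simp add: algebra_simps\<close>)
  have "((\<lambda>x. exp (t * of_real x) / (exp t - 1) - of_real x - 1 / t + 1 / 2) has_integral
     (G (of_real 1) - G (of_real 0))) {0..1}"
    by (rule fundamental_theorem_of_calculus) (auto intro!: has_vector_derivative_real_field G)
  moreover have "G (of_real 1) - G (of_real 0) = 0"
    using t e by (simp add: G_def divide_simps) (simp add: algebra_simps)
  ultimately show ?thesis using True by (simp add: bern_coeff_def)
next
  case False
  note e = exp_minus_1_nonzero[OF t]
  define a where "a = 2 * pi * \<i> * of_int n"
  have a: "a \<noteq> 0" using False by (simp add: a_def)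
  have ta: "t + a \<noteq> 0" using pole_nonzero[OF t, of "- n"] by (auto simp: a_def add_eq_0_iff)
  have cis: "cis (2 * pi * of_int n * x) = exp (a * of_real x)" for x
    by (simp add: cis_conv_exp a_def mult_ac)
  have e1: "exp a = 1"
    using cis[of 1] cis_2pi sin_int_2pin cos_int_2pin by (simp add: complex_eq_iff)
  define G where "G = (\<lambda>x::complex. (1 / ((t + a) * (exp t - 1))) * exp ((t + a) * x) - (1 / a) * (x * exp (a * x))
     + (1 / a\<^sup>2 - (1 / t - 1 / 2) / a) * exp (a * x))"
  have G: "(G has_field_derivative (exp (t * x) / (exp t - 1) - x - 1 / t + 1 / 2) * exp (a * x)) (at x within A)" for x A
    unfolding G_def
    by (rule DERIV_cong, (rule derivative_intros)+)
       (use a ta e t in \<open>simp add: divide_simps power2_eq_square\<close>, simp add: algebra_simps exp_add)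
  have "((\<lambda>x. (exp (t * of_real x) / (exp t - 1) - of_real x - 1 / t + 1 / 2) * exp (a * of_real x)) has_integral
     (G (of_real 1) - G (of_real 0))) {0..1}"
    by (rule fundamental_theorem_of_calculus) (auto intro!: has_vector_derivative_real_field G)
  moreover have "G (of_real 1) - G (of_real 0) = bern_coeff t (- n)"
  proof -
    have "G (of_real 1) - G (of_real 0) = 1 / (t + a) - 1 / a"
    proof -
      have "exp (t + a) = exp t" by (simp add: exp_add e1)
      moreover have "exp t / ((t + a) * (exp t - 1)) - 1 / ((t + a) * (exp t - 1)) = 1 / (t + a)"
        using ta e by (simp flip: diff_divide_distrib)
      ultimately show ?thesis by (simp add: G_def e1)
    qed
    also have "\<dots> = t / ((- a) * (t + a))"
      using a ta by (simp add: divide_simps)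
    also have "\<dots> = bern_coeff t (- n)" by (simp add: bern_coeff_def a_def)
    finally show ?thesis .
  qed
  ultimately show ?thesis by (simp add: cis)
qed

text \<open>The series converges uniformly, so its sum is continuous. The right side is g(frac x)
  with g 0 = g 1, hence continuous and periodic too. Both have the same Fourier coefficients, and
  \<open>fourier_unique\<close> applies to the difference.\<close>

lemma bern_U_fourier:
  assumes t: "norm t < 1" "t \<noteq> 0"
  shows "((\<lambda>m. bern_coeff t m * cis (2 * pi * of_int m * x)) has_sum (bern_U t x - of_real x - 1 / t + 1 / 2)) UNIV"
proof -
  note e = exp_minus_1_nonzero[OF t]
  define g where "g = (\<lambda>x::real. exp (t * of_real x) / (exp t - 1) - of_real x - 1 / t + 1 / 2)"
  define S where "S = (\<lambda>x. \<Sum>\<^sub>\<infinity>m\<in>UNIV. bern_coeff t m * cis (2 * pi * of_int m * x))"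
  define D where "D = (\<lambda>x. S x - g (frac x))"
  have ul: "uniform_limit UNIV (\<lambda>F x. \<Sum>m\<in>F. bern_coeff t m * cis (2 * pi * of_int m * x)) S (finite_subsets_at_top UNIV)"
    unfolding S_def by (rule Weierstrass_m_test_general[OF _ quad_decay_summable])
      (use norm_bern_coeff_le[OF t(1)] in \<open>simp add: norm_mult\<close>)
  have cS: "continuous_on UNIV S"
    by (rule uniform_limit_theorem[OF _ ul]) (auto intro!: always_eventually continuous_intros)
  have "g 0 = g 1" using e by (simp add: g_def divide_simps) 
  then have cg: "continuous_on UNIV (\<lambda>x. g (frac x))"
    by (intro continuous_on_periodized) (auto simp: g_def intro!: continuous_intros)
  have "D x = 0"
  proof (rule fourier_unique)
    show "D (x + 1) = D x" for x
    proof -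
      have "cis (2 * pi * of_int m * (x + 1)) = cis (2 * pi * of_int m * x)" for m :: int
      proof -
        have "cis (2 * pi * of_int m * (x + 1)) = cis (2 * pi * of_int m * x) * cis (2 * pi * of_int m)"
          by (simp add: cis_mult algebra_simps)
        moreover have "cis (2 * pi * of_int m) = 1"
          using sin_int_2pin cos_int_2pin by (simp add: complex_eq_iff)
        ultimately show ?thesis by simp
      qed
      then show ?thesis by (simp add: D_def S_def frac_1_eq)
    qed
    show "continuous_on UNIV D"
      unfolding D_def by (intro continuous_intros cS cg)
    fix n :: int
    have ul': "uniform_limit {0..1} (\<lambda>F x. (\<Sum>m\<in>F. bern_coeff t m * cis (2 * pi * of_int m * x)) * cis (2 * pi * of_int n * x))
       (\<lambda>x. S x * cis (2 * pi * of_int n * x)) (finite_subsets_at_top UNIV)"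
    proof (rule uniform_lim_mult[OF uniform_limit_on_subset[OF ul] uniform_limit_const])
      have "bounded (S ` {0..1})" 
        by (intro compact_imp_bounded compact_continuous_image continuous_on_subset[OF cS] compact_Icc) auto
      then show "bounded (S ` {0..1})" .
      show "bounded ((\<lambda>x. cis (2 * pi * real_of_int n * x)) ` {0..1})"
        unfolding bounded_iff by (rule exI[of _ 1]) simp
    qed simp
    obtain I J where I: "\<And>F. ((\<lambda>x. (\<Sum>m\<in>F. bern_coeff t m * cis (2 * pi * of_int m * x)) * cis (2 * pi * of_int n * x)) has_integral I F) {0..1}"
      and J: "((\<lambda>x. S x * cis (2 * pi * of_int n * x)) has_integral J) {0..1}"
      and IJ: "(I \<longlongrightarrow> J) (finite_subsets_at_top UNIV)"
      by (rule uniform_limit_integral[OF ul']) (auto intro!: continuous_intros)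
    have I_eq: "I F = (\<Sum>m\<in>F. bern_coeff t m * (if m + n = 0 then 1 else 0))" if "finite F" for F
    proof (rule has_integral_unique[OF I])
      have "((\<lambda>x. \<Sum>m\<in>F. bern_coeff t m * cis (2 * pi * of_int (m + n) * x)) has_integral
          (\<Sum>m\<in>F. bern_coeff t m * (if m + n = 0 then 1 else 0))) {0..1}"
        by (intro has_integral_sum that has_integral_mult_right cis_int_integral)
      moreover have "(\<Sum>m\<in>F. bern_coeff t m * cis (2 * pi * of_int (m + n) * x)) =
         (\<Sum>m\<in>F. bern_coeff t m * cis (2 * pi * of_int m * x)) * cis (2 * pi * of_int n * x)" for x
        unfolding sum_distrib_right mult.assoc cis_mult by (simp add: algebra_simps)
      ultimately show "((\<lambda>x. (\<Sum>m\<in>F. bern_coeff t m * cis (2 * pi * of_int m * x)) * cis (2 * pi * of_int n * x))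
         has_integral (\<Sum>m\<in>F. bern_coeff t m * (if m + n = 0 then 1 else 0))) {0..1}" by simp
    qed
    \<comment> \<open>Once the finite set contains -n, orthogonality makes the integral of the
      partial sum exactly the coefficient of index -n.\<close>
    have "eventually (\<lambda>F. I F = bern_coeff t (- n)) (finite_subsets_at_top UNIV)"
      unfolding eventually_finite_subsets_at_top
    proof (intro exI[of _ "{- n}"] conjI allI impI)
      fix F :: "int set" assume F: "finite F \<and> {- n} \<subseteq> F \<and> F \<subseteq> UNIV"
      then have "(\<Sum>m\<in>F. bern_coeff t m * (if m + n = 0 then 1 else 0)) = (\<Sum>m\<in>{- n}. bern_coeff t m)"
        by (intro sum.mono_neutral_cong_right) (auto simp: add_eq_0_iff)
      then show "I F = bern_coeff t (- n)" using I_eq F by simp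
    qed auto
    then have "(I \<longlongrightarrow> bern_coeff t (- n)) (finite_subsets_at_top UNIV)"
      by (rule tendsto_eventually)
    then have "J = bern_coeff t (- n)"
      using IJ tendsto_unique[OF _ IJ] by simp
    \<comment> \<open>On [0,1] the function \<open>frac\<close> differs from the identity at the
      single point 1.\<close>
    moreover have "((\<lambda>x. g (frac x) * cis (2 * pi * of_int n * x)) has_integral bern_coeff t (- n)) {0..1}"
    proof (rule has_integral_spike_finite[OF _ _ bern_integral[OF t]])
      show "finite {1::real}" by simp
      fix x :: real assume "x \<in> {0..1} - {1}"
      then have "frac x = x" by (simp add: frac_eq)
      then show "g (frac x) * cis (2 * pi * of_int n * x) =
        (exp (t * of_real x) / (exp t - 1) - of_real x - 1 / t + 1 / 2) * cis (2 * pi * of_int n * x)"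
        by (simp add: g_def)
    qed
    ultimately show "((\<lambda>x. D x * cis (2 * pi * of_int n * x)) has_integral 0) {0..1}"
      using has_integral_diff[OF J] by (fastforce simp: D_def algebra_simps)
  qed
  moreover have "g (frac x) = bern_U t x - of_real x - 1 / t + 1 / 2"
    by (simp add: g_def bern_U_def frac_def)
  moreover have "(\<lambda>m. bern_coeff t m * cis (2 * pi * of_int m * x)) summable_on UNIV"
    by (rule abs_summable_summable, rule Infinite_Sum.abs_summable_on_comparison_test'[OF quad_decay_summable])
       (use norm_bern_coeff_le[OF t(1)] in \<open>simp add: norm_mult\<close>)
  ultimately show ?thesis
    by (simp add: D_def S_def has_sum_iff)
qed


section \<open>Averages of exponentials over an interval\<close>

definition exp_mean :: "real \<Rightarrow> real \<Rightarrow> complex \<Rightarrow> complex" where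
  "exp_mean p q z = (if z = 0 then 1 else (exp (of_real q * z) - exp (of_real p * z)) / (of_real (q - p) * z))"

lemma has_sum_diff_fun:
  fixes f g :: "'i \<Rightarrow> complex"
  assumes "(f has_sum a) A" "(g has_sum b) A"
  shows "((\<lambda>x. f x - g x) has_sum (a - b)) A"
  using has_sum_add[OF assms(1) has_sum_uminusI[OF assms(2)]] by simp

lemma exp_mean_integral:
  assumes "p < q"
  shows "((\<lambda>s. exp (of_real s * z)) has_integral of_real (q - p) * exp_mean p q z) {p..q}"
proof (cases "z = 0")
  case True
  then show ?thesis
    using has_integral_const_real[of "1::complex" p q] assms by (simp add: exp_mean_def scaleR_conv_of_real)
next
  case False
  have "((\<lambda>s. exp (of_real s * z)) has_integral (exp (of_real q * z) / z - exp (of_real p * z) / z)) {p..q}"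
    by (rule fundamental_theorem_of_calculus)
       (use assms False in \<open>auto intro!: derivative_eq_intros has_vector_derivative_real_field\<close>)
  then show ?thesis
    using False assms by (simp add: exp_mean_def diff_divide_distrib[symmetric] del: of_real_diff)
qed

lemma norm_exp_mean_le_1:
  assumes "p < q" "Re z = 0"
  shows "norm (exp_mean p q z) \<le> 1"
proof -
  have "norm (of_real (q - p) * exp_mean p q z) \<le> 1 * measure lborel (cbox p q)"
    by (rule has_integral_bound[of _ "\<lambda>s. exp (of_real s * z)"])
       (use exp_mean_integral[OF assms(1), of z] assms in \<open>simp_all add: cbox_interval\<close>)
  moreover have "norm (complex_of_real (q - p)) = q - p"
    using assms(1) by (simp only: norm_of_real)
  ultimately show ?thesis using assms(1) by (simp add: norm_mult)
qed

lemma norm_exp_mean_le_inverse: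
  assumes "p < q" "Re z = 0" "z \<noteq> 0"
  shows "norm (exp_mean p q z) \<le> 2 / ((q - p) * norm z)"
proof -
  have "norm (exp (of_real q * z) - exp (of_real p * z)) \<le> 2"
    by (rule order_trans[OF norm_triangle_ineq4]) (use assms in simp)
  moreover have "norm (complex_of_real (q - p)) = q - p"
    using assms(1) by (simp only: norm_of_real)
  ultimately show ?thesis
    using assms by (simp add: exp_mean_def norm_divide norm_mult divide_right_mono)
qed

text \<open>The mean factors as exp(p z) f((q - p) z) with f(w) = (exp w - 1)/w continuous at 0, so
  one d serves all p, q, z. This uniformity is what later gives uniform convergence of the box
  means.\<close>

lemma exp_mean_tendsto_1:
  assumes "e > 0"
  obtains d where "d > 0"
    "\<And>p q z. p < q \<Longrightarrow> norm (of_real p * z) < d \<Longrightarrow> norm (of_real (q - p) * z) < d \<Longrightarrow> norm (exp_mean p q z - 1) < e"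
proof -
  define f where "f = (\<lambda>w::complex. if w = 0 then 1 else (exp w - 1) / w)"
  have "((\<lambda>w. (exp (0 + w) - exp 0) / w) \<longlongrightarrow> (1::complex)) (at 0)"
    using DERIV_exp[of "0::complex"] unfolding DERIV_def by simp
  then have "(f \<longlongrightarrow> 1) (at 0)"
    by (rule Lim_transform_eventually) (auto simp: f_def eventually_at intro!: exI[of _ 1])
  moreover have f0: "f 0 = 1" by (simp add: f_def)
  ultimately have "(f \<longlongrightarrow> f 0) (at 0)" by simp
  then have "isCont f 0" by (simp add: isCont_def)
  then have "((\<lambda>x. exp (fst x) * f (snd x)) \<longlongrightarrow> exp (fst (0, 0::complex)) * f (snd (0::complex, 0))) (nhds (0, 0))"
    by (intro tendsto_mult tendsto_exp tendsto_fst isCont_tendsto_compose[where g = f] tendsto_snd)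
       (auto simp: filterlim_ident intro: tendsto_ident_at[THEN tendsto_within_subset] filterlim_ident)
  then have "eventually (\<lambda>x. dist (exp (fst x) * f (snd x)) 1 < e) (nhds (0, 0))"
    using tendstoD[OF _ assms] f0 by fastforce
  then obtain d where d: "d > 0" "\<And>x. dist x (0, 0) < d \<Longrightarrow> dist (exp (fst x) * f (snd x)) 1 < e"
    unfolding eventually_nhds_metric by blast
  have "norm (exp_mean p q z - 1) < e" if "p < q" "norm (of_real p * z) < d / 2" "norm (of_real (q - p) * z) < d / 2" for p q z
  proof -
    have "dist (of_real p * z, of_real (q - p) * z) (0, 0) \<le> norm (of_real p * z) + norm (of_real (q - p) * z)"
      using norm_Pair_le[of "of_real p * z" "of_real (q - p) * z"] by (simp add: dist_norm del: of_real_diff)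
    then have "dist (exp (of_real p * z) * f (of_real (q - p) * z)) 1 < e"
      using d(2)[of "(of_real p * z, of_real (q - p) * z)"] that by auto
    moreover have "exp (of_real p * z) * f (of_real (q - p) * z) = exp_mean p q z"
      using that(1) 
    proof -
      have "exp (of_real p * z) * (exp (of_real (q - p) * z) - 1) = exp (of_real q * z) - exp (of_real p * z)"
        by (simp add: algebra_simps flip: exp_add)
      then show ?thesis using that(1) by (simp add: f_def exp_mean_def del: of_real_diff)
    qed
    ultimately show ?thesis by (simp add: dist_norm)
  qed
  then show ?thesis using that[of "d / 2"] d(1) by auto
qed

text \<open>Difference quotients of \<open>bern_U_fourier\<close>. The constants cancel, and the
  linear term contributes (q - p)/(q - p) = 1, which is the term m = 0 that
  \<open>bern_coeff\<close> lacks.\<close>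

lemma bern_smooth_series:
  assumes t: "norm t < 1" "t \<noteq> 0" and pq: "p < q"
  shows "((\<lambda>m. t / (t - 2 * pi * \<i> * of_int m) * exp_mean p q (2 * pi * \<i> * of_int m) * cis (2 * pi * of_int m * x))
     has_sum ((bern_U t (x + q) - bern_U t (x + p)) / of_real (q - p))) UNIV"
proof -
  have "((\<lambda>m. (bern_coeff t m * cis (2 * pi * of_int m * (x + q)) - bern_coeff t m * cis (2 * pi * of_int m * (x + p))) / of_real (q - p))
    has_sum (((bern_U t (x + q) - of_real (x + q) - 1 / t + 1 / 2) - (bern_U t (x + p) - of_real (x + p) - 1 / t + 1 / 2)) / of_real (q - p))) UNIV"
    by (intro has_sum_divide_const has_sum_diff_fun bern_U_fourier t)
  moreover have "((\<lambda>m::int. if m = 0 then 1 else 0) has_sum (1::complex)) UNIV"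
    by (rule has_sum_finite_neutralI[of "{0}"]) auto
  ultimately have *: "((\<lambda>m. (bern_coeff t m * cis (2 * pi * of_int m * (x + q)) - bern_coeff t m * cis (2 * pi * of_int m * (x + p))) / of_real (q - p)
     + (if m = 0 then 1 else 0)) has_sum
    (((bern_U t (x + q) - of_real (x + q) - 1 / t + 1 / 2) - (bern_U t (x + p) - of_real (x + p) - 1 / t + 1 / 2)) / of_real (q - p) + 1)) UNIV"
    by (rule has_sum_add)
  have "((bern_U t (x + q) - of_real (x + q) - 1 / t + 1 / 2) - (bern_U t (x + p) - of_real (x + p) - 1 / t + 1 / 2)) / of_real (q - p) + 1
    = (bern_U t (x + q) - bern_U t (x + p)) / of_real (q - p)"
  proof -
    have "of_real (q - p) \<noteq> (0::complex)" using pq by simp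
    then have "(A - of_real (x + q) - 1 / t + 1 / 2 - (B - of_real (x + p) - 1 / t + 1 / 2)) / of_real (q - p) + 1
      = (A - B) / of_real (q - p)" for A B
    proof -
      have "A - of_real (x + q) - 1 / t + 1 / 2 - (B - of_real (x + p) - 1 / t + 1 / 2) = (A - B) - of_real (q - p)"
        by simp
      then show ?thesis using pq by (simp only: diff_divide_distrib) (simp del: of_real_diff)
    qed
    then show ?thesis .
  qed
  moreover have "(bern_coeff t m * cis (2 * pi * of_int m * (x + q)) - bern_coeff t m * cis (2 * pi * of_int m * (x + p))) / of_real (q - p)
     + (if m = 0 then 1 else 0) = t / (t - 2 * pi * \<i> * of_int m) * exp_mean p q (2 * pi * \<i> * of_int m) * cis (2 * pi * of_int m * x)" for m
  proof (cases "m = 0")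
    case True
    then show ?thesis using t by (simp add: bern_coeff_def exp_mean_def)
  next
    case False
    define z where "z = 2 * pi * \<i> * of_int m"
    have z: "z \<noteq> 0" using False by (simp add: z_def)
    have c: "cis (2 * pi * of_int m * y) = exp (of_real y * z)" for y
      by (simp add: cis_conv_exp z_def mult_ac)
    have "exp (of_real (x + r) * z) = exp (of_real x * z) * exp (of_real r * z)" for r
      by (simp add: distrib_right exp_add)
    moreover have "bern_coeff t m = t / (z * (t - z))" by (simp add: bern_coeff_def z_def)
    moreover have "(t / (z * s) * (X * Q) - t / (z * s) * (X * P)) / d = t / s * ((Q - P) / (d * z)) * X"
      if "s \<noteq> 0" "d \<noteq> 0" for s d P Q X :: complex
      using z that by (simp add: divide_simps) (simp add: algebra_simps)
    moreover have "t - z \<noteq> 0" using pole_nonzero[OF t, of m] by (simp add: z_def)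
    moreover have "complex_of_real (q - p) \<noteq> 0" using pq by simp
    ultimately show ?thesis
      using False z unfolding c z_def[symmetric] by (simp add: exp_mean_def del: of_real_diff)
  qed
  ultimately show ?thesis using * by simp
qed

text \<open>As long as x + [p, q] stays in the closed cell [n, n + 1], \<open>bern_U\<close> is one
  exponential plus n, so that averaging multiplies the kernel by \<open>exp_mean\<close>.\<close>

lemma bern_smooth_cell:
  assumes t: "norm t < 1" "t \<noteq> 0" and pq: "p < q"
    and n: "of_int n \<le> x + p" "x + q \<le> of_int n + 1"
  shows "(bern_U t (x + q) - bern_U t (x + p)) / of_real (q - p) =
    t * exp (t * of_real (x - of_int n)) / (exp t - 1) * exp_mean p q t"
proof -
  note e = exp_minus_1_nonzero[OF t]
  have U: "bern_U t y = exp (t * of_real (y - of_int n)) / (exp t - 1) + of_int n"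
    if "of_int n \<le> y" "y \<le> of_int n + 1" for y
  \<comment> \<open>At the right end the fractional part is 0 and the floor is n + 1; the value
    agrees since 1/(e^t - 1) + 1 = e^t/(e^t - 1).\<close>
  proof (cases "y = of_int n + 1")
    case True
    then show ?thesis using e by (simp add: bern_U_def frac_def divide_simps) (simp add: algebra_simps)
  next
    case False
    then have "\<lfloor>y\<rfloor> = n" using that by (intro floor_unique) auto
    then show ?thesis by (simp add: bern_U_def frac_def)
  qed
  have "exp (t * of_real (x + r - of_int n)) = exp (t * of_real (x - of_int n)) * exp (of_real r * t)" for r
    by (simp add: algebra_simps flip: exp_add)
  then have "bern_U t (x + q) - bern_U t (x + p) =
      exp (t * of_real (x - of_int n)) * (exp (of_real q * t) - exp (of_real p * t)) / (exp t - 1)"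
    using U[of "x + q"] U[of "x + p"] n pq by (simp add: algebra_simps diff_divide_distrib)
  then show ?thesis
    using t by (simp add: exp_mean_def)
qed

text \<open>The maximum with 1 treats m = 0, where the mean is 1, together with the decay 1/|m|
  elsewhere.\<close>

lemma norm_exp_mean_int_le:
  assumes "p < q"
  shows "norm (exp_mean p q (2 * pi * \<i> * of_int m)) \<le> (1 + 1 / (q - p)) / max 1 \<bar>of_int m\<bar>"
proof (cases "m = 0")
  case True
  then show ?thesis using assms by (simp add: exp_mean_def)
next
  case False
  then have m: "\<bar>real_of_int m\<bar> \<ge> 1" by linarith
  have nz: "norm (2 * pi * \<i> * of_int m) = 2 * pi * \<bar>of_int m\<bar>"
    by (simp add: norm_mult)
  have "norm (exp_mean p q (2 * pi * \<i> * of_int m)) \<le> 2 / ((q - p) * (2 * pi * \<bar>of_int m\<bar>))"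
    using norm_exp_mean_le_inverse[OF assms, of "2 * pi * \<i> * of_int m"] False nz by simp
  also have "\<dots> = (1 / (q - p)) / (pi * \<bar>of_int m\<bar>)" by simp
  also have "\<dots> \<le> (1 + 1 / (q - p)) / \<bar>of_int m\<bar>"
  proof (rule frac_le)
    show "\<bar>of_int m\<bar> \<le> pi * \<bar>real_of_int m\<bar>" using mult_right_mono[of 1 pi "\<bar>real_of_int m\<bar>"] pi_ge_two by simp
  qed (use assms m in auto)
  finally show ?thesis using m by (simp add: max_def)
qed

text \<open>Combines first-order decay from averaging with first-order decay of a pole coefficient;
  the square of max 1 |x| is at least (1 + x^2)/2.\<close>

lemma max_sq_quad_decay: "1 / max 1 \<bar>x\<bar> * (1 / max 1 \<bar>x\<bar>) \<le> 2 * quad_decay x"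
proof -
  have "1 + x\<^sup>2 \<le> 2 * (max 1 \<bar>x\<bar>)\<^sup>2"
    by (cases "\<bar>x\<bar> \<le> 1") (auto simp: max_def abs_square_le_1 not_le less_imp_le one_le_power abs_le_square_iff[of 1 x, simplified])
  then show ?thesis
    by (simp add: quad_decay_def divide_simps add_pos_nonneg power2_eq_square)
qed

text \<open>For imaginary rates the exponentials have modulus 1, so summability of |b| gives
  convergence uniform in u, and the series may be integrated over [p, q] term by term.\<close>

lemma smooth_series_single:
  fixes b w :: "'i \<Rightarrow> complex"
  assumes pq: "p < q" and b: "(\<lambda>i. norm (b i)) summable_on I" and w: "\<And>i. i \<in> I \<Longrightarrow> Re (w i) = 0"
    and id: "\<And>u. u \<in> {p..q} \<Longrightarrow> ((\<lambda>i. b i * exp (of_real u * w i)) has_sum (K * exp (of_real u * z))) I"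
  shows "((\<lambda>i. b i * exp_mean p q (w i)) has_sum (K * exp_mean p q z)) I"
proof -
  have ul: "uniform_limit {p..q} (\<lambda>F u. \<Sum>i\<in>F. b i * exp (of_real u * w i)) (\<lambda>u. K * exp (of_real u * z)) (finite_subsets_at_top I)"
    by (rule Weierstrass_m_test_general'[OF _ id b]) (simp_all add: norm_mult w)
  obtain A J where A: "\<And>F. ((\<lambda>u. \<Sum>i\<in>F. b i * exp (of_real u * w i)) has_integral A F) {p..q}"
    and J: "((\<lambda>u. K * exp (of_real u * z)) has_integral J) {p..q}" and AJ: "(A \<longlongrightarrow> J) (finite_subsets_at_top I)"
    by (rule uniform_limit_integral[OF ul]) (auto intro!: continuous_intros)
  have "J = K * (of_real (q - p) * exp_mean p q z)"
    by (rule has_integral_unique[OF J]) (intro has_integral_mult_right exp_mean_integral pq)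
  moreover have "A F = (\<Sum>i\<in>F. b i * (of_real (q - p) * exp_mean p q (w i)))" if "finite F" for F
    by (rule has_integral_unique[OF A]) (intro has_integral_sum that has_integral_mult_right exp_mean_integral pq)
  then have "eventually (\<lambda>F. A F = (\<Sum>i\<in>F. b i * (of_real (q - p) * exp_mean p q (w i)))) (finite_subsets_at_top I)"
    by (intro eventually_finite_subsets_at_top_weakI) auto
  ultimately have "((\<lambda>i. b i * (of_real (q - p) * exp_mean p q (w i))) has_sum (K * (of_real (q - p) * exp_mean p q z))) I"
    unfolding has_sum_def using Lim_transform_eventually[OF AJ] by simp
  from has_sum_cmult_right[OF this, of "1 / of_real (q - p)"] show ?thesis
    using pq by (simp add: mult.left_commute flip: of_real_diff)
qed

text \<open>Induction on the directions. Freezing one of them at u absorbs its exponential into a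
  and K; the averaged factors have modulus at most 1, so absolute summability persists when that
  direction is averaged last.\<close>

lemma smooth_series:
  fixes a :: "'i \<Rightarrow> complex" and w :: "'i \<Rightarrow> 'g \<Rightarrow> complex"
  assumes "finite G" and pq: "\<And>g. g \<in> G \<Longrightarrow> p g < q g"
    and "(\<lambda>i. norm (a i)) summable_on I"
    and w: "\<And>i g. i \<in> I \<Longrightarrow> g \<in> G \<Longrightarrow> Re (w i g) = 0"
    and "\<And>s. (\<And>g. g \<in> G \<Longrightarrow> s g \<in> {p g..q g}) \<Longrightarrow>
       ((\<lambda>i. a i * (\<Prod>g\<in>G. exp (of_real (s g) * w i g))) has_sum (K * (\<Prod>g\<in>G. exp (of_real (s g) * z g)))) I"
  shows "((\<lambda>i. a i * (\<Prod>g\<in>G. exp_mean (p g) (q g) (w i g))) has_sum (K * (\<Prod>g\<in>G. exp_mean (p g) (q g) (z g)))) I"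
  using assms
proof (induction G arbitrary: a K rule: finite_induct)
  case empty
  from empty(4)[of "\<lambda>_. 0"] show ?case by simp
next
  case (insert g G)
  have *: "((\<lambda>i. (a i * exp (of_real u * w i g)) * (\<Prod>g\<in>G. exp_mean (p g) (q g) (w i g))) has_sum
      ((K * exp (of_real u * z g)) * (\<Prod>g\<in>G. exp_mean (p g) (q g) (z g)))) I" if u: "u \<in> {p g..q g}" for u
  proof (rule insert.IH)
    have "(\<lambda>i. norm (a i * exp (of_real u * w i g))) summable_on I \<longleftrightarrow> (\<lambda>i. norm (a i)) summable_on I"
      by (rule summable_on_cong) (simp add: norm_mult insert.prems(3))
    then show "(\<lambda>i. norm (a i * exp (of_real u * w i g))) summable_on I" using insert.prems(2) by simp
    fix s assume s: "\<And>h. h \<in> G \<Longrightarrow> s h \<in> {p h..q h}"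
    have "((\<lambda>i. a i * (\<Prod>h\<in>insert g G. exp (of_real ((s(g := u)) h) * w i h))) has_sum
      (K * (\<Prod>h\<in>insert g G. exp (of_real ((s(g := u)) h) * z h)))) I"
      by (rule insert.prems(4)) (use s u in auto)
    moreover have "(\<Prod>h\<in>insert g G. exp (of_real ((s(g := u)) h) * v h)) =
        exp (of_real u * v g) * (\<Prod>h\<in>G. exp (of_real (s h) * v h))" for v :: "'g \<Rightarrow> complex"
      using insert.hyps by (simp, intro disjI2 prod.cong) auto
    ultimately show "((\<lambda>i. (a i * exp (of_real u * w i g)) * (\<Prod>h\<in>G. exp (of_real (s h) * w i h))) has_sum
      ((K * exp (of_real u * z g)) * (\<Prod>h\<in>G. exp (of_real (s h) * z h)))) I" by (simp add: mult_ac)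
  qed (use insert.prems in auto)
  have "((\<lambda>i. (a i * (\<Prod>g\<in>G. exp_mean (p g) (q g) (w i g))) * exp_mean (p g) (q g) (w i g)) has_sum
      ((K * (\<Prod>g\<in>G. exp_mean (p g) (q g) (z g))) * exp_mean (p g) (q g) (z g))) I"
  proof (rule smooth_series_single)
    show "(\<lambda>i. norm (a i * (\<Prod>g\<in>G. exp_mean (p g) (q g) (w i g)))) summable_on I"
    proof (rule Infinite_Sum.abs_summable_on_comparison_test'[OF insert.prems(2)])
      fix i assume i: "i \<in> I"
      have "norm (\<Prod>g\<in>G. exp_mean (p g) (q g) (w i g)) \<le> 1"
        unfolding prod_norm[symmetric] by (rule prod_le_1) (use insert.prems i in \<open>auto intro!: norm_exp_mean_le_1\<close>)
      then show "norm (a i * (\<Prod>g\<in>G. exp_mean (p g) (q g) (w i g))) \<le> norm (a i)"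
        by (simp add: norm_mult mult_left_le)
    qed
  qed (use * insert.prems in \<open>auto simp: mult_ac\<close>)
  then show ?case using insert.hyps by (simp add: mult_ac)
qed

section \<open>Power series in several variables\<close>

lemma has_sum_finite_sum:
  fixes f :: "'j \<Rightarrow> 'i \<Rightarrow> 'c::topological_comm_monoid_add"
  assumes "finite J" "\<And>j. j \<in> J \<Longrightarrow> (f j has_sum s j) A"
  shows "((\<lambda>i. \<Sum>j\<in>J. f j i) has_sum (\<Sum>j\<in>J. s j)) A"
  using assms by (induction J rule: finite_induct) (auto intro!: has_sum_add)

text \<open>A finite set of functions lies in the product of its finite projections, over which the
  sum factors and is bounded by the product of the one-variable sums.\<close>

lemma summable_prod_PiE:
  fixes f :: "'x \<Rightarrow> 'y \<Rightarrow> real"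
  assumes X: "finite X" and f: "\<And>x. x \<in> X \<Longrightarrow> f x summable_on B x"
    and nn: "\<And>x y. x \<in> X \<Longrightarrow> y \<in> B x \<Longrightarrow> f x y \<ge> 0"
  shows "(\<lambda>g. \<Prod>x\<in>X. f x (g x)) summable_on PiE X B"
proof (rule nonneg_bdd_above_summable_on)
  show "0 \<le> (\<Prod>x\<in>X. f x (g x))" if "g \<in> PiE X B" for g
    using that nn by (intro prod_nonneg) auto
  show "bdd_above (sum (\<lambda>g. \<Prod>x\<in>X. f x (g x)) ` {F. F \<subseteq> PiE X B \<and> finite F})"
  proof (rule bdd_aboveI2)
    fix F assume "F \<in> {F. F \<subseteq> PiE X B \<and> finite F}"
    then have F: "F \<subseteq> PiE X B" "finite F" by auto
    define P where "P = PiE X (\<lambda>x. (\<lambda>g. g x) ` F)"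
    have "finite P" unfolding P_def using X F by (intro finite_PiE) auto
    have P: "P \<subseteq> PiE X B" unfolding P_def using F(1) by (intro PiE_mono) auto
    have "F \<subseteq> P" using F(1) by (auto simp: P_def PiE_iff subset_iff)
    then have "(\<Sum>g\<in>F. \<Prod>x\<in>X. f x (g x)) \<le> (\<Sum>g\<in>P. \<Prod>x\<in>X. f x (g x))"
      using P nn \<open>finite P\<close> by (intro sum_mono2 prod_nonneg) (auto simp: PiE_iff subset_iff)
    also have "\<dots> = (\<Prod>x\<in>X. \<Sum>y\<in>(\<lambda>g. g x) ` F. f x y)"
      unfolding P_def using X F by (intro prod_sum_PiE[symmetric]) auto
    also have "\<dots> \<le> (\<Prod>x\<in>X. infsum (f x) (B x))"
      using F nn f by (intro prod_mono conjI sum_nonneg finite_sum_le_infsum) (auto simp: PiE_iff subset_iff)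
    finally show "(\<Sum>g\<in>F. \<Prod>x\<in>X. f x (g x)) \<le> (\<Prod>x\<in>X. infsum (f x) (B x))" .
  qed
qed

lemma has_sum_prod_PiE:
  fixes f :: "'x \<Rightarrow> 'y \<Rightarrow> complex"
  assumes X: "finite X" and f: "\<And>x. x \<in> X \<Longrightarrow> (f x has_sum s x) (B x)"
  shows "((\<lambda>g. \<Prod>x\<in>X. f x (g x)) has_sum (\<Prod>x\<in>X. s x)) (PiE X B)"
proof -
  have abs: "(\<lambda>y. norm (f x y)) summable_on B x" if "x \<in> X" for x
    using f[OF that] summable_on_iff_abs_summable_on_complex has_sum_imp_summable by blast
  have "(\<lambda>g. norm (\<Prod>x\<in>X. f x (g x))) summable_on PiE X B"
    using summable_prod_PiE[OF X abs] by (simp add: prod_norm)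
  then have "(\<lambda>g. \<Prod>x\<in>X. f x (g x)) summable_on PiE X B"
    by (rule abs_summable_summable)
  moreover have "infsum (\<lambda>g. \<Prod>x\<in>X. f x (g x)) (PiE X B) = (\<Prod>x\<in>X. infsum (f x) (B x))"
    by (rule infsum_prod_PiE_abs[OF X abs])
  moreover have "(\<Prod>x\<in>X. infsum (f x) (B x)) = (\<Prod>x\<in>X. s x)"
    using f by (intro prod.cong) (auto simp: infsumI)
  ultimately show ?thesis by (simp add: has_sum_iff)
qed

text \<open>Members of \<open>PiE\<close> are \<open>undefined\<close> off X, multi-indices are 0
  there; this change of default links the product lemmas to \<open>multi_indices\<close>.\<close>

lemma bij_betw_multi_indices:
  "bij_betw (\<lambda>g \<alpha>. if \<alpha> \<in> X then g \<alpha> else 0) (PiE X (\<lambda>_. UNIV)) (multi_indices X)"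
  by (rule bij_betwI[where g = "\<lambda>k. restrict k X"])
     (auto simp: multi_indices_def fun_eq_iff PiE_iff extensional_def)

lemma has_sum_prod_multi_indices:
  fixes f :: "'a \<Rightarrow> nat \<Rightarrow> complex"
  assumes X: "finite X" and f: "\<And>x. x \<in> X \<Longrightarrow> (f x has_sum s x) UNIV"
  shows "((\<lambda>k. \<Prod>x\<in>X. f x (k x)) has_sum (\<Prod>x\<in>X. s x)) (multi_indices X)"
proof -
  have "((\<lambda>g. \<Prod>x\<in>X. f x (if x \<in> X then g x else 0)) has_sum (\<Prod>x\<in>X. s x)) (PiE X (\<lambda>_. UNIV))"
    using has_sum_prod_PiE[OF X f, of "\<lambda>x. x"] by simp
  then show ?thesis
    using has_sum_reindex_bij_betw[OF bij_betw_multi_indices, of "\<lambda>k. \<Prod>x\<in>X. f x (k x)" X "\<Prod>x\<in>X. s x"] by simp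
qed

lemma geometric_multi_summable:
  fixes q :: "'a \<Rightarrow> real"
  assumes X: "finite X" and q: "\<And>x. x \<in> X \<Longrightarrow> 0 \<le> q x \<and> q x < 1"
  shows "(\<lambda>k. \<Prod>x\<in>X. q x ^ k x) summable_on multi_indices X"
proof -
  have "(\<lambda>k. q x ^ k) summable_on (UNIV :: nat set)" if "x \<in> X" for x
    by (rule summable_nonneg_imp_summable_on) (use q that in \<open>auto intro!: summable_geometric\<close>)
  then have "(\<lambda>g. \<Prod>x\<in>X. q x ^ g x) summable_on PiE X (\<lambda>_. UNIV)"
    using q by (intro summable_prod_PiE X) auto
  then show ?thesis
    using summable_on_reindex_bij_betw[OF bij_betw_multi_indices[of X], of "\<lambda>k. \<Prod>x\<in>X. q x ^ k x"] by simp
qed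

section \<open>Cauchy's estimates, uniqueness and limits of power series\<close>

lemma sum_roots_of_unity:
  assumes "\<bar>d\<bar> < int N" "d \<noteq> 0"
  shows "(\<Sum>j<N. cis (2 * pi * of_int d * of_nat j / of_nat N)) = 0"
proof -
  define z where "z = cis (2 * pi * of_int d / of_nat N)"
  have N: "N > 0" using assms by auto
  have "z ^ N = cis (2 * pi * of_int d)"
    unfolding z_def Complex.DeMoivre using N by simp
  also have "\<dots> = 1" using sin_int_2pin cos_int_2pin by (simp add: complex_eq_iff)
  finally have zN: "z ^ N = 1" .
  have "z \<noteq> 1"
  proof
    assume "z = 1"
    then have "cos (2 * pi * of_int d / of_nat N) = 1" by (simp add: z_def complex_eq_iff)
    then obtain m :: int where m: "2 * pi * of_int d / of_nat N = of_int m * 2 * pi"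
      by (auto simp: cos_one_2pi_int)
    then have "real_of_int d = of_int m * of_nat N" using N by (simp add: field_simps)
    then have "d = m * int N" by (metis of_int_eq_iff of_int_mult of_int_of_nat_eq)
    then show False using assms by (auto simp: abs_mult)
  qed
  then have "(\<Sum>j<N. z ^ j) = 0" using zN geometric_sum[of z N] by simp
  moreover have "z ^ j = cis (2 * pi * of_int d * of_nat j / of_nat N)" for j
    unfolding z_def Complex.DeMoivre by (simp add: mult_ac)
  ultimately show ?thesis by simp
qed

text \<open>Averaging over the $N$-th roots of unity in every variable annihilates all monomials except those with exponents congruent to $k$ modulo $N$, and for large $N$ only a small tail of these survives besides $k$.\<close>

lemma cauchy_estimate:
  fixes a :: "('a \<Rightarrow> nat) \<Rightarrow> complex" and \<rho> :: "'a \<Rightarrow> real"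
  assumes X: "finite X" and \<rho>: "\<And>x. x \<in> X \<Longrightarrow> \<rho> x > 0"
    and summ: "(\<lambda>k. norm (a k) * (\<Prod>x\<in>X. \<rho> x ^ k x)) summable_on multi_indices X"
    and G: "\<And>t. (\<And>x. x \<in> X \<Longrightarrow> norm (t x) = \<rho> x) \<Longrightarrow>
         ((\<lambda>k. a k * (\<Prod>x\<in>X. t x ^ k x)) has_sum G t) (multi_indices X) \<and> norm (G t) \<le> M"
    and k: "k \<in> multi_indices X"
  shows "norm (a k) * (\<Prod>x\<in>X. \<rho> x ^ k x) \<le> M"
proof (rule field_le_epsilon)
  fix \<eta> :: real assume \<eta>: "\<eta> > 0"
  let ?I = "multi_indices X"
  define b where "b = (\<lambda>k. a k * (\<Prod>x\<in>X. of_real (\<rho> x) ^ k x))"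
  have nb: "norm (b k) = norm (a k) * (\<Prod>x\<in>X. \<rho> x ^ k x)" for k
  proof -
    have "norm (\<Prod>x\<in>X. complex_of_real (\<rho> x) ^ k x) = (\<Prod>x\<in>X. \<rho> x ^ k x)"
      unfolding prod_norm[symmetric] by (rule prod.cong) (use \<rho> in \<open>auto simp: norm_power less_imp_le\<close>)
    then show ?thesis by (simp add: b_def norm_mult)
  qed
  have sb: "(\<lambda>k. norm (b k)) summable_on ?I" using summ by (simp add: nb)
  obtain K0 where K0: "finite K0" "K0 \<subseteq> ?I" "dist (\<Sum>k\<in>K0. norm (b k)) (infsum (\<lambda>k. norm (b k)) ?I) \<le> \<eta>"
    using infsum_finite_approximation[OF sb \<eta>] by blast
  define K where "K = insert k K0"
  have K: "finite K" "K \<subseteq> ?I" "k \<in> K" using K0 k by (auto simp: K_def)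
  have tail: "infsum (\<lambda>k. norm (b k)) (?I - K) \<le> \<eta>"
  proof -
    have "infsum (\<lambda>k. norm (b k)) (?I - K) = infsum (\<lambda>k. norm (b k)) ?I - infsum (\<lambda>k. norm (b k)) K"
      using K by (intro infsum_Diff sb) auto
    also have "\<dots> = infsum (\<lambda>k. norm (b k)) ?I - (\<Sum>k\<in>K. norm (b k))" using K by simp
    finally have "infsum (\<lambda>k. norm (b k)) (?I - K) = infsum (\<lambda>k. norm (b k)) ?I - (\<Sum>k\<in>K. norm (b k))" .
    moreover have "(\<Sum>k\<in>K0. norm (b k)) \<le> (\<Sum>k\<in>K. norm (b k))"
      using K0 by (intro sum_mono2) (auto simp: K_def)
    ultimately show ?thesis using K0(3) by (simp add: dist_real_def abs_le_iff)
  qed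
  \<comment> \<open>N exceeds every exponent occurring in K. Two different members of K therefore
    differ, in some variable, by a nonzero integer of modulus below N, and are not congruent modulo
    N there.\<close>
  define N where "N = Suc (\<Sum>k\<in>K. \<Sum>x\<in>X. k x)"
  have Nbig: "k' x < N" if "k' \<in> K" "x \<in> X" for k' x
  proof -
    have "k' x \<le> (\<Sum>x\<in>X. k' x)" using X that by (intro member_le_sum) auto
    also have "\<dots> \<le> (\<Sum>k\<in>K. \<Sum>x\<in>X. k x)" using K that by (intro member_le_sum[of k' K "\<lambda>k. \<Sum>x\<in>X. k x"]) auto
    finally show ?thesis by (simp add: N_def)
  qed
  define J where "J = PiE X (\<lambda>_. {..<N})"
  define t where "t = (\<lambda>(j :: 'a \<Rightarrow> nat) x. of_real (\<rho> x) * cis (2 * pi * of_nat (j x) / of_nat N))"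
  define u where "u = (\<lambda>j. \<Prod>x\<in>X. cis (- (2 * pi * of_nat (k x) * of_nat (j x) / of_nat N)))"
  \<comment> \<open>The effect of the averaging on the variable x: a factor 1 if the exponents
    \<open>k' x\<close> and \<open>k x\<close> are congruent modulo N, and 0 otherwise.\<close>
  define w where "w = (\<lambda>k' x. (\<Sum>j<N. cis (2 * pi * of_int (int (k' x) - int (k x)) * of_nat j / of_nat N)) / of_nat N)"
  define A where "A = (\<Sum>j\<in>J. u j * G (t j)) / of_nat N ^ card X"
  have J: "finite J" "card J = N ^ card X"
    using X by (auto simp: J_def card_PiE intro!: finite_PiE)
  have N0: "N > 0" by (simp add: N_def)
  have tn: "norm (t j x) = \<rho> x" if "x \<in> X" for j x
    using \<rho>[OF that] by (simp add: t_def norm_mult)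
  have "norm (\<Sum>j\<in>J. u j * G (t j)) \<le> of_nat (card J) * M"
  proof (rule sum_norm_bound)
    fix j
    have "norm (u j) = 1" unfolding u_def prod_norm[symmetric] by simp
    then show "norm (u j * G (t j)) \<le> M" using G[of "t j"] tn by (simp add: norm_mult)
  qed
  then have AM: "norm A \<le> M"
    using N0 J by (simp add: A_def norm_divide norm_power divide_le_eq mult.commute)
  have hs: "((\<lambda>k'. b k' * (\<Prod>x\<in>X. w k' x)) has_sum A) ?I"
  proof -
    have "((\<lambda>k'. \<Sum>j\<in>J. u j * (a k' * (\<Prod>x\<in>X. t j x ^ k' x))) has_sum (\<Sum>j\<in>J. u j * G (t j))) ?I"
      using G tn by (intro has_sum_finite_sum J has_sum_cmult_right) auto
    then have "((\<lambda>k'. (\<Sum>j\<in>J. u j * (a k' * (\<Prod>x\<in>X. t j x ^ k' x))) / of_nat N ^ card X) has_sum A) ?I"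
      unfolding A_def by (rule has_sum_divide_const)
    moreover have "(\<Sum>j\<in>J. u j * (a k' * (\<Prod>x\<in>X. t j x ^ k' x))) / of_nat N ^ card X = b k' * (\<Prod>x\<in>X. w k' x)" for k'
    proof -
      have "u j * (\<Prod>x\<in>X. t j x ^ k' x) = (\<Prod>x\<in>X. of_real (\<rho> x) ^ k' x) *
         (\<Prod>x\<in>X. cis (2 * pi * of_int (int (k' x) - int (k x)) * of_nat (j x) / of_nat N))" for j
      proof -
        have "cis (- (2 * pi * of_nat (k x) * of_nat (j x) / of_nat N)) * t j x ^ k' x
          = of_real (\<rho> x) ^ k' x * cis (2 * pi * of_int (int (k' x) - int (k x)) * of_nat (j x) / of_nat N)" for x
        proof -
          have "cis (- (2 * pi * of_nat (k x) * of_nat (j x) / of_nat N)) * cis (of_nat (k' x) * (2 * pi * of_nat (j x) / of_nat N))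
            = cis (2 * pi * of_int (int (k' x) - int (k x)) * of_nat (j x) / of_nat N)"
            unfolding cis_mult by (rule arg_cong[of _ _ cis]) (use N0 in \<open>simp add: field_simps\<close>)
          then show ?thesis
            unfolding t_def power_mult_distrib Complex.DeMoivre by (simp add: mult_ac)
        qed
        then show ?thesis unfolding u_def prod.distrib[symmetric] by simp
      qed
      then have "(\<Sum>j\<in>J. u j * (a k' * (\<Prod>x\<in>X. t j x ^ k' x))) =
        (\<Sum>j\<in>J. b k' * (\<Prod>x\<in>X. cis (2 * pi * of_int (int (k' x) - int (k x)) * of_nat (j x) / of_nat N)))"
        unfolding b_def by (simp add: mult_ac)
      also have "\<dots> = b k' * (\<Sum>j\<in>J. (\<Prod>x\<in>X. cis (2 * pi * of_int (int (k' x) - int (k x)) * of_nat (j x) / of_nat N)))"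
        by (simp add: sum_distrib_left)
      also have "(\<Sum>j\<in>J. (\<Prod>x\<in>X. cis (2 * pi * of_int (int (k' x) - int (k x)) * of_nat (j x) / of_nat N))) =
         (\<Prod>x\<in>X. \<Sum>j<N. cis (2 * pi * of_int (int (k' x) - int (k x)) * of_nat j / of_nat N))"
        unfolding J_def using X by (intro prod_sum_PiE[symmetric]) auto
      finally show ?thesis by (simp add: w_def prod_dividef)
    qed
    ultimately show ?thesis by simp
  qed
  have w1: "norm (\<Prod>x\<in>X. w k' x) \<le> 1" for k'
    unfolding prod_norm[symmetric]
  proof (rule prod_le_1)
    fix x
    have "norm (\<Sum>j<N. cis (2 * pi * of_int (int (k' x) - int (k x)) * of_nat j / of_nat N)) \<le> of_nat (card {..<N}) * 1"
      by (rule sum_norm_bound) simp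
    then show "0 \<le> norm (w k' x) \<and> norm (w k' x) \<le> 1"
      using N0 by (simp add: w_def norm_divide divide_le_eq)
  qed
  have wk: "(\<Prod>x\<in>X. w k x) = 1"
    by (rule prod.neutral) (use N0 in \<open>simp add: w_def\<close>)
  have w0: "(\<Prod>x\<in>X. w k' x) = 0" if "k' \<in> K" "k' \<noteq> k" for k'
  proof -
    obtain x where x: "x \<in> X" "k' x \<noteq> k x"
    proof -
      have "\<exists>x\<in>X. k' x \<noteq> k x"
      proof (rule ccontr)
        assume "\<not> ?thesis"
        moreover have "k' x = k x" if "x \<notin> X" for x
          using \<open>k' \<in> K\<close> K k that by (auto simp: multi_indices_def)
        ultimately have "k' = k" by auto
        then show False using \<open>k' \<noteq> k\<close> by simp
      qed
      then show ?thesis using that by blast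
    qed
    have "w k' x = 0"
      unfolding w_def by (subst sum_roots_of_unity) (use Nbig[OF that(1) x(1)] Nbig[OF K(3) x(1)] x in auto)
    then show ?thesis using x X by (intro prod_zero) auto
  qed
  have sbw: "(\<lambda>k'. norm (b k' * (\<Prod>x\<in>X. w k' x))) summable_on (?I - K)"
    by (rule Infinite_Sum.abs_summable_on_comparison_test'[OF summable_on_subset[OF sb]])
       (use w1 in \<open>auto simp: norm_mult mult_left_le\<close>)
  have "A = infsum (\<lambda>k'. b k' * (\<Prod>x\<in>X. w k' x)) K + infsum (\<lambda>k'. b k' * (\<Prod>x\<in>X. w k' x)) (?I - K)"
  proof -
    have "?I = K \<union> (?I - K)" using K by auto
    then have "A = infsum (\<lambda>k'. b k' * (\<Prod>x\<in>X. w k' x)) (K \<union> (?I - K))"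
      using hs by (simp add: infsumI)
    also have "\<dots> = infsum (\<lambda>k'. b k' * (\<Prod>x\<in>X. w k' x)) K + infsum (\<lambda>k'. b k' * (\<Prod>x\<in>X. w k' x)) (?I - K)"
      using K abs_summable_summable[OF sbw] by (intro infsum_Un_disjoint) auto
    finally show ?thesis .
  qed
  also have "infsum (\<lambda>k'. b k' * (\<Prod>x\<in>X. w k' x)) K = (\<Sum>k'\<in>K. b k' * (\<Prod>x\<in>X. w k' x))"
    using K by simp
  also have "\<dots> = (\<Sum>k'\<in>{k}. b k' * (\<Prod>x\<in>X. w k' x))"
    using K w0 by (intro sum.mono_neutral_right) auto
  also have "\<dots> = b k" using wk by simp
  finally have "b k = A - infsum (\<lambda>k'. b k' * (\<Prod>x\<in>X. w k' x)) (?I - K)" by simp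
  then have "norm (b k) \<le> norm A + norm (infsum (\<lambda>k'. b k' * (\<Prod>x\<in>X. w k' x)) (?I - K))"
    by (simp add: norm_triangle_ineq4)
  also have "norm (infsum (\<lambda>k'. b k' * (\<Prod>x\<in>X. w k' x)) (?I - K)) \<le> infsum (\<lambda>k'. norm (b k' * (\<Prod>x\<in>X. w k' x))) (?I - K)"
    by (rule norm_infsum_bound[OF sbw])
  also have "\<dots> \<le> infsum (\<lambda>k. norm (b k)) (?I - K)"
    by (rule infsum_mono[OF sbw summable_on_subset[OF sb]]) (use w1 in \<open>auto simp: norm_mult mult_left_le\<close>)
  also have "\<dots> \<le> \<eta>" by (rule tail)
  finally show "norm (a k) * (\<Prod>x\<in>X. \<rho> x ^ k x) \<le> M + \<eta>"
    using AM by (simp add: nb)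
qed

text \<open>The difference of the two series sums to 0 on the torus, so Cauchy's estimate holds for
  it with the bound 0.\<close>

lemma power_series_unique:
  fixes a b :: "('a \<Rightarrow> nat) \<Rightarrow> complex" and \<rho> :: "'a \<Rightarrow> real"
  assumes X: "finite X" and \<rho>: "\<And>x. x \<in> X \<Longrightarrow> \<rho> x > 0"
    and a: "\<And>t. (\<And>x. x \<in> X \<Longrightarrow> norm (t x) = \<rho> x) \<Longrightarrow>
         ((\<lambda>k. a k * (\<Prod>x\<in>X. t x ^ k x)) has_sum G t) (multi_indices X)"
    and b: "\<And>t. (\<And>x. x \<in> X \<Longrightarrow> norm (t x) = \<rho> x) \<Longrightarrow>
         ((\<lambda>k. b k * (\<Prod>x\<in>X. t x ^ k x)) has_sum G t) (multi_indices X)"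
    and k: "k \<in> multi_indices X"
  shows "a k = b k"
proof -
  have d: "((\<lambda>k. (a k - b k) * (\<Prod>x\<in>X. t x ^ k x)) has_sum 0) (multi_indices X)"
    if t: "\<And>x. x \<in> X \<Longrightarrow> norm (t x) = \<rho> x" for t
    using has_sum_add[OF a[OF t] has_sum_uminusI[OF b[OF t]]] by (simp add: algebra_simps)
  have "norm (a k - b k) * (\<Prod>x\<in>X. \<rho> x ^ k x) \<le> 0"
  proof (rule cauchy_estimate[OF X \<rho> _ _ k])
    have "(\<lambda>k. (a k - b k) * (\<Prod>x\<in>X. of_real (\<rho> x) ^ k x)) summable_on multi_indices X"
      using d[of "\<lambda>x. of_real (\<rho> x)"] \<rho> has_sum_imp_summable by (auto simp: abs_of_pos)
    then have "(\<lambda>k. norm ((a k - b k) * (\<Prod>x\<in>X. of_real (\<rho> x) ^ k x))) summable_on multi_indices X"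
      by (rule summable_on_iff_abs_summable_on_complex[THEN iffD1])
    moreover have "norm ((a k - b k) * (\<Prod>x\<in>X. of_real (\<rho> x) ^ k x)) = norm (a k - b k) * (\<Prod>x\<in>X. \<rho> x ^ k x)" for k
      unfolding norm_mult prod_norm[symmetric]
      by (rule arg_cong[where f = "\<lambda>z. _ * z"], rule prod.cong) (use \<rho> in \<open>auto simp: norm_power abs_of_pos\<close>)
    ultimately show "(\<lambda>k. norm (a k - b k) * (\<Prod>x\<in>X. \<rho> x ^ k x)) summable_on multi_indices X" by simp
    show "((\<lambda>k. (a k - b k) * (\<Prod>x\<in>X. t x ^ k x)) has_sum (\<lambda>_. 0) t) (multi_indices X) \<and> norm ((\<lambda>_. 0::complex) t) \<le> 0"
      if "\<And>x. x \<in> X \<Longrightarrow> norm (t x) = \<rho> x" for t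
      using d[OF that] by simp
  qed
  moreover have "(\<Prod>x\<in>X. \<rho> x ^ k x) > 0" using \<rho> by (intro prod_pos) auto
  ultimately show ?thesis by (simp add: mult_le_0_iff)
qed

text \<open>Uniform convergence on the torus and Cauchy's estimate make the coefficients, weighted
  by the monomials in \<rho>, Cauchy uniformly in k. Inside the polydisc a geometric series
  dominates, so the limits c give a convergent series, and the pointwise limit at points of R
  identifies its sum. R stands for the points where a formula for the functions is valid; the
  polydisc may contain others.\<close>

lemma power_series_limit:
  fixes a :: "nat \<Rightarrow> ('a \<Rightarrow> nat) \<Rightarrow> complex" and \<rho> :: "'a \<Rightarrow> real" and F :: "nat \<Rightarrow> ('a \<Rightarrow> complex) \<Rightarrow> complex"
  assumes X: "finite X" and \<rho>: "\<And>x. x \<in> X \<Longrightarrow> \<rho> x > 0"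
    and summ: "\<And>n. (\<lambda>k. norm (a n k) * (\<Prod>x\<in>X. \<rho> x ^ k x)) summable_on multi_indices X"
    and F: "\<And>n t. t \<in> R \<Longrightarrow> (\<And>x. x \<in> X \<Longrightarrow> norm (t x) \<le> \<rho> x) \<Longrightarrow>
         ((\<lambda>k. a n k * (\<Prod>x\<in>X. t x ^ k x)) has_sum F n t) (multi_indices X)"
    and T: "{t. \<forall>x\<in>X. norm (t x) = \<rho> x} \<subseteq> R"
    and ul: "uniform_limit {t. \<forall>x\<in>X. norm (t x) = \<rho> x} F G sequentially"
    and lim: "\<And>t. t \<in> R \<Longrightarrow> (\<And>x. x \<in> X \<Longrightarrow> norm (t x) < \<rho> x) \<Longrightarrow> (\<lambda>n. F n t) \<longlonglongrightarrow> G t"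
  obtains c where "\<And>k. k \<in> multi_indices X \<Longrightarrow> (\<lambda>n. a n k) \<longlonglongrightarrow> c k"
    and "\<And>t. t \<in> R \<Longrightarrow> (\<And>x. x \<in> X \<Longrightarrow> norm (t x) < \<rho> x) \<Longrightarrow>
        ((\<lambda>k. c k * (\<Prod>x\<in>X. t x ^ k x)) has_sum G t) (multi_indices X)"
proof -
  let ?I = "multi_indices X"
  have rpos: "(\<Prod>x\<in>X. \<rho> x ^ k x) > 0" for k using \<rho> by (intro prod_pos) auto
  have cau: "\<exists>N. \<forall>m\<ge>N. \<forall>n\<ge>N. \<forall>k\<in>?I. norm (a m k - a n k) * (\<Prod>x\<in>X. \<rho> x ^ k x) \<le> e" if e: "e > 0" for e
  proof -
    obtain N where N: "\<And>n t. n \<ge> N \<Longrightarrow> (\<forall>x\<in>X. norm (t x) = \<rho> x) \<Longrightarrow> dist (F n t) (G t) < e / 2"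
      using uniform_limitD[OF ul, of "e / 2"] e unfolding eventually_sequentially by auto
    have "norm (a m k - a n k) * (\<Prod>x\<in>X. \<rho> x ^ k x) \<le> e" if mn: "m \<ge> N" "n \<ge> N" and k: "k \<in> ?I" for m n k
    proof (rule cauchy_estimate[OF X \<rho> _ _ k])
      show "(\<lambda>k. norm (a m k - a n k) * (\<Prod>x\<in>X. \<rho> x ^ k x)) summable_on ?I"
      proof (rule summable_on_comparison_test[OF summable_on_add[OF summ[of m] summ[of n]]])
        fix k
        show "norm (a m k - a n k) * (\<Prod>x\<in>X. \<rho> x ^ k x) \<le>
          norm (a m k) * (\<Prod>x\<in>X. \<rho> x ^ k x) + norm (a n k) * (\<Prod>x\<in>X. \<rho> x ^ k x)"
          using rpos[of k] norm_triangle_ineq4[of "a m k" "a n k"]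
          by (simp flip: distrib_right)
      qed (use rpos in \<open>simp add: less_imp_le\<close>)
      fix t :: "'a \<Rightarrow> complex" assume t: "\<And>x. x \<in> X \<Longrightarrow> norm (t x) = \<rho> x"
      then have tR: "t \<in> R" using T by auto
      have "((\<lambda>k. a m k * (\<Prod>x\<in>X. t x ^ k x) + - (a n k * (\<Prod>x\<in>X. t x ^ k x))) has_sum (F m t + - F n t)) ?I"
        using t tR by (intro has_sum_add has_sum_uminusI F) auto
      then have "((\<lambda>k. (a m k - a n k) * (\<Prod>x\<in>X. t x ^ k x)) has_sum (F m t - F n t)) ?I"
        by (simp add: algebra_simps)
      moreover have "norm (F m t - F n t) \<le> e"
        using N[of m t] N[of n t] mn t dist_triangle_half_l[of "F m t" "G t" e "F n t"]
        by (simp add: dist_norm)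
      ultimately show "((\<lambda>k. (a m k - a n k) * (\<Prod>x\<in>X. t x ^ k x)) has_sum (\<lambda>t. F m t - F n t) t) ?I \<and>
         norm ((\<lambda>t. F m t - F n t) t) \<le> e" by simp
    qed
    then show ?thesis by blast
  qed
  have conv: "convergent (\<lambda>n. a n k)" if k: "k \<in> ?I" for k
  proof (rule Cauchy_convergent, rule CauchyI)
    fix e :: real assume e: "e > 0"
    let ?r = "\<Prod>x\<in>X. \<rho> x ^ k x"
    obtain N where N: "\<forall>m\<ge>N. \<forall>n\<ge>N. \<forall>k\<in>?I. norm (a m k - a n k) * (\<Prod>x\<in>X. \<rho> x ^ k x) \<le> e / 2 * ?r"
      using cau[of "e / 2 * ?r"] e rpos[of k] by auto
    have "norm (a m k - a n k) < e" if "m \<ge> N" "n \<ge> N" for m n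
    proof -
      have "norm (a m k - a n k) * ?r \<le> e / 2 * ?r" using N that k by blast
      then have "norm (a m k - a n k) \<le> e / 2" using rpos[of k] by (simp only: mult_le_cancel_right_pos)
      then show ?thesis using e by simp
    qed
    then show "\<exists>M. \<forall>m\<ge>M. \<forall>n\<ge>M. norm (a m k - a n k) < e" by blast
  qed
  define c where "c = (\<lambda>k. lim (\<lambda>n. a n k))"
  have c: "(\<lambda>n. a n k) \<longlonglongrightarrow> c k" if "k \<in> ?I" for k
    using conv[OF that] by (simp add: c_def convergent_LIMSEQ_iff)
  have ac: "\<exists>N. \<forall>n\<ge>N. \<forall>k\<in>?I. norm (a n k - c k) * (\<Prod>x\<in>X. \<rho> x ^ k x) \<le> e" if e: "e > 0" for e
  proof -
    obtain N where N: "\<forall>m\<ge>N. \<forall>n\<ge>N. \<forall>k\<in>?I. norm (a m k - a n k) * (\<Prod>x\<in>X. \<rho> x ^ k x) \<le> e"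
      using cau[OF e] by blast
    have "norm (a n k - c k) * (\<Prod>x\<in>X. \<rho> x ^ k x) \<le> e" if "n \<ge> N" "k \<in> ?I" for n k
    proof (rule tendsto_upperbound)
      show "(\<lambda>m. norm (a n k - a m k) * (\<Prod>x\<in>X. \<rho> x ^ k x)) \<longlonglongrightarrow> norm (a n k - c k) * (\<Prod>x\<in>X. \<rho> x ^ k x)"
        by (intro tendsto_intros c that)
      show "eventually (\<lambda>m. norm (a n k - a m k) * (\<Prod>x\<in>X. \<rho> x ^ k x) \<le> e) sequentially"
        using N that unfolding eventually_sequentially by blast
    qed simp
    then show ?thesis by blast
  qed
  have res: "((\<lambda>k. c k * (\<Prod>x\<in>X. t x ^ k x)) has_sum G t) ?I"
    if tR: "t \<in> R" and t: "\<And>x. x \<in> X \<Longrightarrow> norm (t x) < \<rho> x" for t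
  proof -
    \<comment> \<open>The ratios of the monomials at t to those on the torus; they are summable
      because t lies strictly inside.\<close>
    define Q where "Q = (\<lambda>k. \<Prod>x\<in>X. (norm (t x) / \<rho> x) ^ k x)"
    have Qs: "Q summable_on ?I"
      unfolding Q_def by (rule geometric_multi_summable[OF X]) (use \<rho> t in \<open>auto simp: divide_simps\<close>)
    have Q0: "Q k \<ge> 0" for k unfolding Q_def by (rule prod_nonneg) (auto simp: \<rho> less_imp_le)
    have tQ: "norm (\<Prod>x\<in>X. t x ^ k x) = (\<Prod>x\<in>X. \<rho> x ^ k x) * Q k" for k
      unfolding Q_def prod.distrib[symmetric] prod_norm[symmetric]
      by (rule prod.cong) (auto simp: norm_power power_divide dest!: \<rho>)
    have bd: "norm ((a n k - c k) * (\<Prod>x\<in>X. t x ^ k x)) \<le> e * Q k"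
      if "norm (a n k - c k) * (\<Prod>x\<in>X. \<rho> x ^ k x) \<le> e" for n k e
      using mult_right_mono[OF that Q0[of k]] by (simp add: norm_mult tQ mult_ac)
    have Ft: "((\<lambda>k. a n k * (\<Prod>x\<in>X. t x ^ k x)) has_sum F n t) ?I" for n
      using tR t by (intro F) (auto simp: less_imp_le)
    have dsum: "(\<lambda>k. (a n k - c k) * (\<Prod>x\<in>X. t x ^ k x)) summable_on ?I \<and>
         norm (infsum (\<lambda>k. (a n k - c k) * (\<Prod>x\<in>X. t x ^ k x)) ?I) \<le> e * infsum Q ?I"
      if "\<forall>k\<in>?I. norm (a n k - c k) * (\<Prod>x\<in>X. \<rho> x ^ k x) \<le> e" for n e
    proof -
      have s: "(\<lambda>k. norm ((a n k - c k) * (\<Prod>x\<in>X. t x ^ k x))) summable_on ?I"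
        by (rule Infinite_Sum.abs_summable_on_comparison_test'[OF summable_on_cmult_right[OF Qs, of e]])
           (use bd that in auto)
      have "norm (infsum (\<lambda>k. (a n k - c k) * (\<Prod>x\<in>X. t x ^ k x)) ?I) \<le> infsum (\<lambda>k. e * Q k) ?I"
        by (rule order_trans[OF norm_infsum_bound[OF s] infsum_mono[OF s summable_on_cmult_right[OF Qs]]])
           (use bd that in auto)
      then show ?thesis using abs_summable_summable[OF s] Qs by (simp add: infsum_cmult_right)
    qed
    obtain N where N: "\<forall>n\<ge>N. \<forall>k\<in>?I. norm (a n k - c k) * (\<Prod>x\<in>X. \<rho> x ^ k x) \<le> 1"
      using ac[of 1] by auto
    have "(\<lambda>k. (a N k - c k) * (\<Prod>x\<in>X. t x ^ k x)) summable_on ?I"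
      using dsum N by blast
    from summable_on_add[OF has_sum_imp_summable[OF Ft[of N]] summable_on_uminus[THEN iffD2, OF this]]
    have csum: "(\<lambda>k. c k * (\<Prod>x\<in>X. t x ^ k x)) summable_on ?I"
      by (simp add: algebra_simps)
    define C where "C = infsum (\<lambda>k. c k * (\<Prod>x\<in>X. t x ^ k x)) ?I"
    have C: "((\<lambda>k. c k * (\<Prod>x\<in>X. t x ^ k x)) has_sum C) ?I"
      using csum by (simp add: C_def)
    have diff: "infsum (\<lambda>k. (a n k - c k) * (\<Prod>x\<in>X. t x ^ k x)) ?I = F n t - C" for n
      using has_sum_add[OF Ft has_sum_uminusI[OF C], of n] by (intro infsumI) (simp add: algebra_simps)
    have "(\<lambda>n. F n t) \<longlonglongrightarrow> C"
    proof (rule LIMSEQ_I)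
      fix e :: real assume e: "e > 0"
      define B where "B = infsum Q ?I + 1"
      have B: "B > 0" "infsum Q ?I < B" using infsum_nonneg[of ?I Q] Q0 by (auto simp: B_def)
      obtain N where N: "\<forall>n\<ge>N. \<forall>k\<in>?I. norm (a n k - c k) * (\<Prod>x\<in>X. \<rho> x ^ k x) \<le> e / B"
        using ac[of "e / B"] e B by auto
      have "norm (F n t - C) < e" if "n \<ge> N" for n
      proof -
        have "norm (F n t - C) \<le> e / B * infsum Q ?I"
          using dsum[of n "e / B"] N that unfolding diff by blast
        also have "\<dots> < e" using e B by (simp add: field_simps)
        finally show ?thesis .
      qed
      then show "\<exists>no. \<forall>n\<ge>no. norm (F n t - C) < e" by blast
    qed
    then have "C = G t" using lim[OF tR t] LIMSEQ_unique by blast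
    then show ?thesis using C by simp
  qed
  show ?thesis using that[OF c res] by blast
qed

text \<open>Radii that decrease fast enough make each form dominated by its largest variable.\<close>

lemma generic_torus:
  fixes L :: "('a \<Rightarrow> complex) set"
  assumes "finite X" "finite L" "\<And>c. c \<in> L \<Longrightarrow> \<exists>x\<in>X. c x \<noteq> 0" "(r::real) > 0"
  shows "\<exists>\<rho>. (\<forall>x\<in>X. 0 < \<rho> x \<and> \<rho> x < r) \<and>
     (\<forall>c\<in>L. \<exists>\<eta>>0. \<forall>t. (\<forall>x\<in>X. norm (t x) = \<rho> x) \<longrightarrow> norm (\<Sum>x\<in>X. c x * t x) \<ge> \<eta>)"
  using assms
proof (induction X arbitrary: L r rule: finite_induct)
  case empty
  then have "L = {}" by auto
  then show ?case by auto
next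
  case (insert y X)
  define L0 where "L0 = {c \<in> L. c y = 0}"
  define L1 where "L1 = {c \<in> L. c y \<noteq> 0}"
  have fin: "finite L0" "finite L1" using insert.prems by (auto simp: L0_def L1_def)
  \<comment> \<open>The variable y receives the radius r/2, the others radii below d. In a form
    involving y the term c_y t_y then has modulus |c_y| r/2 and exceeds the rest by at least |c_y|
    r/4; forms without y are left to the induction hypothesis.\<close>
  have "eventually (\<lambda>d. \<forall>c\<in>L1. d * (\<Sum>x\<in>X. norm (c x)) < norm (c y) * r / 4) (at_right 0)"
  proof (rule eventually_ball_finite[OF fin(2)], rule ballI)
    fix c assume c: "c \<in> L1"
    have "((\<lambda>d. d * (\<Sum>x\<in>X. norm (c x))) \<longlongrightarrow> 0 * (\<Sum>x\<in>X. norm (c x))) (at_right 0)"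
      by (intro tendsto_intros)
    then show "eventually (\<lambda>d. d * (\<Sum>x\<in>X. norm (c x)) < norm (c y) * r / 4) (at_right 0)"
      by (rule order_tendstoD) (use c insert.prems in \<open>auto simp: L1_def\<close>)
  qed
  moreover have "eventually (\<lambda>d. d < r) (at_right 0)" "eventually (\<lambda>d. (d::real) > 0) (at_right 0)"
    using insert.prems by (auto simp: eventually_at_right_less intro: order_tendstoD[OF tendsto_ident_at])
  ultimately have "eventually (\<lambda>d. d > 0 \<and> d < r \<and> (\<forall>c\<in>L1. d * (\<Sum>x\<in>X. norm (c x)) < norm (c y) * r / 4)) (at_right 0)"
    by eventually_elim auto
  then obtain d where d: "d > 0" "d < r" "\<And>c. c \<in> L1 \<Longrightarrow> d * (\<Sum>x\<in>X. norm (c x)) < norm (c y) * r / 4"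
    using eventually_happens[of _ "at_right (0::real)"] trivial_limit_at_right_real by blast
  have "\<exists>x\<in>X. c x \<noteq> 0" if "c \<in> L0" for c
    using insert.prems(2)[of c] that by (auto simp: L0_def)
  from insert.IH[OF fin(1) this d(1)] obtain \<rho> where
    \<rho>: "\<forall>x\<in>X. 0 < \<rho> x \<and> \<rho> x < d" and
    \<eta>: "\<forall>c\<in>L0. \<exists>\<eta>>0. \<forall>t. (\<forall>x\<in>X. norm (t x) = \<rho> x) \<longrightarrow> norm (\<Sum>x\<in>X. c x * t x) \<ge> \<eta>" by blast
  show ?case
  proof (intro exI[of _ "\<rho>(y := r / 2)"] conjI ballI)
    fix x assume "x \<in> insert y X"
    then show "0 < (\<rho>(y := r / 2)) x" "(\<rho>(y := r / 2)) x < r"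
      using \<rho> d insert.prems(3) by auto
  next
    fix c assume c: "c \<in> L"
    have sum_eq: "(\<Sum>x\<in>insert y X. c x * t x) = c y * t y + (\<Sum>x\<in>X. c x * t x)" for t :: "'a \<Rightarrow> complex"
      using insert.hyps by simp
    have restr: "\<forall>x\<in>X. norm (t x) = \<rho> x" "norm (t y) = r / 2"
      if "\<forall>x\<in>insert y X. norm (t x) = (\<rho>(y := r / 2)) x" for t :: "'a \<Rightarrow> complex"
      using that insert.hyps(2) by force+
    show "\<exists>\<eta>>0. \<forall>t. (\<forall>x\<in>insert y X. norm (t x) = (\<rho>(y := r / 2)) x) \<longrightarrow> \<eta> \<le> norm (\<Sum>x\<in>insert y X. c x * t x)"
    proof (cases "c y = 0")
      case True
      then obtain e where e: "e > 0" "\<And>t. (\<forall>x\<in>X. norm (t x) = \<rho> x) \<Longrightarrow> norm (\<Sum>x\<in>X. c x * t x) \<ge> e"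
        using \<eta> c unfolding L0_def by blast
      show ?thesis
      proof (intro exI[of _ e] conjI allI impI)
        fix t :: "'a \<Rightarrow> complex" assume t: "\<forall>x\<in>insert y X. norm (t x) = (\<rho>(y := r / 2)) x"
        then show "e \<le> norm (\<Sum>x\<in>insert y X. c x * t x)"
          using e(2)[OF restr(1)[OF t]] True unfolding sum_eq by simp
      qed (rule e)
    next
      case False
      then have cL: "c \<in> L1" using c by (simp add: L1_def)
      show ?thesis
      proof (intro exI[of _ "norm (c y) * r / 4"] conjI allI impI)
        show "0 < norm (c y) * r / 4" using False insert.prems(3) by simp
        fix t :: "'a \<Rightarrow> complex" assume t: "\<forall>x\<in>insert y X. norm (t x) = (\<rho>(y := r / 2)) x"
        have "norm (\<Sum>x\<in>X. c x * t x) \<le> (\<Sum>x\<in>X. norm (c x * t x))" by (rule norm_sum)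
        also have "\<dots> \<le> (\<Sum>x\<in>X. d * norm (c x))"
        proof (rule sum_mono)
          fix x assume x: "x \<in> X"
          then have "norm (t x) \<le> d" using restr(1)[OF t] \<rho> by (simp add: less_imp_le)
          then show "norm (c x * t x) \<le> d * norm (c x)"
            by (simp add: norm_mult mult.commute[of d] mult_left_mono)
        qed
        also have "\<dots> = d * (\<Sum>x\<in>X. norm (c x))" by (simp add: sum_distrib_left)
        also have "\<dots> < norm (c y) * r / 4" by (rule d(3)[OF cL])
        finally have "norm (\<Sum>x\<in>X. c x * t x) < norm (c y) * r / 4" .
        moreover have "norm (c y * t y) = norm (c y) * r / 2" using restr(2)[OF t] by (simp add: norm_mult)
        moreover have "norm (c y * t y) - norm (\<Sum>x\<in>X. c x * t x) \<le> norm (c y * t y + (\<Sum>x\<in>X. c x * t x))"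
          by (rule norm_diff_ineq)
        ultimately show "norm (c y) * r / 4 \<le> norm (\<Sum>x\<in>insert y X. c x * t x)"
          unfolding sum_eq by linarith
      qed
    qed
  qed
qed

section \<open>Root systems and Weyl chambers\<close>

lemma inner_eq_on_basis:
  fixes x y :: "'a::euclidean_space"
  assumes "span B = UNIV" "\<And>b. b \<in> B \<Longrightarrow> b \<bullet> x = b \<bullet> y"
  shows "x = y"
proof -
  have "z \<bullet> (x - y) = 0" if "z \<in> span B" for z
    using that
    by (induction rule: span_induct) (auto simp: subspace_def inner_simps assms(2))
  then have "(x - y) \<bullet> (x - y) = 0" using assms(1) by blast
  then show ?thesis by simp
qed

text \<open>A linear functional with the prescribed values on B is represented, as in Riesz's
  theorem, through its values on the standard basis.\<close>

lemma dual_vector_exists: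
  fixes B :: "'a::euclidean_space set" and f :: "'a \<Rightarrow> real"
  assumes "independent B"
  shows "\<exists>m. \<forall>b\<in>B. b \<bullet> m = f b"
proof -
  obtain g where g: "linear g" "\<forall>b\<in>B. g b = f b"
    using linear_independent_extend[OF assms, of f] by blast
  have "b \<bullet> (\<Sum>i\<in>Basis. g i *\<^sub>R i) = f b" if "b \<in> B" for b
  proof -
    have "b \<bullet> (\<Sum>i\<in>Basis. g i *\<^sub>R i) = (\<Sum>i\<in>Basis. (b \<bullet> i) * g i)"
      by (simp add: inner_sum_right mult.commute)
    also have "\<dots> = g (\<Sum>i\<in>Basis. (b \<bullet> i) *\<^sub>R i)"
      using g(1) by (simp add: linear_sum linear_scale)
    also have "\<dots> = f b" using g that by (simp add: euclidean_representation)
    finally show ?thesis .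
  qed
  then show ?thesis by blast
qed

lemma finite_independent: "independent (B :: 'a::euclidean_space set) \<Longrightarrow> finite B"
  by (rule independent_imp_finite)

lemma coroot_inner: "rs_coroot a \<bullet> x = 2 * (a \<bullet> x) / (a \<bullet> a)"
  by (simp add: rs_coroot_def)

lemma coroot_inner_sgn:
  assumes "a \<noteq> 0"
  shows "rs_coroot a \<bullet> x > 0 \<longleftrightarrow> a \<bullet> x > 0" "rs_coroot a \<bullet> x = 0 \<longleftrightarrow> a \<bullet> x = 0"
proof -
  have "a \<bullet> a > 0" using assms by simp
  then show "rs_coroot a \<bullet> x > 0 \<longleftrightarrow> a \<bullet> x > 0" "rs_coroot a \<bullet> x = 0 \<longleftrightarrow> a \<bullet> x = 0"
    using assms inner_ge_zero[of a] by (auto simp: coroot_inner zero_less_divide_iff simp del: inner_ge_zero)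
qed

text \<open>Resolves the definite description: independence of B gives a dual vector, and spanning
  makes it unique. Its inner product with b itself is half the squared length of b, which cancels
  the normalization of \<open>rs_coroot\<close>.\<close>

lemma mu_V_inner:
  assumes B: "independent B" "span B = UNIV" and b: "b \<in> B" "b' \<in> B"
  shows "rs_coroot b' \<bullet> mu_V B b = (if b' = b then 1 else 0)"
proof -
  have nz: "c \<noteq> 0" if "c \<in> B" for c using B(1) that dependent_zero by blast
  obtain m where m: "\<And>c. c \<in> B \<Longrightarrow> c \<bullet> m = (if c = b then (c \<bullet> c) / 2 else 0)"
    using dual_vector_exists[OF B(1), of "\<lambda>c. if c = b then (c \<bullet> c) / 2 else 0"] by auto
  have "mu_V B b = m"
    unfolding mu_V_def
  proof (rule the_equality)
    show "\<forall>c\<in>B. rs_coroot c \<bullet> m = (if c = b then 1 else 0)"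
      using m nz by (auto simp: coroot_inner)
    fix m' assume m': "\<forall>c\<in>B. rs_coroot c \<bullet> m' = (if c = b then 1 else 0)"
    show "m' = m"
    proof (rule inner_eq_on_basis[OF B(2)])
      fix c assume c: "c \<in> B"
      then show "c \<bullet> m' = c \<bullet> m" using m[OF c] m' nz[OF c] by (auto simp: coroot_inner field_simps split: if_splits)
    qed
  qed
  then show ?thesis using m[OF b(2)] nz[OF b(2)] by (auto simp: coroot_inner)
qed

lemma mu_V_expand:
  assumes B: "independent B" "span B = UNIV"
  shows "x = (\<Sum>b\<in>B. (x \<bullet> mu_V B b) *\<^sub>R rs_coroot b)" (is "x = ?y")
    and "l = (\<Sum>b\<in>B. (rs_coroot b \<bullet> l) *\<^sub>R mu_V B b)" (is "l = ?m")
proof -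
  have fin: "finite B" using B(1) by (rule finite_independent)
  have nz: "c \<noteq> 0" if "c \<in> B" for c using B(1) that dependent_zero by blast
  have 1: "rs_coroot c \<bullet> (\<Sum>b\<in>B. (rs_coroot b \<bullet> l) *\<^sub>R mu_V B b) = rs_coroot c \<bullet> l" if c: "c \<in> B" for c l
    using mu_V_inner[OF B _ c] fin c by (simp add: inner_sum_right if_distrib[of "(*) _"] cong: if_cong sum.cong)
  have 2: "l = (\<Sum>b\<in>B. (rs_coroot b \<bullet> l) *\<^sub>R mu_V B b)" for l
  proof (rule inner_eq_on_basis[OF B(2)])
    fix c assume c: "c \<in> B"
    show "c \<bullet> l = c \<bullet> (\<Sum>b\<in>B. (rs_coroot b \<bullet> l) *\<^sub>R mu_V B b)"
      using 1[OF c, of l] nz[OF c] by (simp add: coroot_inner)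
  qed
  then show "l = ?m" .
  have "z \<bullet> x = z \<bullet> ?y" for z
  proof -
    have "z \<bullet> x = (\<Sum>b\<in>B. (rs_coroot b \<bullet> z) *\<^sub>R mu_V B b) \<bullet> x" using 2[of z] by simp
    also have "\<dots> = z \<bullet> ?y" by (simp add: inner_sum_left inner_sum_right inner_commute mult.commute)
    finally show ?thesis .
  qed
  then show "x = ?y" using vector_eq_ldot by blast
qed

section \<open>Reflections and words of reflections\<close>

lemma refl_linear: "linear (rs_refl a)"
  by (rule linearI) (simp_all add: rs_refl_def inner_simps algebra_simps)

lemma refl_inner: "a \<noteq> 0 \<Longrightarrow> rs_refl a x \<bullet> rs_refl a y = x \<bullet> y"
  by (simp add: rs_refl_def coroot_inner inner_diff_left inner_diff_right inner_commute[of x a] inner_commute[of y a] field_simps)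

lemma refl_refl: "a \<noteq> 0 \<Longrightarrow> rs_refl a (rs_refl a x) = x"
  by (simp add: rs_refl_def coroot_inner inner_simps)

lemma refl_inner_swap: "a \<noteq> 0 \<Longrightarrow> rs_refl a x \<bullet> y = x \<bullet> rs_refl a y"
  using refl_inner[of a x "rs_refl a y"] refl_refl[of a y] by simp

lemma refl_self: "a \<noteq> 0 \<Longrightarrow> rs_refl a a = - a"
  by (simp add: rs_refl_def coroot_inner) (simp add: algebra_simps flip: scaleR_left_distrib, simp add: scaleR_2)

text \<open>Words are lists rather than maps, since the deletion argument works with the length of a
  word.\<close>

definition word_map :: "'a::euclidean_space list \<Rightarrow> 'a \<Rightarrow> 'a" where
  "word_map xs = foldr (\<lambda>s f. rs_refl s \<circ> f) xs id"

lemma word_map_simps [simp]: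
  "word_map [] = id" "word_map (s # xs) = rs_refl s \<circ> word_map xs"
  "word_map (xs @ ys) = word_map xs \<circ> word_map ys"
proof -
  show "word_map (xs @ ys) = word_map xs \<circ> word_map ys"
    by (induction xs) (auto simp: word_map_def)
qed (simp_all add: word_map_def)

text \<open>The coordinate along s in the basis S, written as a pairing so that linearity is
  immediate.\<close>

definition coeff_S :: "'a::euclidean_space set \<Rightarrow> 'a \<Rightarrow> 'a \<Rightarrow> real" where
  "coeff_S S s x = fund_coweight S s \<bullet> x"

section \<open>Simple roots and positivity\<close>

locale based_root_system =
  fixes D S :: "'a::euclidean_space set"
  assumes rs: "root_system D" and red: "reduced_rs D" and fs: "fundamental_system D S"
begin

lemma finD: "finite D" and zero_notin: "0 \<notin> D" and spanD: "span D = UNIV"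
  and refl_closed: "a \<in> D \<Longrightarrow> b \<in> D \<Longrightarrow> rs_refl a b \<in> D"
  and cartan_int: "a \<in> D \<Longrightarrow> b \<in> D \<Longrightarrow> rs_coroot a \<bullet> b \<in> \<int>"
  using rs by (auto simp: root_system_def)

lemma nz: "a \<in> D \<Longrightarrow> a \<noteq> 0" using zero_notin by auto

lemma uminus_closed: "a \<in> D \<Longrightarrow> - a \<in> D"
  using refl_closed[of a a] refl_self[of a] nz by simp

lemma SD: "S \<subseteq> D" and indS: "independent S" using fs by (auto simp: fundamental_system_def)

lemma finS: "finite S" using SD finD finite_subset by blast

lemma spanS: "span S = UNIV"
proof -
  have "D \<subseteq> span S"
  proof
    fix a assume "a \<in> D"
    then obtain n :: "'a \<Rightarrow> int" where "a = (\<Sum>s\<in>S. of_int (n s) *\<^sub>R s)"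
      using fs by (auto simp: fundamental_system_def)
    then show "a \<in> span S" by (simp add: span_sum span_scale span_base)
  qed
  then have "span D \<subseteq> span S" by (simp add: span_minimal subspace_span)
  then show ?thesis using spanD by auto
qed

lemma fund_coweight_inner:
  assumes "s \<in> S" "s' \<in> S"
  shows "fund_coweight S s \<bullet> s' = (if s' = s then 1 else 0)"
proof -
  obtain m where m: "\<And>c. c \<in> S \<Longrightarrow> c \<bullet> m = (if c = s then 1 else 0)"
    using dual_vector_exists[OF indS, of "\<lambda>c. if c = s then 1 else 0"] by auto
  have "fund_coweight S s = m"
    unfolding fund_coweight_def
  proof (rule the_equality)
    show "\<forall>c\<in>S. m \<bullet> c = (if c = s then 1 else 0)" using m by (auto simp: inner_commute)
    fix m' assume "\<forall>c\<in>S. m' \<bullet> c = (if c = s then 1 else 0)"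
    then show "m' = m" using m by (intro inner_eq_on_basis[OF spanS]) (auto simp: inner_commute)
  qed
  then show ?thesis using m[OF assms(2)] by (simp add: inner_commute)
qed

lemma coeff_sum:
  assumes "s \<in> S"
  shows "coeff_S S s (\<Sum>s\<in>S. n s *\<^sub>R s) = n s"
  unfolding coeff_S_def inner_sum_right inner_scaleR_right
  using fund_coweight_inner[OF assms] finS assms by (simp add: if_distrib[of "(*) _"] cong: if_cong sum.cong)

lemma expandS: "x = (\<Sum>s\<in>S. coeff_S S s x *\<^sub>R s)"
proof -
  have "x \<in> span S" using spanS by simp
  then obtain u where u: "x = (\<Sum>s\<in>S. u s *\<^sub>R s)"
    using span_finite[OF finS] by auto
  have "(\<Sum>s\<in>S. coeff_S S s x *\<^sub>R s) = (\<Sum>s\<in>S. u s *\<^sub>R s)"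
    by (rule sum.cong) (use coeff_sum u in auto)
  then show ?thesis using u by simp
qed

lemma coeff_diff: "coeff_S S s (x - y) = coeff_S S s x - coeff_S S s y"
  and coeff_scale: "coeff_S S s (c *\<^sub>R x) = c * coeff_S S s x"
  and coeff_uminus: "coeff_S S s (- x) = - coeff_S S s x"
  by (simp_all add: coeff_S_def inner_simps)

lemma coeff_simple: "s \<in> S \<Longrightarrow> s' \<in> S \<Longrightarrow> coeff_S S s s' = (if s' = s then 1 else 0)"
  using fund_coweight_inner by (simp add: coeff_S_def)

lemma root_coeffs:
  assumes "a \<in> D"
  shows "(\<forall>s\<in>S. coeff_S S s a \<in> \<int>) \<and> ((\<forall>s\<in>S. coeff_S S s a \<ge> 0) \<or> (\<forall>s\<in>S. coeff_S S s a \<le> 0))"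
proof -
  obtain n :: "'a \<Rightarrow> int" where "a = (\<Sum>s\<in>S. of_int (n s) *\<^sub>R s)" "(\<forall>s\<in>S. n s \<ge> 0) \<or> (\<forall>s\<in>S. n s \<le> 0)"
    using fs assms by (auto simp: fundamental_system_def)
  then show ?thesis using coeff_sum[of _ "\<lambda>s. of_int (n s)"] by auto
qed

lemma pos_iff: "a \<in> pos_roots D S \<longleftrightarrow> a \<in> D \<and> (\<forall>s\<in>S. coeff_S S s a \<ge> 0)"
proof
  assume "a \<in> pos_roots D S"
  then obtain n :: "'a \<Rightarrow> nat" where "a \<in> D" "a = (\<Sum>s\<in>S. of_nat (n s) *\<^sub>R s)"
    by (auto simp: pos_roots_def)
  then show "a \<in> D \<and> (\<forall>s\<in>S. coeff_S S s a \<ge> 0)" using coeff_sum[of _ "\<lambda>s. of_nat (n s)"] by auto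
next
  assume a: "a \<in> D \<and> (\<forall>s\<in>S. coeff_S S s a \<ge> 0)"
  have "a = (\<Sum>s\<in>S. of_nat (nat \<lfloor>coeff_S S s a\<rfloor>) *\<^sub>R s)"
  proof -
    have "real (nat \<lfloor>coeff_S S s a\<rfloor>) = coeff_S S s a" if "s \<in> S" for s
      using a root_coeffs[of a] that by (auto elim!: Ints_cases)
    then have "(\<Sum>s\<in>S. of_nat (nat \<lfloor>coeff_S S s a\<rfloor>) *\<^sub>R s) = (\<Sum>s\<in>S. coeff_S S s a *\<^sub>R s)"
      by (intro sum.cong) auto
    then show ?thesis using expandS[of a] by simp
  qed
  then show "a \<in> pos_roots D S" using a unfolding pos_roots_def
    by (intro CollectI conjI exI[of _ "\<lambda>s. nat \<lfloor>coeff_S S s a\<rfloor>"]) auto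
qed

lemma finP: "finite (pos_roots D S)" and PD: "pos_roots D S \<subseteq> D"
  using finD by (auto simp: pos_roots_def)

lemma pos_or_neg: "a \<in> D \<Longrightarrow> a \<in> pos_roots D S \<or> - a \<in> pos_roots D S"
  using root_coeffs[of a] uminus_closed[of a] by (auto simp: pos_iff coeff_uminus)

lemma not_pos_neg: "a \<in> pos_roots D S \<Longrightarrow> - a \<notin> pos_roots D S"
proof
  assume "a \<in> pos_roots D S" "- a \<in> pos_roots D S"
  then have "\<forall>s\<in>S. coeff_S S s a = 0" by (fastforce simp: pos_iff coeff_uminus)
  then have "a = 0" using expandS[of a] by simp
  then show False using \<open>a \<in> pos_roots D S\<close> PD zero_notin by auto
qed

lemma pos_of_pos_coeff: "a \<in> D \<Longrightarrow> s \<in> S \<Longrightarrow> coeff_S S s a > 0 \<Longrightarrow> a \<in> pos_roots D S"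
  using root_coeffs[of a] by (force simp: pos_iff)

lemma simple_pos: "s \<in> S \<Longrightarrow> s \<in> pos_roots D S"
  using SD by (auto simp: pos_iff coeff_simple)

text \<open>A positive root other than s has a positive coefficient at some other simple root, for
  otherwise it would be a multiple of s, which reducedness excludes. The reflection in s leaves that
  coefficient unchanged, and one positive coefficient decides the sign of a root.\<close>

lemma simple_refl_pos:
  assumes s: "s \<in> S" and a: "a \<in> pos_roots D S" "a \<noteq> s"
  shows "rs_refl s a \<in> pos_roots D S"
proof -
  have aD: "a \<in> D" using a PD by auto
  have "\<exists>s'\<in>S. s' \<noteq> s \<and> coeff_S S s' a > 0"
  proof (rule ccontr)
    assume "\<not> ?thesis"
    then have z: "coeff_S S s' a = 0" if "s' \<in> S" "s' \<noteq> s" for s'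
      using a that by (force simp: pos_iff)
    have "(\<Sum>s'\<in>S. coeff_S S s' a *\<^sub>R s') = (\<Sum>s'\<in>{s}. coeff_S S s' a *\<^sub>R s')"
      using s finS z by (intro sum.mono_neutral_right) auto
    then have e: "a = coeff_S S s a *\<^sub>R s" using expandS[of a] by simp
    then have "coeff_S S s a = 1 \<or> coeff_S S s a = -1"
      using red SD s aD unfolding reduced_rs_def by (metis subsetD)
    then have "coeff_S S s a = 1" using a s by (auto simp: pos_iff)
    then show False using e a by simp
  qed
  then obtain s' where s': "s' \<in> S" "s' \<noteq> s" "coeff_S S s' a > 0" by blast
  have "coeff_S S s' (rs_refl s a) = coeff_S S s' a"
    using s s' by (simp add: rs_refl_def coeff_diff coeff_scale coeff_simple)
  then show ?thesis
    using s' s aD SD refl_closed by (intro pos_of_pos_coeff[of _ s']) auto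
qed

section \<open>The Weyl group as words in simple reflections\<close>

lemma word_in_D: "xs \<in> lists D \<Longrightarrow> a \<in> D \<Longrightarrow> word_map xs a \<in> D"
  by (induction xs) (auto simp: refl_closed)

lemma word_linear: "xs \<in> lists D \<Longrightarrow> linear (word_map xs)"
  by (induction xs) (auto simp: refl_linear linear_compose linear_id)

lemma word_inner: "xs \<in> lists D \<Longrightarrow> word_map xs x \<bullet> word_map xs y = x \<bullet> y"
  by (induction xs) (auto simp: refl_inner nz)

lemma word_rev: "xs \<in> lists D \<Longrightarrow> word_map (rev xs) (word_map xs x) = x"
  by (induction xs) (auto simp: refl_refl nz)

lemma word_rev': "xs \<in> lists D \<Longrightarrow> word_map xs (word_map (rev xs) x) = x"
  using word_rev[of "rev xs" x] by (simp add: in_lists_conv_set)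

lemma coroot_word: "xs \<in> lists D \<Longrightarrow> rs_coroot (word_map xs a) = word_map xs (rs_coroot a)"
  using word_inner[of xs a a] word_linear[of xs] by (simp add: rs_coroot_def linear_scale)

text \<open>Conjugating a reflection by an isometry gives the reflection in the image root, and the
  inverse of a word is the reversed word.\<close>

lemma refl_word:
  assumes "xs \<in> lists D"
  shows "rs_refl (word_map xs a) = word_map (xs @ [a] @ rev xs)"
proof
  fix x
  have "rs_coroot (word_map xs a) \<bullet> x = rs_coroot a \<bullet> word_map (rev xs) x"
    using word_inner[OF assms, of "rs_coroot a" "word_map (rev xs) x"] coroot_word[OF assms, of a] word_rev'[OF assms, of x]
    by simp
  then show "rs_refl (word_map xs a) x = word_map (xs @ [a] @ rev xs) x"
    using word_linear[OF assms] word_rev'[OF assms, of x]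
    by (simp add: rs_refl_def linear_diff linear_scale)
qed

lemma simple_word: "xs \<in> lists S \<Longrightarrow> xs \<in> lists D"
  using SD by auto

text \<open>Induction on the height. Some simple s has positive inner product with a, since
  otherwise \<open>a \<bullet> a\<close> would be at most 0. Unless a is simple, the reflection in s
  keeps it positive and lowers the height by the positive integer
  \<open>rs_coroot s \<bullet> a\<close>.\<close>

lemma pos_root_conj: "a \<in> pos_roots D S \<Longrightarrow> \<exists>xs\<in>lists S. \<exists>s\<in>S. a = word_map xs s"
proof (induction "nat \<lfloor>\<Sum>s\<in>S. coeff_S S s a\<rfloor>" arbitrary: a rule: less_induct)
  case less
  show ?case
  proof (cases "a \<in> S")
    case True
    then show ?thesis by (intro bexI[of _ "[]"] bexI[of _ a]) auto
  next
    case False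
    have aD: "a \<in> D" using less.prems PD by auto
    have "\<exists>s\<in>S. s \<bullet> a > 0"
    proof (rule ccontr)
      assume "\<not> ?thesis"
      then have "(\<Sum>s\<in>S. coeff_S S s a * (s \<bullet> a)) \<le> 0"
        using less.prems by (intro sum_nonpos mult_nonneg_nonpos) (auto simp: pos_iff not_less)
      moreover have "a \<bullet> a = (\<Sum>s\<in>S. coeff_S S s a *\<^sub>R s) \<bullet> a" using expandS[of a] by simp
      ultimately have "a \<bullet> a \<le> 0" by (simp add: inner_sum_left)
      then show False using nz[OF aD] by (metis inner_gt_zero_iff not_less)
    qed
    then obtain s where s: "s \<in> S" "s \<bullet> a > 0" by blast
    have sD: "s \<in> D" using s SD by auto
    define b where "b = rs_refl s a"
    have b: "b \<in> pos_roots D S" unfolding b_def using s less.prems False by (intro simple_refl_pos) auto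
    have cs: "(\<Sum>s'\<in>S. coeff_S S s' b) = (\<Sum>s'\<in>S. coeff_S S s' a) - rs_coroot s \<bullet> a"
    proof -
      have "(\<Sum>s'\<in>S. coeff_S S s' b) = (\<Sum>s'\<in>S. coeff_S S s' a - (if s' = s then rs_coroot s \<bullet> a else 0))"
        by (rule sum.cong) (use s in \<open>auto simp: b_def rs_refl_def coeff_diff coeff_scale coeff_simple\<close>)
      then show ?thesis using s finS by (simp add: sum_subtractf)
    qed
    obtain m :: int where m: "rs_coroot s \<bullet> a = of_int m" using cartan_int[OF sD aD] by (auto elim: Ints_cases)
    have "m > 0" using coroot_inner_sgn(1)[OF nz[OF sD], of a] s m by simp
    have bnn: "(\<Sum>s'\<in>S. coeff_S S s' b) \<ge> 0" using b by (intro sum_nonneg) (auto simp: pos_iff)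
    have "nat \<lfloor>\<Sum>s'\<in>S. coeff_S S s' b\<rfloor> < nat \<lfloor>\<Sum>s'\<in>S. coeff_S S s' a\<rfloor>"
      using cs m \<open>m > 0\<close> bnn by simp
    from less.hyps[OF this b] obtain xs s' where xs: "xs \<in> lists S" "s' \<in> S" "b = word_map xs s'" by blast
    have "a = word_map (s # xs) s'"
      using xs(3) refl_refl[OF nz[OF sD], of a] by (simp add: b_def)
    then show ?thesis using xs s by (intro bexI[of _ "s # xs"] bexI[of _ s']) auto
  qed
qed

lemma root_conj: 
  assumes "a \<in> D"
  shows "\<exists>xs\<in>lists S. \<exists>s\<in>S. a = word_map xs s"
proof (cases "a \<in> pos_roots D S")
  case False
  then have "- a \<in> pos_roots D S" using assms pos_or_neg by auto
  then obtain xs s where xs: "xs \<in> lists S" "s \<in> S" "- a = word_map xs s" using pos_root_conj by blast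
  \<comment> \<open>One more reflection in s turns s into -s and so reaches the negative
    root.\<close>
  have "word_map (xs @ [s]) s = word_map xs (- s)" using xs SD by (simp add: refl_self nz subset_iff)
  also have "\<dots> = a" using linear_neg[OF word_linear[OF simple_word[OF xs(1)]], of s] xs(3) by (metis minus_minus)
  finally show ?thesis using xs by (intro bexI[of _ "xs @ [s]"] bexI[of _ s]) auto
qed (rule pos_root_conj)

text \<open>Every root is the image of a simple one under a word, so by \<open>refl_word\<close> its
  reflection is itself a word in simple reflections.\<close>

lemma weyl_iff_word: "w \<in> weyl_group D \<longleftrightarrow> (\<exists>xs\<in>lists S. w = word_map xs)"
proof
  assume "w \<in> weyl_group D"
  then show "\<exists>xs\<in>lists S. w = word_map xs"
  proof (induction rule: weyl_group.induct)
    case weyl_id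
    then show ?case by (intro bexI[of _ "[]"]) auto
  next
    case (weyl_step w a)
    then obtain ys where ys: "ys \<in> lists S" "w = word_map ys" by blast
    obtain xs s where xs: "xs \<in> lists S" "s \<in> S" "a = word_map xs s" using root_conj[OF weyl_step(2)] by blast
    have "rs_refl a \<circ> w = word_map ((xs @ [s] @ rev xs) @ ys)"
      unfolding word_map_simps(3)[of "xs @ [s] @ rev xs"] using refl_word[OF simple_word[OF xs(1)], of s] xs(3) ys(2) by simp
    then show ?case using xs ys by (intro bexI[of _ "(xs @ [s] @ rev xs) @ ys"]) auto
  qed
next
  have "word_map xs \<in> weyl_group D" if "xs \<in> lists S" for xs
    using that SD by (induction xs) (auto simp: weyl_group.intros simp del: comp_apply intro!: weyl_step)
  then show "\<exists>xs\<in>lists S. w = word_map xs \<Longrightarrow> w \<in> weyl_group D" by blast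
qed

text \<open>Applied from the right, the letters turn the positive root s into a nonpositive one at
  some letter a. There the image of s must equal a, the one positive root that the reflection in a
  makes negative; hence that reflection is a conjugate of the reflection in s, and the two
  cancel.\<close>

lemma deletion:
  assumes "xs \<in> lists S" "s \<in> S" "word_map xs s \<notin> pos_roots D S"
  shows "\<exists>ys\<in>lists S. length ys < length xs \<and> word_map xs \<circ> rs_refl s = word_map ys"
  using assms
proof (induction xs rule: list.induct)
  case Nil
  then show ?case using simple_pos by simp
next
  case (Cons a xs)
  have sD: "s \<in> D" using Cons.prems SD by auto
  have xsD: "xs \<in> lists D" using Cons.prems(1) SD by (auto simp: in_lists_conv_set)
  show ?case
  proof (cases "word_map xs s \<in> pos_roots D S")
    case False
    moreover have "xs \<in> lists S" using Cons.prems(1) by simp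
    ultimately obtain ys where ys: "ys \<in> lists S" "length ys < length xs" "word_map xs \<circ> rs_refl s = word_map ys"
      using Cons.IH Cons.prems(2) by blast
    have "word_map (a # xs) \<circ> rs_refl s = word_map (a # ys)"
      using ys(3) by (simp add: comp_assoc)
    moreover have "length (a # ys) < length (a # xs)" "a # ys \<in> lists S" using ys Cons.prems by auto
    ultimately show ?thesis by blast
  next
    case True
    have "word_map xs s = a"
      using simple_refl_pos[of a, OF _ True] Cons.prems by auto
    then have "rs_refl a = word_map (xs @ [s] @ rev xs)" using refl_word[OF xsD, of s] by simp
    then have "word_map (a # xs) \<circ> rs_refl s = word_map xs"
      using word_rev[OF xsD] refl_refl[OF nz[OF sD]] by (auto simp: fun_eq_iff)
    moreover have "length xs < length (a # xs)" "xs \<in> lists S" using Cons.prems by auto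
    ultimately show ?thesis by blast
  qed
qed

text \<open>If a shortest word ended in s, positivity of the image of s would force the preceding
  letters to send s to a root that is not positive, and \<open>deletion\<close> would produce a
  shorter word. So the shortest word is empty.\<close>

lemma weyl_free:
  assumes w: "w \<in> weyl_group D" and pos: "\<And>a. a \<in> pos_roots D S \<Longrightarrow> w a \<in> pos_roots D S"
  shows "w = id"
proof -
  define P where "P = (\<lambda>n. \<exists>xs\<in>lists S. w = word_map xs \<and> length xs = n)"
  have "\<exists>n. P n" using w weyl_iff_word by (auto simp: P_def)
  then have "P (LEAST n. P n)" by (rule LeastI_ex)
  then obtain xs where xs: "xs \<in> lists S" "w = word_map xs" "length xs = (LEAST n. P n)" by (auto simp: P_def)
  have min: "length xs \<le> length ys" if "ys \<in> lists S" "w = word_map ys" for ys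
    unfolding xs(3) by (rule Least_le) (use that in \<open>auto simp: P_def\<close>)
  show ?thesis
  proof (cases xs rule: rev_exhaust)
    case Nil
    then show ?thesis using xs by simp
  next
    case (snoc ys s)
    have ys: "ys \<in> lists S" "s \<in> S" using snoc xs by auto
    have sD: "s \<in> D" using ys SD by auto
    have "w s = - word_map ys s"
      using linear_neg[OF word_linear[OF simple_word[OF ys(1)]], of s] xs(2) snoc refl_self[OF nz[OF sD]] by simp
    then have "word_map ys s \<notin> pos_roots D S"
      using pos[OF simple_pos[OF ys(2)]] not_pos_neg by (metis minus_minus)
    then obtain zs where zs: "zs \<in> lists S" "length zs < length ys" "word_map ys \<circ> rs_refl s = word_map zs"
      using deletion ys by blast
    then have "w = word_map zs" using xs(2) snoc by simp
    then show ?thesis using min[OF zs(1)] zs(2) snoc by simp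
  qed
qed

lemma weyl_root: "w \<in> weyl_group D \<Longrightarrow> a \<in> D \<Longrightarrow> w a \<in> D"
  using word_in_D[OF simple_word] by (auto simp: weyl_iff_word)

lemma weyl_linear: "w \<in> weyl_group D \<Longrightarrow> linear w"
  using word_linear[OF simple_word] by (auto simp: weyl_iff_word)

lemma weyl_inner: "w \<in> weyl_group D \<Longrightarrow> w x \<bullet> w y = x \<bullet> y"
  using word_inner[OF simple_word] by (auto simp: weyl_iff_word)

lemma weyl_inverse:
  assumes "w \<in> weyl_group D"
  obtains v where "v \<in> weyl_group D" "\<And>x. v (w x) = x" "\<And>x. w (v x) = x"
proof -
  obtain xs where xs: "xs \<in> lists S" "w = word_map xs" using assms weyl_iff_word by blast
  have "rev xs \<in> lists S" using xs(1) by (simp add: in_lists_conv_set)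
  then have "word_map (rev xs) \<in> weyl_group D" using weyl_iff_word by blast
  then show ?thesis
    by (rule that) (simp_all add: xs(2) word_rev[OF simple_word[OF xs(1)]] word_rev'[OF simple_word[OF xs(1)]])
qed

lemma weyl_comp:
  assumes "v \<in> weyl_group D" "w \<in> weyl_group D"
  shows "v \<circ> w \<in> weyl_group D"
proof -
  obtain xs ys where "xs \<in> lists S" "v = word_map xs" "ys \<in> lists S" "w = word_map ys"
    using assms weyl_iff_word by blast
  then show ?thesis by (intro weyl_iff_word[THEN iffD2] bexI[of _ "xs @ ys"]) auto
qed

lemma weyl_coroot_inner:
  assumes "w \<in> weyl_group D"
  shows "rs_coroot (w a) \<bullet> w x = rs_coroot a \<bullet> x"
  using weyl_inner[OF assms] by (simp add: coroot_inner)

text \<open>A member is determined by its restriction to D, a finite spanning set that it maps into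
  itself.\<close>

lemma finite_weyl: "finite (weyl_group D)"
proof -
  have "inj_on (\<lambda>w. restrict w D) (weyl_group D)"
  proof (rule inj_onI)
    fix v w assume vw: "v \<in> weyl_group D" "w \<in> weyl_group D" "restrict v D = restrict w D"
    then have "v a = w a" if "a \<in> D" for a using that by (metis restrict_apply')
    then have "v x = w x" for x
      using linear_eq_on_span[OF weyl_linear weyl_linear, of v w D x] vw spanD by auto
    then show "v = w" by auto
  qed
  moreover have "(\<lambda>w. restrict w D) ` weyl_group D \<subseteq> PiE D (\<lambda>_. D)"
    using weyl_root by auto
  moreover have "finite (PiE D (\<lambda>_. D))" using finD by (intro finite_PiE)
  ultimately show ?thesis using finite_imageD finite_subset by blast
qed

section \<open>Weights and the action on chambers\<close>

definition weights :: "'a set" where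
  "weights = {l. \<forall>s\<in>S. rs_coroot s \<bullet> l \<in> \<int>}"

definition regular_weights :: "'a set" where
  "regular_weights = {l \<in> weights. \<forall>a\<in>D. rs_coroot a \<bullet> l \<noteq> 0}"

lemma weights_refl: "s \<in> S \<Longrightarrow> l \<in> weights \<Longrightarrow> rs_refl s l \<in> weights"
  using cartan_int SD by (auto simp: weights_def rs_refl_def inner_simps intro!: Ints_diff Ints_mult)

lemma weights_word: "xs \<in> lists S \<Longrightarrow> l \<in> weights \<Longrightarrow> word_map xs l \<in> weights"
  by (induction xs) (auto simp: weights_refl)

lemma weights_weyl: "w \<in> weyl_group D \<Longrightarrow> l \<in> weights \<Longrightarrow> w l \<in> weights"
  using weights_word by (auto simp: weyl_iff_word)

text \<open>Integrality is imposed at the simple coroots; it spreads to all coroots because every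
  root is a Weyl image of a simple one and the weights are stable under simple reflections.\<close>

lemma coroot_weight_int:
  assumes "a \<in> D" "l \<in> weights"
  shows "rs_coroot a \<bullet> l \<in> \<int>"
proof -
  obtain xs s where xs: "xs \<in> lists S" "s \<in> S" "a = word_map xs s" using root_conj[OF assms(1)] by blast
  then have w: "word_map xs \<in> weyl_group D" using weyl_iff_word by blast
  have "rs_coroot a \<bullet> l = rs_coroot s \<bullet> word_map (rev xs) l"
    using weyl_coroot_inner[OF w, of s "word_map (rev xs) l"] word_rev'[OF simple_word[OF xs(1)], of l] xs(3) by simp
  moreover have "word_map (rev xs) l \<in> weights" using xs assms by (intro weights_word) auto
  ultimately show ?thesis using xs(2) by (simp add: weights_def)
qed

lemma P_pp_eq: "P_pp S = {l \<in> weights. \<forall>s\<in>S. rs_coroot s \<bullet> l > 0}"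
proof (intro equalityI subsetI)
  have fw: "fund_weight S s = mu_V S s" for s by (simp add: fund_weight_def mu_V_def)
  note mu = mu_V_inner[OF indS spanS]
  fix l assume "l \<in> P_pp S"
  then obtain m :: "'a \<Rightarrow> nat" where m: "l = (\<Sum>s\<in>S. of_nat (m s) *\<^sub>R mu_V S s)" "\<forall>s\<in>S. m s \<ge> 1"
    by (auto simp: P_pp_def fw)
  have "rs_coroot s \<bullet> l = of_nat (m s)" if "s \<in> S" for s
    unfolding m(1) inner_sum_right inner_scaleR_right using mu[OF _ that] that finS
    by (simp add: if_distrib[of "(*) _"] cong: if_cong sum.cong)
  then show "l \<in> {l \<in> weights. \<forall>s\<in>S. rs_coroot s \<bullet> l > 0}"
    using m(2) by (auto simp: weights_def)
next
  have fw: "fund_weight S s = mu_V S s" for s by (simp add: fund_weight_def mu_V_def)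
  fix l assume l: "l \<in> {l \<in> weights. \<forall>s\<in>S. rs_coroot s \<bullet> l > 0}"
  have r: "real (nat \<lfloor>rs_coroot s \<bullet> l\<rfloor>) = rs_coroot s \<bullet> l" "nat \<lfloor>rs_coroot s \<bullet> l\<rfloor> \<ge> 1" if s: "s \<in> S" for s
  proof -
    have "rs_coroot s \<bullet> l \<in> \<int>" using l s by (auto simp: weights_def)
    then obtain m :: int where "rs_coroot s \<bullet> l = of_int m" by (rule Ints_cases)
    moreover have "rs_coroot s \<bullet> l > 0" using l s by auto
    ultimately show "real (nat \<lfloor>rs_coroot s \<bullet> l\<rfloor>) = rs_coroot s \<bullet> l" "nat \<lfloor>rs_coroot s \<bullet> l\<rfloor> \<ge> 1" by auto
  qed
  have "l = (\<Sum>s\<in>S. of_nat (nat \<lfloor>rs_coroot s \<bullet> l\<rfloor>) *\<^sub>R fund_weight S s)"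
  proof -
    have "(\<Sum>s\<in>S. of_nat (nat \<lfloor>rs_coroot s \<bullet> l\<rfloor>) *\<^sub>R fund_weight S s) = (\<Sum>s\<in>S. (rs_coroot s \<bullet> l) *\<^sub>R mu_V S s)"
      by (rule sum.cong) (use r in \<open>auto simp: fw\<close>)
    then show ?thesis using mu_V_expand(2)[OF indS spanS, of l] by simp
  qed
  then show "l \<in> P_pp S" using r(2) unfolding P_pp_def
    by (intro CollectI exI[of _ "\<lambda>s. nat \<lfloor>rs_coroot s \<bullet> l\<rfloor>"] conjI ballI)
qed

lemma P_pp_pos_inner:
  assumes "l \<in> P_pp S" "a \<in> pos_roots D S"
  shows "a \<bullet> l > 0"
proof -
  have s: "s \<bullet> l > 0" if "s \<in> S" for s
    using assms(1) that coroot_inner_sgn(1)[of s l] SD nz by (auto simp: P_pp_eq)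
  have "\<exists>s\<in>S. coeff_S S s a \<noteq> 0"
    using expandS[of a] nz assms(2) PD by (metis (no_types, lifting) scale_eq_0_iff subsetD sum.neutral)
  then obtain s0 where s0: "s0 \<in> S" "coeff_S S s0 a \<noteq> 0" by blast
  have nn: "coeff_S S s a \<ge> 0" if "s \<in> S" for s using assms(2) that by (simp add: pos_iff)
  have "(\<Sum>s\<in>S. coeff_S S s a * (s \<bullet> l)) > 0"
  proof (rule sum_pos2[OF finS s0(1)])
    show "0 < coeff_S S s0 a * (s0 \<bullet> l)" using nn[OF s0(1)] s0 s by simp
    show "0 \<le> coeff_S S s a * (s \<bullet> l)" if "s \<in> S" for s using nn[OF that] s[OF that] by simp
  qed
  moreover have "a \<bullet> l = (\<Sum>s\<in>S. coeff_S S s a *\<^sub>R s) \<bullet> l" using expandS[of a] by simp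
  ultimately show ?thesis by (simp add: inner_sum_left)
qed

lemma pos_of_inner:
  assumes "l \<in> P_pp S" "a \<in> D" "a \<bullet> l > 0"
  shows "a \<in> pos_roots D S"
  using pos_or_neg[OF assms(2)] P_pp_pos_inner[OF assms(1), of "- a"] assms(3) by auto

lemma P_pp_regular: "P_pp S \<subseteq> regular_weights"
proof
  fix l assume l: "l \<in> P_pp S"
  have "rs_coroot a \<bullet> l \<noteq> 0" if a: "a \<in> D" for a
  proof -
    have "a \<bullet> l \<noteq> 0" using pos_or_neg[OF a] P_pp_pos_inner[OF l, of a] P_pp_pos_inner[OF l, of "- a"] by auto
    then show ?thesis using coroot_inner_sgn(2)[OF nz[OF a]] by simp
  qed
  then show "l \<in> regular_weights" using l by (auto simp: regular_weights_def P_pp_eq)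
qed

lemma regular_weights_weyl:
  assumes w: "w \<in> weyl_group D" and l: "l \<in> regular_weights"
  shows "w l \<in> regular_weights"
proof -
  obtain v where v: "v \<in> weyl_group D" "\<And>x. v (w x) = x" "\<And>x. w (v x) = x" using weyl_inverse[OF w] by blast
  have "rs_coroot a \<bullet> w l \<noteq> 0" if "a \<in> D" for a
    using weyl_coroot_inner[OF w, of "v a" l] v l weyl_root[OF v(1) that] by (auto simp: regular_weights_def)
  then show ?thesis using weights_weyl[OF w] l by (auto simp: regular_weights_def)
qed

text \<open>Among the finitely many images of l take one with the largest pairing with \<delta>, a
  vector pairing positively with all simple roots. If it paired negatively with a simple coroot, the
  corresponding reflection would increase that maximum.\<close>

lemma weyl_chamber:
  assumes l: "l \<in> regular_weights"
  shows "\<exists>w\<in>weyl_group D. w l \<in> P_pp S"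
proof -
  note mu = mu_V_inner[OF indS spanS]
  define \<delta> where "\<delta> = (\<Sum>s\<in>S. mu_V S s)"
  have \<delta>: "s \<bullet> \<delta> > 0" if s: "s \<in> S" for s
  proof -
    have "rs_coroot s \<bullet> \<delta> = 1"
      unfolding \<delta>_def inner_sum_right using mu[OF _ s] s finS by (simp cong: sum.cong)
    then show ?thesis using coroot_inner_sgn(1)[of s \<delta>] nz SD s by auto
  qed
  have ne: "weyl_group D \<noteq> {}" using weyl_id by auto
  obtain w where w: "w \<in> weyl_group D" "\<And>v. v \<in> weyl_group D \<Longrightarrow> \<delta> \<bullet> v l \<le> \<delta> \<bullet> w l"
  proof -
    have "Max ((\<lambda>v. \<delta> \<bullet> v l) ` weyl_group D) \<in> (\<lambda>v. \<delta> \<bullet> v l) ` weyl_group D"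
      using finite_weyl ne by (intro Max_in) auto
    then obtain w where w: "w \<in> weyl_group D" "Max ((\<lambda>v. \<delta> \<bullet> v l) ` weyl_group D) = \<delta> \<bullet> w l" by blast
    then have "\<delta> \<bullet> v l \<le> \<delta> \<bullet> w l" if "v \<in> weyl_group D" for v
      using Max_ge[of "(\<lambda>v. \<delta> \<bullet> v l) ` weyl_group D"] finite_weyl that by (metis finite_imageI imageI)
    then show ?thesis using that w(1) by blast
  qed
  have wl: "w l \<in> regular_weights" by (rule regular_weights_weyl[OF w(1) l])
  have "rs_coroot s \<bullet> w l > 0" if s: "s \<in> S" for s
  proof (rule ccontr)
    have sD: "s \<in> D" using s SD by auto
    assume "\<not> ?thesis"
    moreover have "rs_coroot s \<bullet> w l \<noteq> 0" using wl sD by (auto simp: regular_weights_def)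
    ultimately have neg: "rs_coroot s \<bullet> w l < 0" by simp
    have "rs_refl s \<circ> w \<in> weyl_group D" using weyl_step[OF w(1) sD] .
    from w(2)[OF this] have "\<delta> \<bullet> rs_refl s (w l) \<le> \<delta> \<bullet> w l" by simp
    then have "0 \<le> (rs_coroot s \<bullet> w l) * (s \<bullet> \<delta>)" by (simp add: rs_refl_def inner_simps inner_commute)
    then show False using neg \<delta>[OF s] by (simp add: zero_le_mult_iff)
  qed
  then show ?thesis using w(1) wl by (intro bexI[of _ w]) (auto simp: P_pp_eq regular_weights_def)
qed

text \<open>For injectivity, an element carrying one strictly dominant weight to another maps
  positive roots to positive roots, since the pairing with such a weight shows the sign of a root;
  by \<open>weyl_free\<close> it is the identity.\<close>

lemma weyl_bij: "bij_betw (\<lambda>(w, l). w l) (weyl_group D \<times> P_pp S) regular_weights"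
proof (rule bij_betwI')
  fix x y assume x: "x \<in> weyl_group D \<times> P_pp S" and y: "y \<in> weyl_group D \<times> P_pp S"
  obtain w l w' l' where xy: "x = (w, l)" "y = (w', l')" by (cases x; cases y)
  have wl: "w \<in> weyl_group D" "l \<in> P_pp S" "w' \<in> weyl_group D" "l' \<in> P_pp S" using x y xy by auto
  obtain v where v: "v \<in> weyl_group D" "\<And>x. v (w' x) = x" "\<And>x. w' (v x) = x" using weyl_inverse[OF wl(3)] by blast
  have "x = y" if eq: "w l = w' l'"
  proof -
    have vw: "v \<circ> w \<in> weyl_group D" using weyl_comp v wl by auto
    have vl: "(v \<circ> w) l = l'" using eq v by simp
    have "v \<circ> w = id"
    proof (rule weyl_free[OF vw])
      fix a assume a: "a \<in> pos_roots D S"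
      have "(v \<circ> w) a \<bullet> l' > 0" using weyl_inner[OF vw, of a l] vl P_pp_pos_inner[OF wl(2) a] by simp
      then show "(v \<circ> w) a \<in> pos_roots D S" using pos_of_inner[OF wl(4) weyl_root[OF vw]] a PD by auto
    qed
    then have "v (w x) = x" for x by (metis comp_apply id_apply)
    then have "w x = w' x" for x using v(3) by metis
    then show ?thesis using xy vl \<open>v \<circ> w = id\<close> by auto
  qed
  then show "((case x of (w, l) \<Rightarrow> w l) = (case y of (w, l) \<Rightarrow> w l)) = (x = y)" using xy by auto
next
  fix x assume "x \<in> weyl_group D \<times> P_pp S"
  then show "(case x of (w, l) \<Rightarrow> w l) \<in> regular_weights" using regular_weights_weyl P_pp_regular by auto
next
  fix l assume l: "l \<in> regular_weights"
  obtain w where w: "w \<in> weyl_group D" "w l \<in> P_pp S" using weyl_chamber[OF l] by blast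
  obtain v where v: "v \<in> weyl_group D" "\<And>x. v (w x) = x" "\<And>x. w (v x) = x" using weyl_inverse[OF w(1)] by blast
  show "\<exists>x\<in>weyl_group D \<times> P_pp S. l = (case x of (w, l) \<Rightarrow> w l)"
    using w v by (intro bexI[of _ "(v, w l)"]) auto
qed

text \<open>The regular weights fall into one copy of the dominant ones per group element, and
  invariance of f makes the sums over the copies equal.\<close>

lemma has_sum_chamber:
  fixes f :: "'a \<Rightarrow> complex"
  assumes inv: "\<And>w l. w \<in> weyl_group D \<Longrightarrow> l \<in> P_pp S \<Longrightarrow> f (w l) = f l"
    and f: "(f has_sum s) regular_weights"
  shows "(f has_sum (s / of_nat (card (weyl_group D)))) (P_pp S)"
proof -
  have "((\<lambda>x. f (case x of (w, l) \<Rightarrow> w l)) has_sum s) (weyl_group D \<times> P_pp S)"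
    using has_sum_reindex_bij_betw[OF weyl_bij, of f s] f by simp
  moreover have "((\<lambda>x. f (case x of (w, l) \<Rightarrow> w l)) has_sum s) (weyl_group D \<times> P_pp S) \<longleftrightarrow>
      ((\<lambda>x. f (snd x)) has_sum s) (weyl_group D \<times> P_pp S)"
    by (rule has_sum_cong) (use inv in auto)
  ultimately have hs: "((\<lambda>x. f (snd x)) has_sum s) (weyl_group D \<times> P_pp S)" by simp
  have "f summable_on P_pp S"
    using f P_pp_regular has_sum_imp_summable summable_on_subset by blast
  then obtain s' where s': "(f has_sum s') (P_pp S)" by (auto simp: summable_on_def)
  have "((\<lambda>w. s') has_sum s) (weyl_group D)"
    by (rule has_sum_SigmaD[OF hs]) (use s' in simp)
  then have "s = of_nat (card (weyl_group D)) * s'"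
    using finite_weyl by (simp add: has_sum_finite_iff)
  moreover have "card (weyl_group D) \<noteq> 0" using finite_weyl weyl_id by auto
  ultimately show ?thesis using s' by simp
qed

text \<open>A root b not orthogonal to some a in E is a multiple of \<open>a - rs_refl b a\<close>,
  hence in the span of E. So the roots split into those in the span and those orthogonal to E, and
  irreducibility leaves none of the second kind.\<close>

lemma invariant_spans:
  assumes irr: "irreducible_rs D" and E: "E \<subseteq> D" "E \<noteq> {}"
    and inv: "\<And>a b. a \<in> D \<Longrightarrow> b \<in> E \<Longrightarrow> rs_refl a b \<in> E"
  shows "span E = UNIV"
proof -
  define D1 where "D1 = D \<inter> span E"
  define D2 where "D2 = {b\<in>D. \<forall>a\<in>E. b \<bullet> a = 0}"
  have "D1 \<union> D2 = D"
  proof -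
    have "b \<in> span E" if b: "b \<in> D" "a \<in> E" "b \<bullet> a \<noteq> 0" for a b
    proof -
      have c: "rs_coroot b \<bullet> a \<noteq> 0" using coroot_inner_sgn(2)[OF nz[OF b(1)]] b by simp
      have "a - rs_refl b a \<in> span E" using inv b by (intro span_diff span_base) auto
      then have "(1 / (rs_coroot b \<bullet> a)) *\<^sub>R (a - rs_refl b a) \<in> span E" by (rule span_scale)
      then show ?thesis using c by (simp add: rs_refl_def)
    qed
    then show ?thesis by (auto simp: D1_def D2_def)
  qed
  moreover have "a \<bullet> b = 0" if "a \<in> D1" "b \<in> D2" for a b
  proof -
    have "a \<in> span E" using that by (simp add: D1_def)
    then show ?thesis
      by (induction rule: span_induct)
         (use that in \<open>auto simp: subspace_def inner_simps D2_def inner_commute\<close>)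
  qed
  moreover have "D1 \<noteq> {}" using E span_base by (fastforce simp: D1_def)
  ultimately have "D2 = {}" using irr unfolding irreducible_rs_def by blast
  then have "D \<subseteq> span E" using \<open>D1 \<union> D2 = D\<close> by (auto simp: D1_def)
  then have "span D \<subseteq> span E" by (simp add: span_minimal subspace_span)
  then show ?thesis using spanD by auto
qed

lemma invariant_pos_spans:
  assumes "span E = UNIV" "E \<subseteq> D" "\<And>b. b \<in> E \<Longrightarrow> - b \<in> E"
  shows "span (E \<inter> pos_roots D S) = UNIV"
proof -
  have "E \<subseteq> span (E \<inter> pos_roots D S)"
  proof
    fix b assume b: "b \<in> E"
    show "b \<in> span (E \<inter> pos_roots D S)"
    proof (cases "b \<in> pos_roots D S")
      case False
      then have "- b \<in> E \<inter> pos_roots D S" using assms b pos_or_neg by auto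
      then have "- (- b) \<in> span (E \<inter> pos_roots D S)" by (intro span_neg span_base)
      then show ?thesis by simp
    qed (use b in \<open>auto intro: span_base\<close>)
  qed
  then have "span E \<subseteq> span (E \<inter> pos_roots D S)" by (simp add: span_minimal subspace_span)
  then show ?thesis using assms by auto
qed

text \<open>A fundamental weight orthogonal to a spanning set would vanish, yet it pairs to 1 with
  its own simple coroot.\<close>

lemma spanning_root_set:
  assumes "span E = UNIV" "E \<subseteq> pos_roots D S"
  shows "root_set D S E"
proof -
  have fw: "fund_weight S s = mu_V S s" for s by (simp add: fund_weight_def mu_V_def)
  have "\<exists>\<alpha>\<in>E. \<alpha> \<bullet> fund_weight S s \<noteq> 0" if s: "s \<in> S" for s
  proof (rule ccontr)
    assume "\<not> ?thesis"
    then have "fund_weight S s = 0" using inner_eq_on_basis[OF assms(1), of "fund_weight S s" 0] by auto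
    then show False using mu_V_inner[OF indS spanS s s] by (simp add: fw)
  qed
  then show ?thesis using assms(2) by (auto simp: root_set_def)
qed

end

lemma norm_refl: "a \<noteq> 0 \<Longrightarrow> norm (rs_refl a b) = norm b"
  by (simp add: norm_eq_sqrt_inner refl_inner)

context based_root_system begin

text \<open>Reflections preserve lengths. Both sets are nonempty because D is finite and, spanning a
  nonzero space, nonempty.\<close>

lemma long_short_invariant:
  assumes "E = long_roots D \<or> E = short_roots D"
  shows "E \<subseteq> D" "E \<noteq> {}" "\<And>a b. a \<in> D \<Longrightarrow> b \<in> E \<Longrightarrow> rs_refl a b \<in> E"
proof -
  have "D \<noteq> {}"
  proof
    assume "D = {}"
    then have "(UNIV :: 'a set) = {0}" using spanD by simp
    moreover obtain b :: 'a where "b \<in> Basis" using nonempty_Basis by blast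
    ultimately show False using nonzero_Basis by blast
  qed
  show "E \<subseteq> D" using assms by (auto simp: long_roots_def short_roots_def)
  have "Max (norm ` D) \<in> norm ` D" "Min (norm ` D) \<in> norm ` D"
    using finD \<open>D \<noteq> {}\<close> by (auto intro!: Max_in Min_in)
  then obtain a b where "a \<in> D" "norm a = Max (norm ` D)" "b \<in> D" "norm b = Min (norm ` D)"
    by (metis (mono_tags, lifting) imageE)
  then have "a \<in> long_roots D" "b \<in> short_roots D"
    using finD by (auto simp: long_roots_def short_roots_def)
  then show "E \<noteq> {}" using assms by auto
  show "rs_refl a b \<in> E" if "a \<in> D" "b \<in> E" for a b
    using assms that refl_closed[OF that(1), of b] norm_refl[OF nz[OF that(1)], of b]
    by (auto simp: long_roots_def short_roots_def)
qed

end

section \<open>Partial fractions, no-broken-circuit sums and lattice characters\<close>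

text \<open>The condition that \<open>bases_VA\<close> imposes on the intersection of a basis with
  the list. These are the no-broken-circuit sets of the vectors in \<open>ns\<close>, where a
  circuit is broken by deleting its last member.\<close>

definition nbc_sets :: "'a::euclidean_space list \<Rightarrow> 'a set set" where
  "nbc_sets ns = {I. I \<subseteq> set ns \<and> (\<forall>j<length ns. ns ! j \<notin> span (I \<inter> set (take j ns)))}"

lemma finite_nbc_sets: "finite (nbc_sets ns)"
  by (rule finite_subset[of _ "Pow (set ns)"]) (auto simp: nbc_sets_def)

lemma span_orthogonal:
  assumes "x \<in> span I" "\<And>i. i \<in> I \<Longrightarrow> i \<bullet> l = 0"
  shows "x \<bullet> l = 0"
  using assms(1) by (induction rule: span_induct) (auto simp: subspace_def inner_simps assms(2))

text \<open>If some member of the list is orthogonal to $l$, toggling the last such member is a sign-reversing involution: it changes none of the span conditions at or before its own index, and those after it hold because $l$ does not annihilate the later members.\<close>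

lemma nbc_sum:
  fixes l :: "'a::euclidean_space"
  assumes ns: "distinct ns"
  shows "(\<Sum>I\<in>{I\<in>nbc_sets ns. \<forall>i\<in>I. i \<bullet> l = 0}. (-1) ^ card I) =
     (if \<forall>\<nu>\<in>set ns. \<nu> \<bullet> l \<noteq> 0 then 1 else (0::complex))"
proof (cases "\<forall>\<nu>\<in>set ns. \<nu> \<bullet> l \<noteq> 0")
  case True
  have "{I\<in>nbc_sets ns. \<forall>i\<in>I. i \<bullet> l = 0} = {{}}"
  proof (intro equalityI subsetI)
    fix I assume "I \<in> {I\<in>nbc_sets ns. \<forall>i\<in>I. i \<bullet> l = 0}"
    then show "I \<in> {{}}" using True by (auto simp: nbc_sets_def)
  next
    fix I assume "I \<in> {{} :: 'a set}"
    moreover have "ns ! j \<noteq> 0" if "j < length ns" for j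
      using True nth_mem[OF that] by (metis inner_zero_left)
    ultimately show "I \<in> {I\<in>nbc_sets ns. \<forall>i\<in>I. i \<bullet> l = 0}" by (auto simp: nbc_sets_def)
  qed
  then show ?thesis using True by simp
next
  case False
  define Z where "Z = {j. j < length ns \<and> ns ! j \<bullet> l = 0}"
  have Z: "finite Z" "Z \<noteq> {}" using False by (auto simp: Z_def in_set_conv_nth)
  define j0 where "j0 = Max Z"
  have j0: "j0 < length ns" "ns ! j0 \<bullet> l = 0" and jmax: "\<And>j. j < length ns \<Longrightarrow> ns ! j \<bullet> l = 0 \<Longrightarrow> j \<le> j0"
    using Max_in[OF Z] Max_ge[OF Z(1)] by (auto simp: j0_def Z_def)
  define v where "v = ns ! j0"
  define tog where "tog = (\<lambda>I. if v \<in> I then I - {v} else insert v I)"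
  let ?N = "{I\<in>nbc_sets ns. \<forall>i\<in>I. i \<bullet> l = 0}"
  have togN: "tog I \<in> ?N" if I: "I \<in> ?N" for I
  proof -
    have I': "I \<subseteq> set ns" "\<And>i. i \<in> I \<Longrightarrow> i \<bullet> l = 0" "\<And>j. j < length ns \<Longrightarrow> ns ! j \<notin> span (I \<inter> set (take j ns))"
      using I by (auto simp: nbc_sets_def)
    have perp: "i \<bullet> l = 0" if "i \<in> tog I" for i using that I' j0 by (auto simp: tog_def v_def split: if_splits)
    have "ns ! j \<notin> span (tog I \<inter> set (take j ns))" if j: "j < length ns" for j
    proof (cases "j \<le> j0")
      case True
      have "v \<notin> set (take j ns)"
      proof
        assume "v \<in> set (take j ns)"
        then obtain i where "i < j" "ns ! i = v" by (auto simp: in_set_conv_nth)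
        then show False using ns j j0 True by (auto simp: v_def nth_eq_iff_index_eq)
      qed
      then have "tog I \<inter> set (take j ns) = I \<inter> set (take j ns)" by (auto simp: tog_def)
      then show ?thesis using I'(3)[OF j] by simp
    next
      case False
      then have "ns ! j \<bullet> l \<noteq> 0" using jmax j by auto
      then show ?thesis using span_orthogonal[of "ns ! j" "tog I \<inter> set (take j ns)" l] perp by auto
    qed
    moreover have "tog I \<subseteq> set ns" using I'(1) j0 by (auto simp: tog_def v_def)
    ultimately show ?thesis using perp by (auto simp: nbc_sets_def)
  qed
  have togtog: "tog (tog I) = I" for I by (auto simp: tog_def)
  have fin: "finite I" if "I \<in> ?N" for I using that finite_subset[of I "set ns"] by (auto simp: nbc_sets_def)
  have sgn: "(-1::complex) ^ card (tog I) = - ((-1) ^ card I)" if I: "I \<in> ?N" for I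
  proof (cases "v \<in> I")
    case True
    then have "card I = Suc (card (I - {v}))" using fin[OF I] by (metis card_Suc_Diff1)
    then have "(-1::complex) ^ card I = - ((-1) ^ card (I - {v}))" by simp
    then show ?thesis using True by (simp add: tog_def del: card_Diff_insert card_Diff_singleton)
  next
    case False
    then show ?thesis using fin[OF I] by (simp add: tog_def)
  qed
  have "bij_betw tog ?N ?N"
    by (rule bij_betwI[where g = tog]) (use togN togtog in auto)
  then have "(\<Sum>I\<in>?N. (-1::complex) ^ card I) = (\<Sum>I\<in>?N. (-1) ^ card (tog I))"
    by (rule sum.reindex_bij_betw[symmetric])
  also have "\<dots> = (\<Sum>I\<in>?N. - ((-1) ^ card I))" by (rule sum.cong) (use sgn in auto)
  also have "\<dots> = - (\<Sum>I\<in>?N. (-1) ^ card I)" by (simp add: sum_negf)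
  finally have "(\<Sum>I\<in>?N. (-1::complex) ^ card I) = 0"
    by (simp add: eq_neg_iff_add_eq_0 flip: mult_2)
  then show ?thesis using False by simp
qed

definition compl_bases :: "'a::euclidean_space set \<Rightarrow> 'a set \<Rightarrow> 'a set set" where
  "compl_bases I X = {J. J \<subseteq> X \<and> independent (I \<union> J) \<and> span (I \<union> J) = UNIV}"

text \<open>The value of the affine form $w_g$ at the common zero of the forms $w_b$, $b \in J$, on the orthogonal complement of $I$.\<close>

definition relc :: "'a::euclidean_space set \<Rightarrow> 'a set \<Rightarrow> ('a \<Rightarrow> complex) \<Rightarrow> 'a \<Rightarrow> complex" where
  "relc I J w g = w g - (\<Sum>b\<in>J. w b * of_real (rs_coroot g \<bullet> mu_V (I \<union> J) b))"

lemma coroot_in_span: "a \<in> span A \<Longrightarrow> rs_coroot a \<in> span A"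
  by (simp add: rs_coroot_def span_scale)

lemma coroot_in_span_iff: "a \<noteq> 0 \<Longrightarrow> rs_coroot a \<in> span A \<longleftrightarrow> a \<in> span A"
  by (auto simp: rs_coroot_def span_scale dest: span_scale[of _ _ "(a \<bullet> a) / 2"])

text \<open>A linear relation $\sum_a d_a a^\vee \in \mathrm{span}\, I$ writes the nonzero constant $\sum_a d_a w_a$ as a combination of the $w_a$, so that each summand cancels one factor and the induction hypothesis applies.\<close>

lemma partial_fractions:
  fixes w :: "'a::euclidean_space \<Rightarrow> complex"
  assumes "finite X" and I: "independent I" and "X \<inter> I = {}" and "0 \<notin> X"
    and "span (I \<union> X) = UNIV"
    and "\<And>x. x \<in> X \<Longrightarrow> w x \<noteq> 0"
    and "\<And>J g. J \<in> compl_bases I X \<Longrightarrow> g \<in> X - J \<Longrightarrow> relc I J w g \<noteq> 0"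
  shows "(\<Sum>J\<in>compl_bases I X. (\<Prod>g\<in>X - J. 1 / relc I J w g) * (\<Prod>b\<in>J. 1 / w b)) = (\<Prod>x\<in>X. 1 / w x)"
  using assms(1,3-)
proof (induction "card X" arbitrary: X rule: less_induct)
  case less
  note fin = less.prems(1) and disj = less.prems(2) and nz = less.prems(3) and sp = less.prems(4)
    and w = less.prems(5) and reg = less.prems(6)
  have finI: "finite I" using I by (rule finite_independent)
  have finJ: "finite J" if "J \<in> compl_bases I X" for J
    using that fin finite_subset by (auto simp: compl_bases_def)
  have finC: "finite (compl_bases I X)"
    by (rule finite_subset[of _ "Pow X"]) (use fin in \<open>auto simp: compl_bases_def\<close>)
  obtain B where B: "I \<subseteq> B" "B \<subseteq> I \<union> X" "independent B" "I \<union> X \<subseteq> span B"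
    using maximal_independent_subset_extend[of I "I \<union> X"] I by auto
  define J0 where "J0 = B - I"
  have BJ: "B = I \<union> J0" using B by (auto simp: J0_def)
  have spB: "span B = UNIV" using B(4) sp by (metis span_minimal subspace_span top.extremum_uniqueI)
  have J0: "J0 \<in> compl_bases I X" "J0 \<subseteq> X" using B spB by (auto simp: compl_bases_def J0_def Un_absorb1)
  show ?case
  proof (cases "J0 = X")
    case True
    have "compl_bases I X = {X}"
    proof (intro equalityI subsetI)
      fix J assume J: "J \<in> compl_bases I X"
      have "X \<subseteq> J"
      proof
        fix x assume x: "x \<in> X"
        show "x \<in> J"
        proof (rule ccontr)
          assume "x \<notin> J"
          then have "I \<union> J \<subseteq> B - {x}" using J x disj True BJ by (auto simp: compl_bases_def)
          then have "x \<in> span (B - {x})" using J span_mono[of "I \<union> J" "B - {x}"] by (auto simp: compl_bases_def)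
          moreover have "x \<in> B" using x True BJ by auto
          ultimately show False using B(3) by (auto simp: dependent_def)
        qed
      qed
      then show "J \<in> {X}" using J by (auto simp: compl_bases_def)
    qed (use J0 True in auto)
    then show ?thesis by simp
  next
    case False
    then obtain g where g: "g \<in> X" "g \<notin> J0" using J0 by auto
    \<comment> \<open>Expanding the coroot of g in the basis B and moving the J0-part to the other
      side gives coefficients d whose combination of coroots lies in the span of I.\<close>
    define d where "d = (\<lambda>a. if a = g then 1 else if a \<in> J0 then - (rs_coroot g \<bullet> mu_V B a) else 0)"
    have dsum: "(\<Sum>a\<in>X. of_real (d a) *\<^sub>R f a) = f g - (\<Sum>a\<in>J0. (rs_coroot g \<bullet> mu_V B a) *\<^sub>R f a)" for f :: "'a \<Rightarrow> 'b::real_vector"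
    proof -
      have "(\<Sum>a\<in>X. of_real (d a) *\<^sub>R f a) = (\<Sum>a\<in>insert g J0. of_real (d a) *\<^sub>R f a)"
        using fin g J0 by (intro sum.mono_neutral_right) (auto simp: d_def)
      also have "\<dots> = f g + (\<Sum>a\<in>J0. of_real (d a) *\<^sub>R f a)"
        using g finJ[OF J0(1)] by (simp add: d_def)
      also have "(\<Sum>a\<in>J0. of_real (d a) *\<^sub>R f a) = (\<Sum>a\<in>J0. - ((rs_coroot g \<bullet> mu_V B a) *\<^sub>R f a))"
        using g by (intro sum.cong) (auto simp: d_def)
      finally show ?thesis by (simp add: sum_negf)
    qed
    define r where "r = (\<Sum>a\<in>X. d a *\<^sub>R rs_coroot a)"
    have r: "r \<in> span I"
    proof -
      have "rs_coroot g = (\<Sum>b\<in>B. (rs_coroot g \<bullet> mu_V B b) *\<^sub>R rs_coroot b)"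
        by (rule mu_V_expand(1)[OF B(3) spB])
      also have "\<dots> = (\<Sum>b\<in>I. (rs_coroot g \<bullet> mu_V B b) *\<^sub>R rs_coroot b) + (\<Sum>b\<in>J0. (rs_coroot g \<bullet> mu_V B b) *\<^sub>R rs_coroot b)"
        unfolding BJ using finI finJ[OF J0(1)] J0 disj by (intro sum.union_disjoint) auto
      finally have "r = (\<Sum>b\<in>I. (rs_coroot g \<bullet> mu_V B b) *\<^sub>R rs_coroot b)"
        using dsum[of rs_coroot] unfolding r_def by (simp only: of_real_eq_id id_apply) (metis add_diff_cancel_right')
      then show ?thesis by (simp add: span_sum span_scale coroot_in_span span_base)
    qed
    define L where "L = (\<Sum>a\<in>X. of_real (d a) * w a)"
    have "L = relc I J0 w g"
      using dsum[of w] by (simp add: L_def relc_def BJ scaleR_conv_of_real mult.commute)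
    then have L0: "L \<noteq> 0" using reg[OF J0(1)] g by auto
    \<comment> \<open>Dropping a preserves spanning when \<open>d a\<close> is nonzero, since the
      relation expresses a through I and the rest of X. The complementary bases of the smaller set
      are those avoiding a.\<close>
    have IH: "(\<Prod>x\<in>X - {a}. 1 / w x) =
        (\<Sum>J\<in>{J\<in>compl_bases I X. a \<notin> J}. (\<Prod>g\<in>X - J - {a}. 1 / relc I J w g) * (\<Prod>b\<in>J. 1 / w b))"
      if a: "a \<in> X" "d a \<noteq> 0" for a
    proof -
      have cb: "compl_bases I (X - {a}) = {J\<in>compl_bases I X. a \<notin> J}" by (auto simp: compl_bases_def)
      have "(\<Sum>J\<in>compl_bases I (X - {a}). (\<Prod>g\<in>X - {a} - J. 1 / relc I J w g) * (\<Prod>b\<in>J. 1 / w b)) = (\<Prod>x\<in>X - {a}. 1 / w x)"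
      proof (rule less.hyps)
        show "card (X - {a}) < card X" using fin a by (intro psubset_card_mono) auto
        have "d a *\<^sub>R rs_coroot a = r - (\<Sum>b\<in>X - {a}. d b *\<^sub>R rs_coroot b)"
          using fin a by (simp add: r_def sum.remove)
        also have "\<dots> \<in> span (I \<union> (X - {a}))"
        proof (rule span_diff)
          show "r \<in> span (I \<union> (X - {a}))" using r span_mono[of I "I \<union> (X - {a})"] by auto
          show "(\<Sum>b\<in>X - {a}. d b *\<^sub>R rs_coroot b) \<in> span (I \<union> (X - {a}))"
            by (intro span_sum span_scale coroot_in_span span_base) auto
        qed
        finally have "(1 / d a) *\<^sub>R (d a *\<^sub>R rs_coroot a) \<in> span (I \<union> (X - {a}))" by (rule span_scale)
        then have "rs_coroot a \<in> span (I \<union> (X - {a}))" using a by simp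
        then have "a \<in> span (I \<union> (X - {a}))" using coroot_in_span_iff[of a] nz a by auto
        then have "I \<union> X \<subseteq> span (I \<union> (X - {a}))" using span_base[of _ "I \<union> (X - {a})"] by blast
        then show "span (I \<union> (X - {a})) = UNIV" using sp by (metis span_minimal subspace_span top.extremum_uniqueI)
        show "relc I J w g \<noteq> 0" if "J \<in> compl_bases I (X - {a})" "g \<in> X - {a} - J" for J g
          using reg that by (auto simp: cb)
      qed (use fin disj nz w in auto)
      moreover have "X - {a} - J = X - J - {a}" for J by auto
      ultimately show ?thesis unfolding cb by simp
    qed
    \<comment> \<open>At the common zero of the forms in J the combination with coefficients d still
      equals L: the correction pairs r with the dual vectors of J, and these pairings vanish because
      r lies in the span of I.\<close>
    have key: "(\<Sum>a\<in>X - J. of_real (d a) * relc I J w a) = L" if J: "J \<in> compl_bases I X" for J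
    proof -
      have ind: "independent (I \<union> J)" "span (I \<union> J) = UNIV" "J \<subseteq> X" using J by (auto simp: compl_bases_def)
      have z: "relc I J w a = 0" if a: "a \<in> J" for a
      proof -
        have "(\<Sum>b\<in>J. w b * of_real (rs_coroot a \<bullet> mu_V (I \<union> J) b)) = (\<Sum>b\<in>J. if b = a then w b else 0)"
          by (rule sum.cong) (use a mu_V_inner[OF ind(1,2)] in auto)
        then show ?thesis using a finJ[OF J] by (simp add: relc_def)
      qed
      have "(\<Sum>a\<in>X - J. of_real (d a) * relc I J w a) = (\<Sum>a\<in>X. of_real (d a) * relc I J w a)"
        using fin z ind by (intro sum.mono_neutral_left) auto
      also have "\<dots> = L - (\<Sum>a\<in>X. \<Sum>b\<in>J. w b * of_real (d a * (rs_coroot a \<bullet> mu_V (I \<union> J) b)))"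
        unfolding L_def relc_def by (simp add: right_diff_distrib sum_subtractf sum_distrib_left mult_ac)
      also have "(\<Sum>a\<in>X. \<Sum>b\<in>J. w b * of_real (d a * (rs_coroot a \<bullet> mu_V (I \<union> J) b))) =
          (\<Sum>b\<in>J. w b * of_real (r \<bullet> mu_V (I \<union> J) b))"
        by (subst sum.swap) (simp add: r_def inner_sum_left sum_distrib_left)
      also have "\<dots> = 0"
      proof (rule sum.neutral, rule ballI)
        fix b assume b: "b \<in> J"
        have "i \<bullet> mu_V (I \<union> J) b = 0" if i: "i \<in> I" for i
        proof -
          have "i \<noteq> b" using i b ind disj by auto
          then have "rs_coroot i \<bullet> mu_V (I \<union> J) b = 0" using mu_V_inner[OF ind(1,2), of b i] i b by auto
          moreover have "i \<noteq> 0" using i I dependent_zero by blast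
          ultimately show ?thesis using coroot_inner_sgn(2) by blast
        qed
        then have "r \<bullet> mu_V (I \<union> J) b = 0" using span_orthogonal[OF r] by blast
        then show "w b * of_real (r \<bullet> mu_V (I \<union> J) b) = 0" by simp
      qed
      finally show ?thesis by simp
    qed
    have "L * (\<Prod>x\<in>X. 1 / w x) = (\<Sum>a\<in>X. of_real (d a) * (\<Prod>x\<in>X - {a}. 1 / w x))"
      unfolding L_def sum_distrib_right
    proof (rule sum.cong)
      fix a assume a: "a \<in> X"
      show "of_real (d a) * w a * (\<Prod>x\<in>X. 1 / w x) = of_real (d a) * (\<Prod>x\<in>X - {a}. 1 / w x)"
        using prod.remove[OF fin a, of "\<lambda>x. 1 / w x"] w[OF a] by simp
    qed simp
    also have "\<dots> = (\<Sum>a\<in>X. \<Sum>J\<in>{J\<in>compl_bases I X. a \<notin> J}. of_real (d a) * ((\<Prod>g\<in>X - J - {a}. 1 / relc I J w g) * (\<Prod>b\<in>J. 1 / w b)))"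
    proof (rule sum.cong)
      fix a assume a: "a \<in> X"
      show "of_real (d a) * (\<Prod>x\<in>X - {a}. 1 / w x) =
        (\<Sum>J\<in>{J\<in>compl_bases I X. a \<notin> J}. of_real (d a) * ((\<Prod>g\<in>X - J - {a}. 1 / relc I J w g) * (\<Prod>b\<in>J. 1 / w b)))"
        using IH[OF a] by (cases "d a = 0") (auto simp: sum_distrib_left)
    qed simp
    \<comment> \<open>After the exchange each J collects all a outside it, whose contributions
      \<open>key\<close> adds up to L.\<close>
    also have "\<dots> = (\<Sum>J\<in>compl_bases I X. \<Sum>a\<in>{a\<in>X. a \<notin> J}. of_real (d a) * ((\<Prod>g\<in>X - J - {a}. 1 / relc I J w g) * (\<Prod>b\<in>J. 1 / w b)))"
      by (rule sum.swap_restrict[OF fin finC])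
    also have "\<dots> = (\<Sum>J\<in>compl_bases I X. L * ((\<Prod>g\<in>X - J. 1 / relc I J w g) * (\<Prod>b\<in>J. 1 / w b)))"
    proof (rule sum.cong)
      fix J assume J: "J \<in> compl_bases I X"
      have eq: "{a\<in>X. a \<notin> J} = X - J" by auto
      have "(\<Sum>a\<in>X - J. of_real (d a) * ((\<Prod>g\<in>X - J - {a}. 1 / relc I J w g) * (\<Prod>b\<in>J. 1 / w b))) =
        (\<Sum>a\<in>X - J. (of_real (d a) * relc I J w a) * ((\<Prod>g\<in>X - J. 1 / relc I J w g) * (\<Prod>b\<in>J. 1 / w b)))"
      proof (rule sum.cong)
        fix a assume a: "a \<in> X - J"
        show "of_real (d a) * ((\<Prod>g\<in>X - J - {a}. 1 / relc I J w g) * (\<Prod>b\<in>J. 1 / w b)) =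
          (of_real (d a) * relc I J w a) * ((\<Prod>g\<in>X - J. 1 / relc I J w g) * (\<Prod>b\<in>J. 1 / w b))"
          using prod.remove[of "X - J" a "\<lambda>g. 1 / relc I J w g"] fin a reg[OF J a] by simp
      qed simp
      also have "\<dots> = L * ((\<Prod>g\<in>X - J. 1 / relc I J w g) * (\<Prod>b\<in>J. 1 / w b))"
        by (simp add: key[OF J] flip: sum_distrib_right)
      finally show "(\<Sum>a\<in>{a\<in>X. a \<notin> J}. of_real (d a) * ((\<Prod>g\<in>X - J - {a}. 1 / relc I J w g) * (\<Prod>b\<in>J. 1 / w b))) =
        L * ((\<Prod>g\<in>X - J. 1 / relc I J w g) * (\<Prod>b\<in>J. 1 / w b))" unfolding eq .
    qed simp
    also have "\<dots> = L * (\<Sum>J\<in>compl_bases I X. (\<Prod>g\<in>X - J. 1 / relc I J w g) * (\<Prod>b\<in>J. 1 / w b))"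
      by (simp add: sum_distrib_left)
    finally show ?thesis using L0 by simp
  qed
qed

section \<open>Lattice cosets and their characters\<close>

abbreviation ee :: "real \<Rightarrow> complex" where
  "ee x \<equiv> exp (2 * pi * \<i> * complex_of_real x)"

lemma exp_2pi_int:
  assumes "x \<in> \<int>"
  shows "ee x = 1"
proof -
  obtain n :: int where "x = of_int n" using assms by (auto elim: Ints_cases)
  then show ?thesis using exp_eq_1[of "2 * pi * \<i> * complex_of_real x"] by auto
qed

lemma exp_2pi_not_int:
  assumes "ee x = 1"
  shows "x \<in> \<int>"
proof -
  obtain n :: int where "2 * pi * x = of_int (2 * n) * pi"
    using assms exp_eq_1[of "2 * pi * \<i> * complex_of_real x"] by auto
  then have "x = of_int n" by simp
  then show ?thesis by simp
qed

context based_root_system begin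

lemma bases_V_props:
  assumes "B \<in> bases_V D S"
  shows "independent B" "span B = UNIV" "finite B" "B \<subseteq> D" "0 \<notin> B"
  using assms PD zero_notin finite_independent by (auto simp: bases_V_def)

lemma lattice_V_memI: "(\<Sum>b\<in>B. of_int (m b) *\<^sub>R rs_coroot b) \<in> lattice_V B"
  by (auto simp: lattice_V_def)

lemma lattice_V_add: "(x::'a) \<in> lattice_V B \<Longrightarrow> y \<in> lattice_V B \<Longrightarrow> x + y \<in> lattice_V B"
proof -
  assume "x \<in> lattice_V B" "y \<in> lattice_V B"
  then obtain m n :: "'a \<Rightarrow> int" where "x = (\<Sum>\<beta>\<in>B. of_int (m \<beta>) *\<^sub>R rs_coroot \<beta>)" "y = (\<Sum>\<beta>\<in>B. of_int (n \<beta>) *\<^sub>R rs_coroot \<beta>)"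
    by (auto simp: lattice_V_def)
  then have "x + y = (\<Sum>\<beta>\<in>B. of_int (m \<beta> + n \<beta>) *\<^sub>R rs_coroot \<beta>)"
    by (simp add: sum.distrib scaleR_left_distrib)
  then show ?thesis unfolding lattice_V_def by (intro CollectI exI[of _ "\<lambda>b. m b + n b"]) simp
qed

lemma lattice_V_uminus: "(x::'a) \<in> lattice_V B \<Longrightarrow> - x \<in> lattice_V B"
proof -
  assume "x \<in> lattice_V B"
  then obtain m :: "'a \<Rightarrow> int" where "x = (\<Sum>\<beta>\<in>B. of_int (m \<beta>) *\<^sub>R rs_coroot \<beta>)"
    by (auto simp: lattice_V_def)
  then have "- x = (\<Sum>\<beta>\<in>B. of_int (- m \<beta>) *\<^sub>R rs_coroot \<beta>)"
    by (simp add: sum_negf)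
  then show ?thesis unfolding lattice_V_def by (intro CollectI exI[of _ "\<lambda>b. - m b"]) simp
qed

lemma lattice_V_zero: "0 \<in> lattice_V B"
  unfolding lattice_V_def by (intro CollectI exI[of _ "\<lambda>_. 0"]) simp

lemma coroot_lattice_eq: "coroot_lattice S = lattice_V S"
  by (simp add: coroot_lattice_def lattice_V_def)

lemma lattice_V_weight_int: "x \<in> lattice_V B \<Longrightarrow> (\<And>b. b \<in> B \<Longrightarrow> rs_coroot b \<bullet> l \<in> \<int>) \<Longrightarrow> x \<bullet> l \<in> \<int>"
  by (auto simp: lattice_V_def inner_sum_left intro!: Ints_sum Ints_mult)

text \<open>The exponential is constant on a coset, so the arbitrary representatives chosen in
  \<open>F_gen\<close> do no harm.\<close>

lemma coset_inner:
  assumes C: "C \<in> cosets_V S B" and l: "\<And>b. b \<in> B \<Longrightarrow> rs_coroot b \<bullet> l \<in> \<int>"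
    and q: "q \<in> C" "q' \<in> C"
  shows "ee (q \<bullet> l) = ee (q' \<bullet> l)"
proof -
  obtain q0 x x' where "q = q0 + x" "q' = q0 + x'" and x: "x \<in> lattice_V B" "x' \<in> lattice_V B"
    using C q by (auto simp: cosets_V_def)
  moreover have "ee (z \<bullet> l) = 1" if "z \<in> lattice_V B" for z
    using lattice_V_weight_int[OF that l] exp_2pi_int by blast
  ultimately show ?thesis by (simp add: inner_add_left distrib_left exp_add)
qed

lemma coset_nonempty:
  assumes "C \<in> cosets_V S B"
  shows "(SOME q. q \<in> C) \<in> C"
proof -
  obtain q where "C = (\<lambda>x. q + x) ` lattice_V B" using assms by (auto simp: cosets_V_def)
  then have "q + 0 \<in> C" using lattice_V_zero by blast
  then show ?thesis by (rule someI)
qed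

text \<open>Subtracting the integer parts of the coordinates with respect to B moves every
  representative into a bounded region, and the coroot lattice has finitely many points there, being
  integral in the coordinates with respect to S.\<close>

lemma finite_cosets:
  assumes B: "B \<in> bases_V D S"
  shows "finite (cosets_V S B)"
proof -
  note BP = bases_V_props[OF B]
  define M where "M = (\<Sum>b\<in>B. norm (rs_coroot b))"
  define R where "R = {r. norm r \<le> M \<and> (\<forall>s\<in>S. r \<bullet> mu_V S s \<in> \<int>)}"
  have "finite R"
  proof -
    let ?h = "\<lambda>r. restrict (\<lambda>s. \<lfloor>r \<bullet> mu_V S s\<rfloor>) S"
    define K where "K = (\<lambda>s. \<lceil>M * norm (mu_V S s)\<rceil>)"
    have "?h ` R \<subseteq> PiE S (\<lambda>s. {- K s..K s})"
    proof clarify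
      fix r assume r: "r \<in> R"
      have "\<lfloor>r \<bullet> mu_V S s\<rfloor> \<in> {- K s..K s}" if "s \<in> S" for s
      proof -
        have "\<bar>r \<bullet> mu_V S s\<bar> \<le> norm r * norm (mu_V S s)" by (rule Cauchy_Schwarz_ineq2)
        also have "\<dots> \<le> M * norm (mu_V S s)" using r by (intro mult_right_mono) (auto simp: R_def)
        also have "\<dots> \<le> of_int (K s)" by (simp add: K_def)
        finally show ?thesis by (auto simp: abs_le_iff le_floor_iff floor_le_iff)
      qed
      then show "?h r \<in> PiE S (\<lambda>s. {- K s..K s})" by auto
    qed
    moreover have "finite (PiE S (\<lambda>s. {- K s..K s}))" using finS by (intro finite_PiE) auto
    moreover have "inj_on ?h R"
    proof (rule inj_onI)
      fix r r' assume r: "r \<in> R" "r' \<in> R" "?h r = ?h r'"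
      have "r \<bullet> mu_V S s = r' \<bullet> mu_V S s" if s: "s \<in> S" for s
      proof -
        have "\<lfloor>r \<bullet> mu_V S s\<rfloor> = \<lfloor>r' \<bullet> mu_V S s\<rfloor>" using fun_cong[OF r(3), of s] s by simp
        moreover have "r \<bullet> mu_V S s \<in> \<int>" "r' \<bullet> mu_V S s \<in> \<int>" using r s by (auto simp: R_def)
        ultimately show ?thesis by (auto elim!: Ints_cases)
      qed
      then show "r = r'"
        using mu_V_expand(1)[OF indS spanS, of r] mu_V_expand(1)[OF indS spanS, of r'] by simp
    qed
    ultimately show ?thesis using finite_imageD finite_subset by blast
  qed
  moreover have "cosets_V S B \<subseteq> (\<lambda>q. (\<lambda>x. q + x) ` lattice_V B) ` R"
  proof
    fix C assume "C \<in> cosets_V S B"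
    then obtain q where q: "q \<in> lattice_V S" "C = (\<lambda>x. q + x) ` lattice_V B"
      by (auto simp: cosets_V_def coroot_lattice_eq)
    define x where "x = (\<Sum>b\<in>B. of_int \<lfloor>q \<bullet> mu_V B b\<rfloor> *\<^sub>R rs_coroot b)"
    have x: "x \<in> lattice_V B" unfolding x_def by (rule lattice_V_memI)
    have "q - x = (\<Sum>b\<in>B. frac (q \<bullet> mu_V B b) *\<^sub>R rs_coroot b)"
    proof -
      have "q = (\<Sum>b\<in>B. (q \<bullet> mu_V B b) *\<^sub>R rs_coroot b)" by (rule mu_V_expand(1)[OF BP(1,2)])
      then have "q - x = (\<Sum>b\<in>B. (q \<bullet> mu_V B b) *\<^sub>R rs_coroot b) - x" by simp
      then show ?thesis by (simp add: x_def frac_def scaleR_left_diff_distrib sum_subtractf)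
    qed
    then have "norm (q - x) \<le> (\<Sum>b\<in>B. norm (frac (q \<bullet> mu_V B b) *\<^sub>R rs_coroot b))"
      by (simp only: norm_sum)
    also have "\<dots> \<le> M"
      unfolding M_def by (intro sum_mono) (simp add: mult_left_le_one_le less_imp_le[OF frac_lt_1])
    finally have "norm (q - x) \<le> M" .
    moreover have "(q - x) \<bullet> mu_V S s \<in> \<int>" if s: "s \<in> S" for s
    proof -
      have ws: "mu_V S s \<in> weights" using mu_V_inner[OF indS spanS s] by (simp add: weights_def)
      have "q \<bullet> mu_V S s \<in> \<int>" by (rule lattice_V_weight_int[OF q(1)]) (use ws in \<open>simp add: weights_def\<close>)
      moreover have "x \<bullet> mu_V S s \<in> \<int>"
        by (rule lattice_V_weight_int[OF x]) (use coroot_weight_int ws BP(4) in blast)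
      ultimately show ?thesis by (simp add: inner_diff_left)
    qed
    ultimately have "q - x \<in> R" by (simp add: R_def)
    moreover have "C = (\<lambda>z. (q - x) + z) ` lattice_V B"
    proof (intro equalityI subsetI)
      fix c assume "c \<in> C"
      then obtain z where "z \<in> lattice_V B" "c = q + z" using q by auto
      then show "c \<in> (\<lambda>z. (q - x) + z) ` lattice_V B" using lattice_V_add[OF x, of z] by (intro image_eqI[of _ _ "x + z"]) auto
    next
      fix c assume "c \<in> (\<lambda>z. (q - x) + z) ` lattice_V B"
      then obtain z where "z \<in> lattice_V B" "c = (q - x) + z" by auto
      then show "c \<in> C" unfolding q(2) using lattice_V_add[OF lattice_V_uminus[OF x], of z] by (intro image_eqI[of _ _ "- x + z"]) auto
    qed
    ultimately show "C \<in> (\<lambda>q. (\<lambda>x. q + x) ` lattice_V B) ` R" by blast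
  qed
  ultimately show ?thesis using finite_surj by blast
qed

lemma cosets_nonempty: "cosets_V S B \<noteq> {}"
  using lattice_V_zero[of S] by (auto simp: cosets_V_def coroot_lattice_eq)

text \<open>The summand is a character of the quotient, trivial precisely when l is a weight.
  Otherwise translation by a simple coroot with nonintegral pairing permutes the cosets and
  multiplies the sum by a number other than 1.\<close>

lemma character_sum:
  assumes B: "B \<in> bases_V D S" and l: "\<And>b. b \<in> B \<Longrightarrow> rs_coroot b \<bullet> l \<in> \<int>"
  shows "(\<Sum>C\<in>cosets_V S B. ee ((SOME q. q \<in> C) \<bullet> l)) =
    (if l \<in> weights then of_nat (card (cosets_V S B)) else 0)"
proof (cases "l \<in> weights")
  case True
  have "ee ((SOME q. q \<in> C) \<bullet> l) = 1" if C: "C \<in> cosets_V S B" for C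
  proof -
    obtain q where q: "q \<in> lattice_V S" "C = (\<lambda>x. q + x) ` lattice_V B"
      using C by (auto simp: cosets_V_def coroot_lattice_eq)
    have "q \<in> C" using q lattice_V_zero[of B] by (auto intro!: image_eqI[of _ _ 0])
    then have "ee ((SOME q. q \<in> C) \<bullet> l) = ee (q \<bullet> l)"
      using coset_inner[OF C l coset_nonempty[OF C]] by blast
    also have "q \<bullet> l \<in> \<int>" by (rule lattice_V_weight_int[OF q(1)]) (use True in \<open>simp add: weights_def\<close>)
    then have "ee (q \<bullet> l) = 1" by (rule exp_2pi_int)
    finally show ?thesis .
  qed
  then show ?thesis using True by simp
next
  case False
  then obtain s where s: "s \<in> S" "rs_coroot s \<bullet> l \<notin> \<int>" by (auto simp: weights_def)
  define u where "u = rs_coroot s"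
  define e where "e = (\<lambda>C. ee ((SOME q. q \<in> C) \<bullet> l))"
  have uQ: "u \<in> lattice_V S"
  proof -
    have "u = (\<Sum>s'\<in>S. of_int (if s' = s then 1 else 0) *\<^sub>R rs_coroot s')"
      using s finS by (simp add: u_def if_distrib[of "\<lambda>x. x *\<^sub>R _"] if_distrib[of of_int] cong: if_cong)
    then show ?thesis using lattice_V_memI[where m = "\<lambda>s'. if s' = s then 1 else 0"] by metis
  qed
  have shift: "(\<lambda>x. v + x) ` C \<in> cosets_V S B" if C: "C \<in> cosets_V S B" and v: "v \<in> lattice_V S" for C v
  proof -
    obtain q where q: "q \<in> lattice_V S" "C = (\<lambda>x. q + x) ` lattice_V B"
      using C by (auto simp: cosets_V_def coroot_lattice_eq)
    have "(\<lambda>x. v + x) ` C = (\<lambda>x. (v + q) + x) ` lattice_V B" unfolding q(2) image_image by (simp add: add.assoc)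
    then show ?thesis using lattice_V_add[OF v q(1)] by (auto simp: cosets_V_def coroot_lattice_eq)
  qed
  have "bij_betw ((`) (\<lambda>x. u + x)) (cosets_V S B) (cosets_V S B)"
  proof (rule bij_betwI[where g = "(`) (\<lambda>x. - u + x)"])
    show "(`) (\<lambda>x. u + x) \<in> cosets_V S B \<rightarrow> cosets_V S B" using shift[OF _ uQ] by blast
    show "(`) (\<lambda>x. - u + x) \<in> cosets_V S B \<rightarrow> cosets_V S B" using shift[OF _ lattice_V_uminus[OF uQ]] by blast
  qed (simp_all add: image_image)
  then have "(\<Sum>C\<in>cosets_V S B. e C) = (\<Sum>C\<in>cosets_V S B. e ((\<lambda>x. u + x) ` C))"
    by (rule sum.reindex_bij_betw[symmetric])
  also have "\<dots> = (\<Sum>C\<in>cosets_V S B. ee (u \<bullet> l) * e C)"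
  proof (rule sum.cong)
    fix C assume C: "C \<in> cosets_V S B"
    have C': "(\<lambda>x. u + x) ` C \<in> cosets_V S B" by (rule shift[OF C uQ])
    have "u + (SOME q. q \<in> C) \<in> (\<lambda>x. u + x) ` C" using coset_nonempty[OF C] by simp
    then have "e ((\<lambda>x. u + x) ` C) = ee ((u + (SOME q. q \<in> C)) \<bullet> l)"
      unfolding e_def using coset_inner[OF C' l coset_nonempty[OF C']] by blast
    then show "e ((\<lambda>x. u + x) ` C) = ee (u \<bullet> l) * e C"
      by (simp add: e_def inner_add_left distrib_left exp_add)
  qed simp
  also have "\<dots> = ee (u \<bullet> l) * (\<Sum>C\<in>cosets_V S B. e C)"
    by (simp add: sum_distrib_left)
  finally have "(ee (u \<bullet> l) - 1) * (\<Sum>C\<in>cosets_V S B. e C) = 0"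
    by (simp add: left_diff_distrib)
  moreover have "ee (u \<bullet> l) \<noteq> 1"
    using exp_2pi_not_int[of "u \<bullet> l"] s by (auto simp: u_def)
  ultimately show ?thesis using False by (simp add: e_def)
qed

end

section \<open>The smoothed generating function\<close>

text \<open>\<open>a\<close> writes \<phi> in coroots of X, so that the shift by a multiple of
  \<phi> becomes the lower corner of a box in the directions of X. \<open>\<delta>\<close> bounds
  the edges relative to that shift: in every dual coordinate the extent of the box is smaller than
  the shift, so all its points lie on the same side as \<phi>.\<close>

locale root_sum = based_root_system D S for D S :: "'a::euclidean_space set" +
  fixes X :: "'a set" and ns :: "'a list" and \<phi> y :: 'a and a :: "'a \<Rightarrow> real" and \<delta> :: real
  assumes X: "X \<subseteq> pos_roots D S" and spX: "span X = UNIV"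
    and ns: "distinct ns" "set ns = pos_roots D S - X"
    and generic: "generic_phi D S \<phi>"
    and phi: "\<phi> = (\<Sum>\<alpha>\<in>X. a \<alpha> *\<^sub>R rs_coroot \<alpha>)"
    and delta: "\<delta> > 0" "\<And>B \<beta>. B \<in> bases_V D S \<Longrightarrow> \<beta> \<in> B \<Longrightarrow>
       \<delta> * (\<Sum>\<alpha>\<in>X. \<bar>rs_coroot \<alpha> \<bullet> mu_V B \<beta>\<bar>) < \<bar>\<phi> \<bullet> mu_V B \<beta>\<bar>"
begin

section \<open>The averaging box and its cells\<close>

lemma finX: "finite X" using X finP finite_subset by blast

lemma XD: "X \<subseteq> D" using X PD by blast

lemma finite_bases_V: "finite (bases_V D S)"
  by (rule finite_subset[of _ "Pow (pos_roots D S)"]) (use finP in \<open>auto simp: bases_V_def\<close>)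

definition lo :: "real \<Rightarrow> 'a \<Rightarrow> real" where "lo \<epsilon> \<alpha> = \<epsilon> * a \<alpha>"
definition hi :: "real \<Rightarrow> 'a \<Rightarrow> real" where "hi \<epsilon> \<alpha> = \<epsilon> * (a \<alpha> + \<delta>)"

lemma lo_less_hi: "\<epsilon> > 0 \<Longrightarrow> lo \<epsilon> \<alpha> < hi \<epsilon> \<alpha>"
  using delta(1) by (simp add: lo_def hi_def)

text \<open>On the whole box the fractional part at $y + q$ moves inside one closed unit cell, so it is affine there; frac_V prescribes the cell on the side of $\phi$.\<close>

definition cell_cond :: "real \<Rightarrow> 'a set \<Rightarrow> 'a set \<Rightarrow> 'a \<Rightarrow> bool" where
  "cell_cond \<epsilon> B C \<beta> \<longleftrightarrow> (\<forall>s. (\<forall>\<alpha>\<in>X. s \<alpha> \<in> {lo \<epsilon> \<alpha>..hi \<epsilon> \<alpha>}) \<longrightarrow>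
     - frac_V \<phi> B \<beta> (y + (SOME q. q \<in> C)) \<le> (\<Sum>\<alpha>\<in>X. s \<alpha> * (rs_coroot \<alpha> \<bullet> mu_V B \<beta>)) \<and>
     (\<Sum>\<alpha>\<in>X. s \<alpha> * (rs_coroot \<alpha> \<bullet> mu_V B \<beta>)) \<le> 1 - frac_V \<phi> B \<beta> (y + (SOME q. q \<in> C)))"

definition cell_ok :: "real \<Rightarrow> bool" where
  "cell_ok \<epsilon> \<longleftrightarrow> (\<forall>B\<in>bases_V D S. \<forall>C\<in>cosets_V S B. \<forall>\<beta>\<in>B. cell_cond \<epsilon> B C \<beta>)"

text \<open>A point of the box has a coordinate T with |T - \<epsilon> P| < \<epsilon> |P|, where P
  is the coordinate of \<phi>. So T has the sign of P and size below 2 \<epsilon> |P|, which for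
  small \<epsilon> is less than the room left in the cell.\<close>

lemma eventually_cell_ok: "eventually cell_ok (at_right 0)"
proof -
  have "eventually (\<lambda>\<epsilon>. \<forall>B\<in>bases_V D S. \<forall>C\<in>cosets_V S B. \<forall>\<beta>\<in>B. cell_cond \<epsilon> B C \<beta>) (at_right 0)"
  proof (intro eventually_ball_finite ballI)
    show "finite (bases_V D S)" by (rule finite_bases_V)
    fix B assume B: "B \<in> bases_V D S"
    show "finite (cosets_V S B)" by (rule finite_cosets[OF B])
    show "finite B" by (rule bases_V_props(3)[OF B])
    fix C \<beta> assume C: "C \<in> cosets_V S B" and \<beta>: "\<beta> \<in> B"
    define x where "x = y + (SOME q. q \<in> C)"
    define P where "P = \<phi> \<bullet> mu_V B \<beta>"
    define c where "c = (\<lambda>\<alpha>. rs_coroot \<alpha> \<bullet> mu_V B \<beta>)"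
    \<comment> \<open>The distance to the wall of the cell that lies ahead in the direction of
      \<phi>. It is positive even at integer coordinates, which is the purpose of the two cases in
      \<open>frac_V\<close>.\<close>
    define g where "g = (if P > 0 then 1 - frac (x \<bullet> mu_V B \<beta>) else frac_V \<phi> B \<beta> x)"
    have P0: "P \<noteq> 0" using generic B \<beta> by (auto simp: generic_phi_def P_def)
    have g0: "g > 0"
      using frac_lt_1[of "x \<bullet> mu_V B \<beta>"] frac_lt_1[of "- (x \<bullet> mu_V B \<beta>)"] by (auto simp: g_def frac_V_def P_def)
    have "((\<lambda>\<epsilon>. \<epsilon> * (2 * \<bar>P\<bar>)) \<longlongrightarrow> 0 * (2 * \<bar>P\<bar>)) (at_right 0)" by (intro tendsto_intros)
    then have "eventually (\<lambda>\<epsilon>. \<epsilon> * (2 * \<bar>P\<bar>) < g) (at_right 0)"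
      by (rule order_tendstoD) (use g0 in simp)
    moreover have "eventually (\<lambda>\<epsilon>::real. \<epsilon> > 0) (at_right 0)" by (simp add: eventually_at_right_less)
    ultimately show "eventually (\<lambda>\<epsilon>. cell_cond \<epsilon> B C \<beta>) (at_right 0)"
    proof eventually_elim
      case (elim \<epsilon>)
      show ?case
        unfolding cell_cond_def
      proof (intro allI impI)
        fix s assume s: "\<forall>\<alpha>\<in>X. s \<alpha> \<in> {lo \<epsilon> \<alpha>..hi \<epsilon> \<alpha>}"
        define T where "T = (\<Sum>\<alpha>\<in>X. s \<alpha> * c \<alpha>)"
        have PP: "P = (\<Sum>\<alpha>\<in>X. a \<alpha> * c \<alpha>)" by (simp add: P_def phi c_def inner_sum_left)
        have "\<bar>T - \<epsilon> * P\<bar> = \<bar>\<Sum>\<alpha>\<in>X. (s \<alpha> - lo \<epsilon> \<alpha>) * c \<alpha>\<bar>"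
          by (simp add: T_def PP lo_def sum_distrib_left sum_subtractf[symmetric] algebra_simps)
        also have "\<dots> \<le> (\<Sum>\<alpha>\<in>X. \<bar>(s \<alpha> - lo \<epsilon> \<alpha>) * c \<alpha>\<bar>)" by (rule sum_abs)
        also have "\<dots> \<le> (\<Sum>\<alpha>\<in>X. (\<epsilon> * \<delta>) * \<bar>c \<alpha>\<bar>)"
        proof (rule sum_mono)
          fix \<alpha> assume "\<alpha> \<in> X"
          then have "\<bar>s \<alpha> - lo \<epsilon> \<alpha>\<bar> \<le> \<epsilon> * \<delta>" using s by (auto simp: lo_def hi_def algebra_simps)
          then show "\<bar>(s \<alpha> - lo \<epsilon> \<alpha>) * c \<alpha>\<bar> \<le> (\<epsilon> * \<delta>) * \<bar>c \<alpha>\<bar>" by (simp add: abs_mult mult_right_mono)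
        qed
        also have "\<dots> = \<epsilon> * (\<delta> * (\<Sum>\<alpha>\<in>X. \<bar>c \<alpha>\<bar>))" by (simp add: sum_distrib_left mult_ac)
        also have "\<dots> < \<epsilon> * \<bar>P\<bar>" using delta(2)[OF B \<beta>] elim by (simp add: c_def P_def)
        finally have T: "\<bar>T - \<epsilon> * P\<bar> < \<epsilon> * \<bar>P\<bar>" .
        have "- frac_V \<phi> B \<beta> x \<le> T \<and> T \<le> 1 - frac_V \<phi> B \<beta> x"
        proof (cases "P > 0")
          case True
          then have "0 < T" "T < \<epsilon> * (2 * \<bar>P\<bar>)" using T by auto
          moreover have "frac_V \<phi> B \<beta> x = frac (x \<bullet> mu_V B \<beta>)" using True by (simp add: frac_V_def P_def)
          moreover have "g = 1 - frac (x \<bullet> mu_V B \<beta>)" using True by (simp add: g_def)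
          ultimately show ?thesis using elim frac_ge_0[of "x \<bullet> mu_V B \<beta>"] by linarith
        next
          case False
          then have "P < 0" using P0 by simp
          then have "T < 0" "- T < \<epsilon> * (2 * \<bar>P\<bar>)" using T by auto
          moreover have "frac_V \<phi> B \<beta> x \<le> 1" using False frac_ge_0[of "- (x \<bullet> mu_V B \<beta>)"] by (simp add: frac_V_def P_def)
          ultimately show ?thesis using elim False by (simp add: g_def)
        qed
        then show "- frac_V \<phi> B \<beta> (y + (SOME q. q \<in> C)) \<le> (\<Sum>\<alpha>\<in>X. s \<alpha> * (rs_coroot \<alpha> \<bullet> mu_V B \<beta>)) \<and>
          (\<Sum>\<alpha>\<in>X. s \<alpha> * (rs_coroot \<alpha> \<bullet> mu_V B \<beta>)) \<le> 1 - frac_V \<phi> B \<beta> (y + (SOME q. q \<in> C))"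
          by (simp add: x_def T_def c_def)
      qed
    qed
  qed
  then show ?thesis unfolding cell_ok_def .
qed

lemma frac_V_int: "\<exists>n::int. x \<bullet> mu_V B \<beta> - frac_V \<phi> B \<beta> x = of_int n"
proof (cases "\<phi> \<bullet> mu_V B \<beta> > 0")
  case True
  then show ?thesis by (intro exI[of _ "\<lfloor>x \<bullet> mu_V B \<beta>\<rfloor>"]) (simp add: frac_V_def frac_def)
next
  case False
  then show ?thesis by (intro exI[of _ "- 1 - \<lfloor>- (x \<bullet> mu_V B \<beta>)\<rfloor>"]) (simp add: frac_V_def frac_def)
qed

text \<open>The mean over the box of the exponential of the sum of all s_\<alpha>
  \<open>z \<alpha>\<close>, which factors over the directions.\<close>

definition box_exp_mean :: "real \<Rightarrow> ('a \<Rightarrow> complex) \<Rightarrow> complex" where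
  "box_exp_mean \<epsilon> z = (\<Prod>\<alpha>\<in>X. exp_mean (lo \<epsilon> \<alpha>) (hi \<epsilon> \<alpha>) (z \<alpha>))"

text \<open>The pairing of $\alpha^\vee$ with the point $\sum_\beta t_\beta \mu^{\mathbf V}_\beta$.\<close>

definition tau :: "'a set \<Rightarrow> ('a \<Rightarrow> complex) \<Rightarrow> 'a \<Rightarrow> complex" where
  "tau B t \<alpha> = (\<Sum>\<beta>\<in>B - set ns. t \<beta> * complex_of_real (rs_coroot \<alpha> \<bullet> mu_V B \<beta>))"

definition wpair :: "'a \<Rightarrow> 'a \<Rightarrow> complex" where
  "wpair l \<alpha> = 2 * pi * \<i> * complex_of_real (rs_coroot \<alpha> \<bullet> l)"

abbreviation coset_prod :: "'a set \<Rightarrow> 'a set \<Rightarrow> ('a \<Rightarrow> complex) \<Rightarrow> complex" where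
  "coset_prod B C t \<equiv> \<Prod>\<beta>\<in>B - set ns. t \<beta> * exp (t \<beta> * complex_of_real (frac_V \<phi> B \<beta> (y + (SOME q. q \<in> C)))) / (exp (t \<beta>) - 1)"

text \<open>The directions of the basis are averaged first, which turns each one-dimensional factor into an absolutely convergent series; the remaining directions are then averaged term by term.\<close>

lemma smoothed_product:
  assumes \<epsilon>: "\<epsilon> > 0" "cell_ok \<epsilon>" and B: "B \<in> bases_V D S" and C: "C \<in> cosets_V S B"
    and t: "\<And>\<alpha>. \<alpha> \<in> X \<Longrightarrow> norm (t \<alpha>) < 1 \<and> t \<alpha> \<noteq> 0"
  defines "J \<equiv> B - set ns"
  defines "q \<equiv> SOME q. q \<in> C"
  defines "lam \<equiv> (\<lambda>m::'a \<Rightarrow> int. \<Sum>\<beta>\<in>J. of_int (m \<beta>) *\<^sub>R mu_V B \<beta>)"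
  shows "((\<lambda>m. ee ((y + q) \<bullet> lam m) *
        ((\<Prod>\<beta>\<in>J. t \<beta> / (t \<beta> - 2 * pi * \<i> * of_int (m \<beta>))) * box_exp_mean \<epsilon> (wpair (lam m)))) has_sum
      ((\<Prod>\<beta>\<in>J. t \<beta> * exp (t \<beta> * complex_of_real (frac_V \<phi> B \<beta> (y + q))) / (exp (t \<beta>) - 1)) * box_exp_mean \<epsilon> (tau B t)))
      (PiE J (\<lambda>_. UNIV))"
proof -
  note BP = bases_V_props[OF B]
  have JX: "J \<subseteq> X" and JB: "J \<subseteq> B" using B ns by (auto simp: J_def bases_V_def)
  have finJ: "finite J" using JX finX finite_subset by blast
  define G where "G = X - J"
  have finG: "finite G" using finX by (simp add: G_def)
  have XJG: "X = J \<union> G" "J \<inter> G = {}" using JX by (auto simp: G_def)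
  have splitX: "(\<Prod>\<alpha>\<in>X. f \<alpha>) = (\<Prod>\<alpha>\<in>J. f \<alpha>) * (\<Prod>\<alpha>\<in>G. f \<alpha>)" for f :: "'a \<Rightarrow> complex"
    unfolding XJG(1) by (rule prod.union_disjoint) (use finJ finG XJG in auto)
  define c where "c = (\<lambda>\<alpha> \<beta>. rs_coroot \<alpha> \<bullet> mu_V B \<beta>)"
  have cJ: "c \<alpha> \<beta> = (if \<alpha> = \<beta> then 1 else 0)" if "\<alpha> \<in> J" "\<beta> \<in> J" for \<alpha> \<beta>
    using mu_V_inner[OF BP(1,2), of \<beta> \<alpha>] subsetD[OF JB that(1)] subsetD[OF JB that(2)] by (simp add: c_def)
  define b where "b = (\<lambda>\<beta> (m::int). t \<beta> / (t \<beta> - 2 * pi * \<i> * of_int m) * exp_mean (lo \<epsilon> \<beta>) (hi \<epsilon> \<beta>) (2 * pi * \<i> * of_int m))"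
  \<comment> \<open>The coordinate along \<beta> of y + q after moving in the directions outside the
    basis; the directions in J other than \<beta> do not affect it.\<close>
  define xx where "xx = (\<lambda>s \<beta>. (y + q) \<bullet> mu_V B \<beta> + (\<Sum>\<gamma>\<in>G. s \<gamma> * c \<gamma> \<beta>))"
  define fr where "fr = (\<lambda>\<beta>. frac_V \<phi> B \<beta> (y + q))"
  define am where "am = (\<lambda>m. (\<Prod>\<beta>\<in>J. b \<beta> (m \<beta>)) * ee ((y + q) \<bullet> lam m))"
  define K where "K = (\<Prod>\<beta>\<in>J. t \<beta> * exp (t \<beta> * of_real (fr \<beta>)) / (exp (t \<beta>) - 1) * exp_mean (lo \<epsilon> \<beta>) (hi \<epsilon> \<beta>) (t \<beta>))"
  define z where "z = (\<lambda>\<gamma>. \<Sum>\<beta>\<in>J. t \<beta> * complex_of_real (c \<gamma> \<beta>))"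
  note lh = lo_less_hi[OF \<epsilon>(1)]
  have tJ: "norm (t \<beta>) < 1" "t \<beta> \<noteq> 0" if "\<beta> \<in> J" for \<beta> using t that JX by auto
  have lamc: "rs_coroot \<alpha> \<bullet> lam m = (\<Sum>\<beta>\<in>J. of_int (m \<beta>) * c \<alpha> \<beta>)" for \<alpha> m
    by (simp add: lam_def inner_sum_right c_def)
  have lamJ: "rs_coroot \<beta> \<bullet> lam m = of_int (m \<beta>)" if "\<beta> \<in> J" for \<beta> m
  proof -
    have "(\<Sum>\<beta>'\<in>J. of_int (m \<beta>') * c \<beta> \<beta>') = (\<Sum>\<beta>'\<in>J. if \<beta>' = \<beta> then of_int (m \<beta>') else 0)"
      by (rule sum.cong) (use cJ that in auto)
    then show ?thesis using that finJ by (simp add: lamc)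
  qed
  have step: "((\<lambda>m. am m * (\<Prod>\<gamma>\<in>G. exp (of_real (s \<gamma>) * wpair (lam m) \<gamma>))) has_sum (K * (\<Prod>\<gamma>\<in>G. exp (of_real (s \<gamma>) * z \<gamma>)))) (PiE J (\<lambda>_. UNIV))"
    if s: "\<And>\<gamma>. \<gamma> \<in> G \<Longrightarrow> s \<gamma> \<in> {lo \<epsilon> \<gamma>..hi \<epsilon> \<gamma>}" for s
  proof -
    have f1: "((\<lambda>m. b \<beta> m * cis (2 * pi * of_int m * xx s \<beta>)) has_sum
        (t \<beta> * exp (t \<beta> * of_real (fr \<beta>)) / (exp (t \<beta>) - 1) * exp_mean (lo \<epsilon> \<beta>) (hi \<epsilon> \<beta>) (t \<beta>) * exp (t \<beta> * of_real (\<Sum>\<gamma>\<in>G. s \<gamma> * c \<gamma> \<beta>)))) UNIV"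
      if \<beta>: "\<beta> \<in> J" for \<beta>
    proof -
      obtain n :: int where n: "(y + q) \<bullet> mu_V B \<beta> - fr \<beta> = of_int n" using frac_V_int fr_def by blast
      have cell: "- fr \<beta> \<le> u + (\<Sum>\<gamma>\<in>G. s \<gamma> * c \<gamma> \<beta>) \<and> u + (\<Sum>\<gamma>\<in>G. s \<gamma> * c \<gamma> \<beta>) \<le> 1 - fr \<beta>"
        if u: "u \<in> {lo \<epsilon> \<beta>..hi \<epsilon> \<beta>}" for u
      proof -
        \<comment> \<open>The cell condition speaks of points of the whole box, so the remaining
          members of J receive the admissible value \<open>lo \<epsilon>\<close>; they do not
          contribute, since c is the Kronecker symbol on J.\<close>
        define s' where "s' = (\<lambda>\<alpha>. if \<alpha> \<in> G then s \<alpha> else if \<alpha> = \<beta> then u else lo \<epsilon> \<alpha>)"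
        have s': "\<forall>\<alpha>\<in>X. s' \<alpha> \<in> {lo \<epsilon> \<alpha>..hi \<epsilon> \<alpha>}"
          using s u lh by (auto simp: s'_def less_imp_le)
        have "(\<Sum>\<alpha>\<in>X. s' \<alpha> * c \<alpha> \<beta>) = (\<Sum>\<alpha>\<in>J. s' \<alpha> * c \<alpha> \<beta>) + (\<Sum>\<alpha>\<in>G. s' \<alpha> * c \<alpha> \<beta>)"
          unfolding XJG(1) by (rule sum.union_disjoint) (use finJ finG XJG in auto)
        also have "(\<Sum>\<alpha>\<in>J. s' \<alpha> * c \<alpha> \<beta>) = (\<Sum>\<alpha>\<in>J. if \<alpha> = \<beta> then u else 0)"
          by (rule sum.cong) (use cJ \<beta> XJG in \<open>auto simp: s'_def\<close>)
        also have "\<dots> = u" using \<beta> finJ by simp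
        also have "(\<Sum>\<alpha>\<in>G. s' \<alpha> * c \<alpha> \<beta>) = (\<Sum>\<alpha>\<in>G. s \<alpha> * c \<alpha> \<beta>)" by (rule sum.cong) (auto simp: s'_def)
        finally have "(\<Sum>\<alpha>\<in>X. s' \<alpha> * c \<alpha> \<beta>) = u + (\<Sum>\<alpha>\<in>G. s \<alpha> * c \<alpha> \<beta>)" .
        then show ?thesis
          using \<epsilon>(2)[unfolded cell_ok_def cell_cond_def, rule_format, OF B C, of \<beta> s'] s' \<beta> JB
          unfolding c_def fr_def q_def by auto
      qed
      \<comment> \<open>Both ends of the averaging interval lie in one closed unit cell, as
        \<open>bern_smooth_cell\<close> demands.\<close>
      have x1: "of_int n \<le> xx s \<beta> + lo \<epsilon> \<beta>" "xx s \<beta> + hi \<epsilon> \<beta> \<le> of_int n + 1"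
        using cell[of "lo \<epsilon> \<beta>"] cell[of "hi \<epsilon> \<beta>"] less_imp_le[OF lh] n by (auto simp: xx_def)
      have "xx s \<beta> - of_int n = fr \<beta> + (\<Sum>\<gamma>\<in>G. s \<gamma> * c \<gamma> \<beta>)" using n by (simp add: xx_def)
      then have "exp (t \<beta> * of_real (xx s \<beta> - of_int n)) = exp (t \<beta> * of_real (fr \<beta>)) * exp (t \<beta> * of_real (\<Sum>\<gamma>\<in>G. s \<gamma> * c \<gamma> \<beta>))"
        by (simp add: distrib_left exp_add del: of_real_sum)
      then show ?thesis
        using bern_smooth_series[OF tJ[OF \<beta>] lh[of \<beta>], of "xx s \<beta>"] bern_smooth_cell[OF tJ[OF \<beta>] lh x1]
        by (simp add: b_def mult_ac)
    qed
    have "((\<lambda>m. \<Prod>\<beta>\<in>J. b \<beta> (m \<beta>) * cis (2 * pi * of_int (m \<beta>) * xx s \<beta>)) has_sum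
       (\<Prod>\<beta>\<in>J. t \<beta> * exp (t \<beta> * of_real (fr \<beta>)) / (exp (t \<beta>) - 1) * exp_mean (lo \<epsilon> \<beta>) (hi \<epsilon> \<beta>) (t \<beta>) * exp (t \<beta> * of_real (\<Sum>\<gamma>\<in>G. s \<gamma> * c \<gamma> \<beta>)))) (PiE J (\<lambda>_. UNIV))"
      by (rule has_sum_prod_PiE[OF finJ, where f = "\<lambda>\<beta> m. b \<beta> m * cis (2 * pi * of_int m * xx s \<beta>)"]) (rule f1)
    then have "((\<lambda>m. \<Prod>\<beta>\<in>J. b \<beta> (m \<beta>) * cis (2 * pi * of_int (m \<beta>) * xx s \<beta>)) has_sum
       (K * (\<Prod>\<beta>\<in>J. exp (t \<beta> * of_real (\<Sum>\<gamma>\<in>G. s \<gamma> * c \<gamma> \<beta>))))) (PiE J (\<lambda>_. UNIV))"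
      unfolding K_def prod.distrib[symmetric] by (simp only: mult.assoc)
    moreover have "(\<Prod>\<beta>\<in>J. exp (t \<beta> * of_real (\<Sum>\<gamma>\<in>G. s \<gamma> * c \<gamma> \<beta>))) = (\<Prod>\<gamma>\<in>G. exp (of_real (s \<gamma>) * z \<gamma>))"
    proof -
      have "(\<Prod>\<beta>\<in>J. exp (t \<beta> * of_real (\<Sum>\<gamma>\<in>G. s \<gamma> * c \<gamma> \<beta>))) = exp (\<Sum>\<beta>\<in>J. \<Sum>\<gamma>\<in>G. of_real (s \<gamma>) * (t \<beta> * of_real (c \<gamma> \<beta>)))"
        by (simp add: exp_sum[OF finJ] sum_distrib_left mult_ac)
      also have "\<dots> = exp (\<Sum>\<gamma>\<in>G. of_real (s \<gamma>) * z \<gamma>)"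
        unfolding z_def sum_distrib_left by (subst sum.swap) simp
      finally show ?thesis by (simp add: exp_sum[OF finG])
    qed
    moreover have "(\<Prod>\<beta>\<in>J. b \<beta> (m \<beta>) * cis (2 * pi * of_int (m \<beta>) * xx s \<beta>)) =
       am m * (\<Prod>\<gamma>\<in>G. exp (of_real (s \<gamma>) * wpair (lam m) \<gamma>))" for m
    proof -
      have "(\<Prod>\<beta>\<in>J. cis (2 * pi * of_int (m \<beta>) * xx s \<beta>)) = exp (\<Sum>\<beta>\<in>J. 2 * pi * \<i> * of_real (of_int (m \<beta>) * xx s \<beta>))"
        unfolding exp_sum[OF finJ] by (rule prod.cong) (simp_all add: cis_conv_exp mult_ac)
      also have "(\<Sum>\<beta>\<in>J. 2 * pi * \<i> * of_real (of_int (m \<beta>) * xx s \<beta>)) = 2 * pi * \<i> * of_real (\<Sum>\<beta>\<in>J. of_int (m \<beta>) * xx s \<beta>)"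
        by (simp add: sum_distrib_left)
      also have "(\<Sum>\<beta>\<in>J. of_int (m \<beta>) * xx s \<beta>) = (y + q) \<bullet> lam m + (\<Sum>\<gamma>\<in>G. s \<gamma> * (rs_coroot \<gamma> \<bullet> lam m))"
      proof -
        have "(\<Sum>\<beta>\<in>J. of_int (m \<beta>) * (\<Sum>\<gamma>\<in>G. s \<gamma> * c \<gamma> \<beta>)) = (\<Sum>\<beta>\<in>J. \<Sum>\<gamma>\<in>G. s \<gamma> * (of_int (m \<beta>) * c \<gamma> \<beta>))"
          by (simp add: sum_distrib_left mult_ac)
        also have "\<dots> = (\<Sum>\<gamma>\<in>G. s \<gamma> * (rs_coroot \<gamma> \<bullet> lam m))"
          unfolding lamc sum_distrib_left by (rule sum.swap)
        finally show ?thesis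
          by (simp add: xx_def distrib_left sum.distrib lam_def inner_sum_right)
      qed
      also have "2 * pi * \<i> * of_real ((y + q) \<bullet> lam m + (\<Sum>\<gamma>\<in>G. s \<gamma> * (rs_coroot \<gamma> \<bullet> lam m))) =
         2 * pi * \<i> * of_real ((y + q) \<bullet> lam m) + (\<Sum>\<gamma>\<in>G. of_real (s \<gamma>) * wpair (lam m) \<gamma>)"
        by (simp add: distrib_left wpair_def sum_distrib_left mult_ac)
      finally show ?thesis
        by (simp add: prod.distrib am_def exp_add exp_sum[OF finG] mult_ac)
    qed
    ultimately show ?thesis by simp
  qed
  have sum_am: "(\<lambda>m. norm (am m)) summable_on (PiE J (\<lambda>_. UNIV))"
  proof -
    have bs: "b \<beta> summable_on UNIV" if "\<beta> \<in> J" for \<beta>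
      using has_sum_imp_summable[OF bern_smooth_series[OF tJ[OF that] lh[of \<beta>], of 0]] by (simp add: b_def[abs_def])
    then have "(\<lambda>m. norm (b \<beta> m)) summable_on UNIV" if "\<beta> \<in> J" for \<beta>
      by (rule summable_on_iff_abs_summable_on_complex[THEN iffD1]) (use that bs in auto)
    then have "(\<lambda>m. \<Prod>\<beta>\<in>J. norm (b \<beta> (m \<beta>))) summable_on (PiE J (\<lambda>_. UNIV))"
      by (intro summable_prod_PiE finJ) auto
    moreover have "norm (am m) = (\<Prod>\<beta>\<in>J. norm (b \<beta> (m \<beta>)))" for m
      by (simp add: am_def norm_mult prod_norm)
    ultimately show ?thesis by simp
  qed
  \<comment> \<open>Now the directions in G are averaged; \<open>am\<close> is absolutely summable
    thanks to the first averaging.\<close>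
  have "((\<lambda>m. am m * (\<Prod>\<gamma>\<in>G. exp_mean (lo \<epsilon> \<gamma>) (hi \<epsilon> \<gamma>) (wpair (lam m) \<gamma>))) has_sum (K * (\<Prod>\<gamma>\<in>G. exp_mean (lo \<epsilon> \<gamma>) (hi \<epsilon> \<gamma>) (z \<gamma>)))) (PiE J (\<lambda>_. UNIV))"
    by (rule smooth_series[OF finG lh sum_am _ step]) (simp_all add: wpair_def)
  moreover have "am m * (\<Prod>\<gamma>\<in>G. exp_mean (lo \<epsilon> \<gamma>) (hi \<epsilon> \<gamma>) (wpair (lam m) \<gamma>)) =
      ee ((y + q) \<bullet> lam m) *
        ((\<Prod>\<beta>\<in>J. t \<beta> / (t \<beta> - 2 * pi * \<i> * of_int (m \<beta>))) * box_exp_mean \<epsilon> (wpair (lam m)))" for m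
  proof -
    have "box_exp_mean \<epsilon> (wpair (lam m)) = (\<Prod>\<beta>\<in>J. exp_mean (lo \<epsilon> \<beta>) (hi \<epsilon> \<beta>) (wpair (lam m) \<beta>)) * (\<Prod>\<gamma>\<in>G. exp_mean (lo \<epsilon> \<gamma>) (hi \<epsilon> \<gamma>) (wpair (lam m) \<gamma>))"
      unfolding box_exp_mean_def by (rule splitX)
    moreover have "(\<Prod>\<beta>\<in>J. exp_mean (lo \<epsilon> \<beta>) (hi \<epsilon> \<beta>) (wpair (lam m) \<beta>)) = (\<Prod>\<beta>\<in>J. exp_mean (lo \<epsilon> \<beta>) (hi \<epsilon> \<beta>) (2 * pi * \<i> * of_int (m \<beta>)))"
      by (rule prod.cong) (simp_all add: wpair_def lamJ)
    ultimately show ?thesis unfolding am_def b_def prod.distrib by (simp only: mult_ac)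
  qed
  moreover have "K * (\<Prod>\<gamma>\<in>G. exp_mean (lo \<epsilon> \<gamma>) (hi \<epsilon> \<gamma>) (z \<gamma>)) =
     (\<Prod>\<beta>\<in>J. t \<beta> * exp (t \<beta> * complex_of_real (frac_V \<phi> B \<beta> (y + q))) / (exp (t \<beta>) - 1)) * box_exp_mean \<epsilon> (tau B t)"
  proof -
    have tz: "tau B t \<alpha> = z \<alpha>" for \<alpha> by (simp add: tau_def z_def c_def J_def)
    have zJ: "z \<beta> = t \<beta>" if "\<beta> \<in> J" for \<beta>
    proof -
      have "z \<beta> = (\<Sum>\<beta>'\<in>J. if \<beta>' = \<beta> then t \<beta>' else 0)"
        unfolding z_def by (rule sum.cong) (use cJ that in auto)
      then show ?thesis using that finJ by simp
    qed
    have "box_exp_mean \<epsilon> (tau B t) = (\<Prod>\<beta>\<in>J. exp_mean (lo \<epsilon> \<beta>) (hi \<epsilon> \<beta>) (z \<beta>)) * (\<Prod>\<gamma>\<in>G. exp_mean (lo \<epsilon> \<gamma>) (hi \<epsilon> \<gamma>) (z \<gamma>))"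
      unfolding box_exp_mean_def tz by (rule splitX)
    moreover have "(\<Prod>\<beta>\<in>J. exp_mean (lo \<epsilon> \<beta>) (hi \<epsilon> \<beta>) (z \<beta>)) = (\<Prod>\<beta>\<in>J. exp_mean (lo \<epsilon> \<beta>) (hi \<epsilon> \<beta>) (t \<beta>))"
      by (rule prod.cong) (simp_all add: zJ)
    ultimately show ?thesis unfolding K_def fr_def prod.distrib by (simp only: mult_ac)
  qed
  ultimately show ?thesis by simp
qed

text \<open>Averaging the shifts over the cosets leaves, by \<open>character_sum\<close>, exactly
  those points of the lattice dual to \<open>lattice_V B\<close> that are weights. Since the
  coordinates along \<open>B \<inter> set ns\<close> are 0, these are the weights orthogonal to that
  set.\<close>

lemma smoothed_coset_average:
  assumes \<epsilon>: "\<epsilon> > 0" "cell_ok \<epsilon>" and B: "B \<in> bases_V D S"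
    and t: "\<And>\<alpha>. \<alpha> \<in> X \<Longrightarrow> norm (t \<alpha>) < 1 \<and> t \<alpha> \<noteq> 0"
  shows "((\<lambda>l. if \<forall>i\<in>B \<inter> set ns. i \<bullet> l = 0 then ee (y \<bullet> l) *
        ((\<Prod>\<beta>\<in>B - set ns. t \<beta> / (t \<beta> - wpair l \<beta>)) * box_exp_mean \<epsilon> (wpair l)) else 0) has_sum
      (1 / of_nat (card (cosets_V S B)) *
       (\<Sum>C\<in>cosets_V S B. coset_prod B C t)
       * box_exp_mean \<epsilon> (tau B t))) weights"
proof -
  note BP = bases_V_props[OF B]
  define J where "J = B - set ns"
  have JX: "J \<subseteq> X" and JB: "J \<subseteq> B" using B ns by (auto simp: J_def bases_V_def)
  have finJ: "finite J" using JX finX finite_subset by blast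
  define lam where "lam = (\<lambda>m::'a \<Rightarrow> int. \<Sum>\<beta>\<in>J. of_int (m \<beta>) *\<^sub>R mu_V B \<beta>)"
  define gg where "gg = (\<lambda>m. (\<Prod>\<beta>\<in>J. t \<beta> / (t \<beta> - 2 * pi * \<i> * of_int (m \<beta>))) * box_exp_mean \<epsilon> (wpair (lam m)))"
  define N where "N = card (cosets_V S B)"
  have N0: "N \<noteq> 0" using finite_cosets[OF B] cosets_nonempty by (simp add: N_def)
  have lamB: "rs_coroot b \<bullet> lam m = (if b \<in> J then of_int (m b) else 0)" if b: "b \<in> B" for b m
  proof -
    have "rs_coroot b \<bullet> lam m = (\<Sum>\<beta>\<in>J. if \<beta> = b then of_int (m \<beta>) else 0)"
      unfolding lam_def inner_sum_right by (rule sum.cong) (use mu_V_inner[OF BP(1,2) _ b] JB in auto)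
    then show ?thesis using finJ by simp
  qed
  have "((\<lambda>m. \<Sum>C\<in>cosets_V S B. ee ((y + (SOME q. q \<in> C)) \<bullet> lam m) * gg m) has_sum
      (\<Sum>C\<in>cosets_V S B. coset_prod B C t * box_exp_mean \<epsilon> (tau B t)))
      (PiE J (\<lambda>_. UNIV))"
    unfolding gg_def lam_def J_def by (intro has_sum_finite_sum finite_cosets B smoothed_product \<epsilon> t)
  then have "((\<lambda>m. 1 / of_nat N * (\<Sum>C\<in>cosets_V S B. ee ((y + (SOME q. q \<in> C)) \<bullet> lam m) * gg m)) has_sum
      (1 / of_nat N * (\<Sum>C\<in>cosets_V S B. coset_prod B C t * box_exp_mean \<epsilon> (tau B t))))
      (PiE J (\<lambda>_. UNIV))"
    by (rule has_sum_cmult_right)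
  moreover have "1 / of_nat N * (\<Sum>C\<in>cosets_V S B. ee ((y + (SOME q. q \<in> C)) \<bullet> lam m) * gg m) =
     (if lam m \<in> weights then ee (y \<bullet> lam m) * gg m else 0)" for m
  proof -
    have "(\<Sum>C\<in>cosets_V S B. ee ((y + (SOME q. q \<in> C)) \<bullet> lam m) * gg m) =
      (\<Sum>C\<in>cosets_V S B. ee ((SOME q. q \<in> C) \<bullet> lam m)) * (ee (y \<bullet> lam m) * gg m)"
      unfolding sum_distrib_right by (rule sum.cong) (simp_all add: inner_add_left distrib_left exp_add mult_ac)
    also have "(\<Sum>C\<in>cosets_V S B. ee ((SOME q. q \<in> C) \<bullet> lam m)) = (if lam m \<in> weights then of_nat N else 0)"
      unfolding N_def by (rule character_sum[OF B]) (simp add: lamB)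
    finally show ?thesis using N0 by simp
  qed
  ultimately have hs: "((\<lambda>m. if lam m \<in> weights then ee (y \<bullet> lam m) * gg m else 0) has_sum
      (1 / of_nat N * (\<Sum>C\<in>cosets_V S B. coset_prod B C t) * box_exp_mean \<epsilon> (tau B t)))
      (PiE J (\<lambda>_. UNIV))"
    by (simp add: sum_distrib_right mult.assoc)
  define W where "W = {l \<in> weights. \<forall>i\<in>B \<inter> set ns. i \<bullet> l = 0}"
  define K where "K = {m \<in> PiE J (\<lambda>_. UNIV). lam m \<in> weights}"
  define f where "f = (\<lambda>l. ee (y \<bullet> l) * ((\<Prod>\<beta>\<in>J. t \<beta> / (t \<beta> - wpair l \<beta>)) * box_exp_mean \<epsilon> (wpair l)))"
  have perp: "i \<bullet> l = 0 \<longleftrightarrow> rs_coroot i \<bullet> l = 0" if "i \<in> B" for i l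
    using coroot_inner_sgn(2)[of i l] BP(5) that by metis
  have ints: "rs_coroot \<beta> \<bullet> l \<in> \<int>" if "\<beta> \<in> B" "l \<in> weights" for \<beta> l
    using coroot_weight_int BP(4) that by blast
  \<comment> \<open>A weight orthogonal to \<open>B \<inter> set ns\<close> is recovered from its
    integer pairings with the coroots of J.\<close>
  have bij: "bij_betw lam K W"
  proof (rule bij_betwI[where g = "\<lambda>l. restrict (\<lambda>\<beta>. \<lfloor>rs_coroot \<beta> \<bullet> l\<rfloor>) J"])
    show "lam \<in> K \<rightarrow> W"
      using perp lamB by (auto simp: K_def W_def J_def)
    have lam_inv: "lam (restrict (\<lambda>\<beta>. \<lfloor>rs_coroot \<beta> \<bullet> l\<rfloor>) J) = l" if l: "l \<in> W" for l
    proof -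
      have "l = (\<Sum>b\<in>B. (rs_coroot b \<bullet> l) *\<^sub>R mu_V B b)" by (rule mu_V_expand(2)[OF BP(1,2)])
      also have "\<dots> = (\<Sum>b\<in>J. (rs_coroot b \<bullet> l) *\<^sub>R mu_V B b)"
        using l BP(3) JB perp by (intro sum.mono_neutral_right) (auto simp: W_def J_def)
      also have "\<dots> = lam (restrict (\<lambda>\<beta>. \<lfloor>rs_coroot \<beta> \<bullet> l\<rfloor>) J)"
        unfolding lam_def
      proof (rule sum.cong)
        fix b assume b: "b \<in> J"
        then have "rs_coroot b \<bullet> l \<in> \<int>" using ints l JB by (auto simp: W_def)
        then show "(rs_coroot b \<bullet> l) *\<^sub>R mu_V B b = of_int (restrict (\<lambda>\<beta>. \<lfloor>rs_coroot \<beta> \<bullet> l\<rfloor>) J b) *\<^sub>R mu_V B b"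
          using b by (auto elim!: Ints_cases)
      qed simp
      finally show ?thesis by simp
    qed
    then show "(\<lambda>l. restrict (\<lambda>\<beta>. \<lfloor>rs_coroot \<beta> \<bullet> l\<rfloor>) J) \<in> W \<rightarrow> K"
      by (auto simp: K_def W_def)
    show "lam (restrict (\<lambda>\<beta>. \<lfloor>rs_coroot \<beta> \<bullet> l\<rfloor>) J) = l" if "l \<in> W" for l by (rule lam_inv[OF that])
    show "restrict (\<lambda>\<beta>. \<lfloor>rs_coroot \<beta> \<bullet> lam m\<rfloor>) J = m" if m: "m \<in> K" for m
    proof
      fix b
      show "restrict (\<lambda>\<beta>. \<lfloor>rs_coroot \<beta> \<bullet> lam m\<rfloor>) J b = m b"
        using lamB[of b m] m JB by (cases "b \<in> J") (auto simp: K_def PiE_iff extensional_def)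
    qed
  qed
  have fm: "f (lam m) = ee (y \<bullet> lam m) * gg m" for m
  proof -
    have "(\<Prod>\<beta>\<in>J. t \<beta> / (t \<beta> - wpair (lam m) \<beta>)) = (\<Prod>\<beta>\<in>J. t \<beta> / (t \<beta> - 2 * pi * \<i> * of_int (m \<beta>)))"
      by (rule prod.cong) (use lamB JB in \<open>auto simp: wpair_def\<close>)
    then show ?thesis by (simp add: f_def gg_def)
  qed
  let ?s = "1 / of_nat N * (\<Sum>C\<in>cosets_V S B. coset_prod B C t) * box_exp_mean \<epsilon> (tau B t)"
  have "((\<lambda>m. f (lam m)) has_sum ?s) K \<longleftrightarrow>
     ((\<lambda>m. if lam m \<in> weights then ee (y \<bullet> lam m) * gg m else 0) has_sum ?s) (PiE J (\<lambda>_. UNIV))"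
    by (rule has_sum_cong_neutral) (auto simp: K_def fm)
  then have "((\<lambda>m. f (lam m)) has_sum ?s) K" using hs by simp
  then have "(f has_sum ?s) W" using has_sum_reindex_bij_betw[OF bij, of f ?s] by simp
  moreover have "(f has_sum ?s) W \<longleftrightarrow> ((\<lambda>l. if \<forall>i\<in>B \<inter> set ns. i \<bullet> l = 0 then f l else 0) has_sum ?s) weights"
    by (rule has_sum_cong_neutral) (auto simp: W_def)
  ultimately have "((\<lambda>l. if \<forall>i\<in>B \<inter> set ns. i \<bullet> l = 0 then f l else 0) has_sum ?s) weights" by blast
  then show ?thesis unfolding f_def J_def N_def .
qed

section \<open>Summation over the bases for a fixed weight\<close>

lemma nbc_independent:
  assumes I: "I \<in> nbc_sets ns"
  shows "independent I"
proof -
  have "independent (I \<inter> set (take k ns))" if "k \<le> length ns" for k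
    using that
  proof (induction k)
    case (Suc k)
    have "set (take (Suc k) ns) = insert (ns ! k) (set (take k ns))"
      using Suc.prems by (simp add: take_Suc_conv_app_nth)
    moreover have "ns ! k \<notin> span (I \<inter> set (take k ns))" using I Suc.prems by (simp add: nbc_sets_def)
    ultimately show ?case
      using Suc by (cases "ns ! k \<in> I") (auto simp: independent_insert)
  qed (simp add: independent_empty)
  from this[of "length ns"] have "independent (I \<inter> set ns)" by simp
  moreover have "I \<inter> set ns = I" using I by (auto simp: nbc_sets_def)
  ultimately show ?thesis by simp
qed

text \<open>The span condition sees a basis through its members in the list alone, so a basis splits
  into an admissible I in the list and an arbitrary complement of I in X.\<close>

lemma bases_VA_bij: "bij_betw (\<lambda>(I, J). I \<union> J) (Sigma (nbc_sets ns) (\<lambda>I. compl_bases I X)) (bases_VA D S ns)"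
proof (rule bij_betwI[where g = "\<lambda>B. (B \<inter> set ns, B - set ns)"])
  have XA: "X \<inter> set ns = {}" "X \<union> set ns = pos_roots D S" using X ns by auto
  show "(\<lambda>(I, J). I \<union> J) \<in> Sigma (nbc_sets ns) (\<lambda>I. compl_bases I X) \<rightarrow> bases_VA D S ns"
  proof clarify
    fix I J assume IJ: "I \<in> nbc_sets ns" "J \<in> compl_bases I X"
    then have sub: "I \<subseteq> set ns" "J \<subseteq> X" by (auto simp: nbc_sets_def compl_bases_def)
    have "(I \<union> J) \<inter> set (take j ns) = I \<inter> set (take j ns)" for j
      using sub XA set_take_subset[of j ns] by auto
    then show "I \<union> J \<in> bases_VA D S ns"
      using IJ sub XA by (auto simp: bases_VA_def bases_V_def nbc_sets_def compl_bases_def)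
  qed
  show "(\<lambda>B. (B \<inter> set ns, B - set ns)) \<in> bases_VA D S ns \<rightarrow> Sigma (nbc_sets ns) (\<lambda>I. compl_bases I X)"
  proof
    fix B assume B: "B \<in> bases_VA D S ns"
    have "B \<inter> set ns \<inter> set (take j ns) = B \<inter> set (take j ns)" for j using set_take_subset[of j ns] by auto
    then have 1: "B \<inter> set ns \<in> nbc_sets ns" using B by (auto simp: bases_VA_def nbc_sets_def)
    have "B \<inter> set ns \<union> (B - set ns) = B" by auto
    then have 2: "B - set ns \<in> compl_bases (B \<inter> set ns) X" using B XA by (auto simp: bases_VA_def bases_V_def compl_bases_def)
    show "(B \<inter> set ns, B - set ns) \<in> Sigma (nbc_sets ns) (\<lambda>I. compl_bases I X)" using 1 2 by simp
  qed
  show "((case x of (I, J) \<Rightarrow> I \<union> J) \<inter> set ns, (case x of (I, J) \<Rightarrow> I \<union> J) - set ns) = x"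
    if "x \<in> Sigma (nbc_sets ns) (\<lambda>I. compl_bases I X)" for x
  proof -
    obtain I J where x: "x = (I, J)" by (cases x)
    then have "I \<subseteq> set ns" "J \<subseteq> X" using that by (auto simp: nbc_sets_def compl_bases_def)
    then show ?thesis using x XA by auto
  qed
  show "(case (B \<inter> set ns, B - set ns) of (I, J) \<Rightarrow> I \<union> J) = B" for B by auto
qed

text \<open>The average of the formula for F over the box: inside a cell, moving y by s_\<alpha>
  times the coroot of \<alpha>, for all \<alpha> in X, multiplies the B-summand by the exponential
  of the sum of all s_\<alpha> \<open>tau B t \<alpha>\<close>.\<close>

definition F_smooth :: "real \<Rightarrow> ('a \<Rightarrow> complex) \<Rightarrow> complex" where
  "F_smooth \<epsilon> t = (\<Sum>B\<in>bases_VA D S ns.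
     (-1) ^ card (set ns - B) *
     (\<Prod>\<gamma>\<in>pos_roots D S - (B \<union> set ns). t \<gamma> / (t \<gamma> - tau B t \<gamma>)) *
     (1 / of_nat (card (cosets_V S B))) *
     (\<Sum>C\<in>cosets_V S B. coset_prod B C t) *
     box_exp_mean \<epsilon> (tau B t))"

lemma F_gen_tau:
  "F_gen D S ns \<phi> t y = (\<Sum>B\<in>bases_VA D S ns.
     (-1) ^ card (set ns - B) *
     (\<Prod>\<gamma>\<in>pos_roots D S - (B \<union> set ns). t \<gamma> / (t \<gamma> - tau B t \<gamma>)) *
     (1 / of_nat (card (cosets_V S B))) *
     (\<Sum>C\<in>cosets_V S B. coset_prod B C t))"
  by (simp add: F_gen_def tau_def)

lemma finite_bases_VA: "finite (bases_VA D S ns)"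
  by (rule finite_subset[OF _ finite_bases_V]) (auto simp: bases_VA_def)

text \<open>For a fixed weight l the bases are grouped by their part I in the list, and those with l
  orthogonal to I contribute. Partial fractions turn the sum over the complements J into the same
  full product for every I, and the remaining signs add up to the indicator of
  \<open>nbc_sum\<close>.\<close>

lemma F_smooth_has_sum:
  assumes \<epsilon>: "\<epsilon> > 0" "cell_ok \<epsilon>"
    and t: "\<And>\<alpha>. \<alpha> \<in> X \<Longrightarrow> norm (t \<alpha>) < 1" and reg: "F_regular D S ns X t"
  shows "((\<lambda>l. (-1) ^ card (set ns) * (if \<forall>\<nu>\<in>set ns. \<nu> \<bullet> l \<noteq> 0 then 1 else 0) *
       ee (y \<bullet> l) * box_exp_mean \<epsilon> (wpair l) * (\<Prod>\<alpha>\<in>X. t \<alpha> / (t \<alpha> - wpair l \<alpha>))) has_sum F_smooth \<epsilon> t) weights"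
proof -
  have XA: "X \<inter> set ns = {}" "X \<union> set ns = pos_roots D S" using X ns by auto
  have t': "norm (t \<alpha>) < 1 \<and> t \<alpha> \<noteq> 0" if "\<alpha> \<in> X" for \<alpha>
    using t[OF that] reg that by (auto simp: F_regular_def)
  define e where "e = (\<lambda>l. ee (y \<bullet> l))"
  define T where "T = (\<lambda>B. (-1) ^ card (set ns - B) * (\<Prod>\<gamma>\<in>pos_roots D S - (B \<union> set ns). t \<gamma> / (t \<gamma> - tau B t \<gamma>)))"
  have "((\<lambda>l. \<Sum>B\<in>bases_VA D S ns. T B * (if \<forall>i\<in>B \<inter> set ns. i \<bullet> l = 0 then e l *
        ((\<Prod>\<beta>\<in>B - set ns. t \<beta> / (t \<beta> - wpair l \<beta>)) * box_exp_mean \<epsilon> (wpair l)) else 0)) has_sum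
      (\<Sum>B\<in>bases_VA D S ns. T B * (1 / of_nat (card (cosets_V S B)) *
       (\<Sum>C\<in>cosets_V S B. coset_prod B C t)
       * box_exp_mean \<epsilon> (tau B t)))) weights"
    unfolding e_def
    by (intro has_sum_finite_sum has_sum_cmult_right smoothed_coset_average finite_bases_VA \<epsilon> t')
       (auto simp: bases_VA_def)
  then have hs: "((\<lambda>l. \<Sum>B\<in>bases_VA D S ns. T B * (if \<forall>i\<in>B \<inter> set ns. i \<bullet> l = 0 then e l *
        ((\<Prod>\<beta>\<in>B - set ns. t \<beta> / (t \<beta> - wpair l \<beta>)) * box_exp_mean \<epsilon> (wpair l)) else 0)) has_sum F_smooth \<epsilon> t) weights"
    unfolding F_smooth_def T_def by (simp only: mult.assoc)
  have eq: "(\<Sum>B\<in>bases_VA D S ns. T B * (if \<forall>i\<in>B \<inter> set ns. i \<bullet> l = 0 then e l *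
        ((\<Prod>\<beta>\<in>B - set ns. t \<beta> / (t \<beta> - wpair l \<beta>)) * box_exp_mean \<epsilon> (wpair l)) else 0)) =
      (-1) ^ card (set ns) * (if \<forall>\<nu>\<in>set ns. \<nu> \<bullet> l \<noteq> 0 then 1 else 0) * e l * box_exp_mean \<epsilon> (wpair l) * (\<Prod>\<alpha>\<in>X. t \<alpha> / (t \<alpha> - wpair l \<alpha>))"
    if l: "l \<in> weights" for l
  proof -
    \<comment> \<open>The affine forms to which partial fractions are applied. They do not vanish,
      since \<open>t \<alpha>\<close> is nonzero of modulus below 1 while
      \<open>wpair l \<alpha>\<close> is 2 pi i times an integer.\<close>
    define w where "w = (\<lambda>\<alpha>. t \<alpha> - wpair l \<alpha>)"
    have w0: "w \<alpha> \<noteq> 0" if \<alpha>: "\<alpha> \<in> X" for \<alpha>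
    proof -
      obtain m :: int where m: "rs_coroot \<alpha> \<bullet> l = of_int m"
        using coroot_weight_int[of \<alpha> l] \<alpha> XD l by (auto elim: Ints_cases)
      have "t \<alpha> \<noteq> 2 * pi * \<i> * of_int m" using pole_nonzero t'[OF \<alpha>] by blast
      then show ?thesis by (simp add: w_def wpair_def m)
    qed
    \<comment> \<open>When l is orthogonal to I, its pairings obey the same expansion in the basis
      as the coroots do. The l-part of \<open>relc\<close> cancels, and what remains is the
      denominator in F, independent of l.\<close>
    have relc_tau: "relc I J w g = t g - tau (I \<union> J) t g"
      if IJ: "I \<in> nbc_sets ns" "J \<in> compl_bases I X" and perp: "\<forall>i\<in>I. i \<bullet> l = 0" for I J g
    proof -
      have J: "(I \<union> J) - set ns = J" using IJ XA by (auto simp: nbc_sets_def compl_bases_def)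
      have ind: "independent (I \<union> J)" "span (I \<union> J) = UNIV" using IJ by (auto simp: compl_bases_def)
      have "l = (\<Sum>b\<in>I \<union> J. (rs_coroot b \<bullet> l) *\<^sub>R mu_V (I \<union> J) b)" by (rule mu_V_expand(2)[OF ind])
      also have "\<dots> = (\<Sum>b\<in>J. (rs_coroot b \<bullet> l) *\<^sub>R mu_V (I \<union> J) b)"
        using finite_independent[OF ind(1)] perp by (intro sum.mono_neutral_right) (auto simp: coroot_inner)
      finally have "rs_coroot g \<bullet> l = rs_coroot g \<bullet> (\<Sum>b\<in>J. (rs_coroot b \<bullet> l) *\<^sub>R mu_V (I \<union> J) b)" by simp
      then have "wpair l g = (\<Sum>b\<in>J. wpair l b * of_real (rs_coroot g \<bullet> mu_V (I \<union> J) b))"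
        by (simp add: wpair_def inner_sum_right sum_distrib_left mult_ac)
      then show ?thesis
        unfolding relc_def tau_def J w_def by (simp add: left_diff_distrib sum_subtractf)
    qed
    define trm where "trm = (\<lambda>B. T B * (if \<forall>i\<in>B \<inter> set ns. i \<bullet> l = 0 then e l *
        ((\<Prod>\<beta>\<in>B - set ns. t \<beta> / (t \<beta> - wpair l \<beta>)) * box_exp_mean \<epsilon> (wpair l)) else 0))"
    have termIJ: "trm (I \<union> J) = (if \<forall>i\<in>I. i \<bullet> l = 0 then (-1) ^ card (set ns) * (-1) ^ card I * e l * box_exp_mean \<epsilon> (wpair l) *
        (\<Prod>\<alpha>\<in>X. t \<alpha>) * ((\<Prod>g\<in>X - J. 1 / relc I J w g) * (\<Prod>b\<in>J. 1 / w b)) else 0)"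
      if IJ: "I \<in> nbc_sets ns" "J \<in> compl_bases I X" for I J
    proof (cases "\<forall>i\<in>I. i \<bullet> l = 0")
      case True
      have sub: "I \<subseteq> set ns" "J \<subseteq> X" using IJ by (auto simp: nbc_sets_def compl_bases_def)
      have i1: "(I \<union> J) \<inter> set ns = I" "(I \<union> J) - set ns = J" "set ns - (I \<union> J) = set ns - I"
        "pos_roots D S - (I \<union> J \<union> set ns) = X - J" using sub XA by auto
      have tau_rel: "t g - tau (I \<union> J) t g = relc I J w g" for g using relc_tau[OF IJ True] by simp
      have card: "(-1::complex) ^ card (set ns - I) = (-1) ^ card (set ns) * (-1) ^ card I"
      proof -
        have "card (set ns) = card (set ns - I) + card I"
          using sub finite_subset[OF sub(1)] by (simp add: card_Diff_subset card_mono)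
        then show ?thesis by (simp add: power_add flip: power_mult_distrib)
      qed
      have prodX: "(\<Prod>\<alpha>\<in>X. t \<alpha>) = (\<Prod>\<alpha>\<in>X - J. t \<alpha>) * (\<Prod>\<alpha>\<in>J. t \<alpha>)"
        using prod.subset_diff[OF sub(2) finX, of t] by simp
      have "trm (I \<union> J) = (-1) ^ card (set ns - I) * (\<Prod>g\<in>X - J. t g / relc I J w g) * (e l * ((\<Prod>\<beta>\<in>J. t \<beta> / w \<beta>) * box_exp_mean \<epsilon> (wpair l)))"
        unfolding trm_def T_def i1 tau_rel using True by (simp add: w_def)
      also have "(\<Prod>g\<in>X - J. t g / relc I J w g) = (\<Prod>g\<in>X - J. t g) * (\<Prod>g\<in>X - J. 1 / relc I J w g)"
        by (simp flip: prod.distrib)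
      also have "(\<Prod>\<beta>\<in>J. t \<beta> / w \<beta>) = (\<Prod>\<beta>\<in>J. t \<beta>) * (\<Prod>\<beta>\<in>J. 1 / w \<beta>)"
        by (simp flip: prod.distrib)
      finally show ?thesis unfolding prodX card if_P[OF True] by (simp only: mult_ac)
    next
      case False
      have "(I \<union> J) \<inter> set ns = I" using IJ XA by (auto simp: nbc_sets_def compl_bases_def)
      then show ?thesis using False unfolding trm_def by auto
    qed
    have pf: "(\<Sum>J\<in>compl_bases I X. (\<Prod>g\<in>X - J. 1 / relc I J w g) * (\<Prod>b\<in>J. 1 / w b)) = (\<Prod>x\<in>X. 1 / w x)"
      if I: "I \<in> nbc_sets ns" "\<forall>i\<in>I. i \<bullet> l = 0" for I
    proof (rule partial_fractions[OF finX nbc_independent[OF I(1)]])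
      show "X \<inter> I = {}" using I XA by (auto simp: nbc_sets_def)
      show "0 \<notin> X" using XD zero_notin by auto
      show "span (I \<union> X) = UNIV" using spX span_mono[of X "I \<union> X"] by auto
      show "w x \<noteq> 0" if "x \<in> X" for x by (rule w0[OF that])
      fix J g assume J: "J \<in> compl_bases I X" "g \<in> X - J"
      have B: "I \<union> J \<in> bases_VA D S ns" using bij_betwE[OF bases_VA_bij] I J by fastforce
      have sub: "I \<subseteq> set ns" "J \<subseteq> X" using I J by (auto simp: nbc_sets_def compl_bases_def)
      have i1: "(I \<union> J) - set ns = J" "pos_roots D S - (I \<union> J \<union> set ns) = X - J" using sub XA by auto
      have "t g - tau (I \<union> J) t g \<noteq> 0"
        using reg B J unfolding F_regular_def tau_def using i1 by force
      then show "relc I J w g \<noteq> 0" using relc_tau[OF I(1) J(1) I(2)] by simp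
    qed
    have finC: "finite (compl_bases I X)" for I
      by (rule finite_subset[of _ "Pow X"]) (use finX in \<open>auto simp: compl_bases_def\<close>)
    have "(\<Sum>B\<in>bases_VA D S ns. trm B) = (\<Sum>(I, J)\<in>Sigma (nbc_sets ns) (\<lambda>I. compl_bases I X). trm (I \<union> J))"
      using sum.reindex_bij_betw[OF bases_VA_bij, of "trm"] by (simp add: case_prod_unfold)
    also have "\<dots> = (\<Sum>I\<in>nbc_sets ns. \<Sum>J\<in>compl_bases I X. trm (I \<union> J))"
      using finite_nbc_sets finC by (intro sum.Sigma[symmetric]) auto
    also have "\<dots> = (\<Sum>I\<in>nbc_sets ns. if \<forall>i\<in>I. i \<bullet> l = 0 then (-1) ^ card I * ((-1) ^ card (set ns) * e l * box_exp_mean \<epsilon> (wpair l) * (\<Prod>\<alpha>\<in>X. t \<alpha> / w \<alpha>)) else 0)"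
    proof (rule sum.cong)
      fix I assume I: "I \<in> nbc_sets ns"
      show "(\<Sum>J\<in>compl_bases I X. trm (I \<union> J)) = (if \<forall>i\<in>I. i \<bullet> l = 0 then (-1) ^ card I * ((-1) ^ card (set ns) * e l * box_exp_mean \<epsilon> (wpair l) * (\<Prod>\<alpha>\<in>X. t \<alpha> / w \<alpha>)) else 0)"
      proof (cases "\<forall>i\<in>I. i \<bullet> l = 0")
        case True
        have "(\<Sum>J\<in>compl_bases I X. trm (I \<union> J)) = (\<Sum>J\<in>compl_bases I X. (-1) ^ card (set ns) * (-1) ^ card I * e l * box_exp_mean \<epsilon> (wpair l) *
          (\<Prod>\<alpha>\<in>X. t \<alpha>) * ((\<Prod>g\<in>X - J. 1 / relc I J w g) * (\<Prod>b\<in>J. 1 / w b)))"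
          by (rule sum.cong) (use termIJ[OF I] True in auto)
        also have "\<dots> = (-1) ^ card (set ns) * (-1) ^ card I * e l * box_exp_mean \<epsilon> (wpair l) * (\<Prod>\<alpha>\<in>X. t \<alpha>) * (\<Prod>x\<in>X. 1 / w x)"
          unfolding sum_distrib_left[symmetric] pf[OF I True] ..
        also have "\<dots> = (-1) ^ card I * ((-1) ^ card (set ns) * e l * box_exp_mean \<epsilon> (wpair l) * ((\<Prod>\<alpha>\<in>X. t \<alpha>) * (\<Prod>x\<in>X. 1 / w x)))"
          by (simp only: mult_ac)
        also have "(\<Prod>\<alpha>\<in>X. t \<alpha>) * (\<Prod>x\<in>X. 1 / w x) = (\<Prod>\<alpha>\<in>X. t \<alpha> / w \<alpha>)" by (simp flip: prod.distrib)
        finally show ?thesis using True by simp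
      next
        case False
        have "trm (I \<union> J) = 0" if "J \<in> compl_bases I X" for J
          using termIJ[OF I that] unfolding if_not_P[OF False] .
        then show ?thesis unfolding if_not_P[OF False] by (simp add: sum.neutral)
      qed
    qed simp
    also have "\<dots> = (\<Sum>I\<in>{I\<in>nbc_sets ns. \<forall>i\<in>I. i \<bullet> l = 0}. (-1) ^ card I) * ((-1) ^ card (set ns) * e l * box_exp_mean \<epsilon> (wpair l) * (\<Prod>\<alpha>\<in>X. t \<alpha> / w \<alpha>))"
      unfolding sum_distrib_right by (rule sum.inter_filter[symmetric, OF finite_nbc_sets])
    also have "\<dots> = (-1) ^ card (set ns) * (if \<forall>\<nu>\<in>set ns. \<nu> \<bullet> l \<noteq> 0 then 1 else 0) * e l * box_exp_mean \<epsilon> (wpair l) * (\<Prod>\<alpha>\<in>X. t \<alpha> / (t \<alpha> - wpair l \<alpha>))"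
      unfolding nbc_sum[OF ns(1)] w_def by (simp only: mult_ac)
    finally show ?thesis unfolding trm_def .
  qed
  show ?thesis
    using has_sum_cong[THEN iffD1, OF eq hs] by (simp only: e_def)
qed

end

section \<open>Taylor coefficients of the generating function\<close>

text \<open>Taylor coefficients of $t / (t - x)$ in $t$, where the quotient is read as $1$ for $x = 0$.\<close>

definition pole_coeff :: "nat \<Rightarrow> complex \<Rightarrow> complex" where
  "pole_coeff k x = (if x = 0 then (if k = 0 then 1 else 0) else if k = 0 then 0 else - (1 / x ^ k))"

text \<open>For x nonzero, t/(t - x) is minus the geometric series of t/x from exponent 1,
  convergent since |t| < 1 \<le> |x|; for x = 0 the quotient is the constant 1.\<close>

lemma pole_coeff_has_sum:
  fixes m :: int
  assumes t: "norm t < 1" "t \<noteq> 0" and x: "x = 2 * pi * \<i> * of_int m"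
  shows "((\<lambda>k. pole_coeff k x * t ^ k) has_sum (t / (t - x))) UNIV"
proof (cases "m = 0")
  case True
  then show ?thesis
    using t x by (intro has_sum_finite_neutralI[of "{0}"]) (auto simp: pole_coeff_def)
next
  case False
  have x0: "x \<noteq> 0" using False x by simp
  have tx: "t - x \<noteq> 0" using pole_nonzero[OF t, of m] x by simp
  have "norm x = 2 * pi * \<bar>of_int m\<bar>" by (simp add: x norm_mult)
  moreover have m1: "1 \<le> \<bar>real_of_int m\<bar>" using False by linarith
  moreover have "1 * 1 \<le> (2 * pi) * \<bar>real_of_int m\<bar>"
    using m1 pi_ge_two by (intro mult_mono) auto
  ultimately have "norm (t / x) < 1" using t x0 by (simp add: norm_divide)
  from has_sum_uminusI[OF has_sum_geometric_from_1[OF this]]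
  have hs: "((\<lambda>n. - ((t / x) ^ n)) has_sum (- (t / x / (1 - t / x)))) {1..}" .
  moreover have "- (t / x / (1 - t / x)) = t / (t - x)"
  proof -
    have "1 - t / x = (x - t) / x" using x0 by (simp add: diff_divide_distrib)
    then have "t / x / (1 - t / x) = t / (x - t)" using x0 by simp
    moreover have "- (t / (x - t)) = t / (t - x)" using minus_divide_right[of t "x - t"] by simp
    ultimately show ?thesis by (simp only:)
  qed
  ultimately have "((\<lambda>n. - ((t / x) ^ n)) has_sum (t / (t - x))) {1..}" by simp
  moreover have "((\<lambda>n. - ((t / x) ^ n)) has_sum (t / (t - x))) {1..} \<longleftrightarrow> ((\<lambda>k. pole_coeff k x * t ^ k) has_sum (t / (t - x))) UNIV"
    by (rule has_sum_cong_neutral) (auto simp: pole_coeff_def x0 power_divide)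
  ultimately show ?thesis by simp
qed

text \<open>The first bound holds for all k and supplies one of the two powers used under smoothing,
  the box mean supplying the other. The second is summable by itself and survives the removal of the
  smoothing.\<close>

lemma norm_pole_coeff_le:
  fixes m :: int
  assumes x: "x = 2 * pi * \<i> * of_int m"
  shows "norm (pole_coeff k x) \<le> 1 / max 1 \<bar>of_int m\<bar>" and "k \<ge> 2 \<Longrightarrow> norm (pole_coeff k x) \<le> 2 * quad_decay (of_int m)"
proof -
  have main: "norm (pole_coeff k x) \<le> (1 / max 1 \<bar>of_int m\<bar>) ^ j" if kj: "j \<le> k" "j \<ge> 1" and m: "m \<noteq> 0" for j
  proof -
    have m1: "\<bar>real_of_int m\<bar> \<ge> 1" using m by linarith
    have nx: "norm x = 2 * pi * \<bar>of_int m\<bar>" by (simp add: x norm_mult)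
    have "norm x \<ge> 1 * \<bar>of_int m\<bar>" unfolding nx using pi_ge_two by (intro mult_right_mono) auto
    then have nx1: "\<bar>real_of_int m\<bar> \<le> norm x" by simp
    have "norm (pole_coeff k x) = 1 / norm x ^ k" using kj m1 nx1 by (auto simp: pole_coeff_def norm_divide norm_power)
    also have "\<dots> \<le> 1 / \<bar>of_int m\<bar> ^ j"
    proof (rule divide_left_mono)
      have "\<bar>real_of_int m\<bar> ^ j \<le> \<bar>of_int m\<bar> ^ k" using m1 kj by (intro power_increasing) auto
      also have "\<dots> \<le> norm x ^ k" using nx1 by (intro power_mono) auto
      finally show "\<bar>real_of_int m\<bar> ^ j \<le> norm x ^ k" .
    qed (use m1 nx1 in \<open>auto intro!: mult_pos_pos zero_less_power\<close>)
    finally show ?thesis using m1 by (simp add: max_def power_divide)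
  qed
  show "norm (pole_coeff k x) \<le> 1 / max 1 \<bar>of_int m\<bar>"
  proof (cases "m = 0 \<or> k = 0")
    case True
    then show ?thesis by (auto simp: pole_coeff_def x)
  next
    case False
    then show ?thesis using main[of 1] by simp
  qed
  show "norm (pole_coeff k x) \<le> 2 * quad_decay (of_int m)" if "k \<ge> 2"
  proof (cases "m = 0")
    case True
    then show ?thesis using that quad_decay_pos[of 0] by (simp add: pole_coeff_def x)
  next
    case False
    have "norm (pole_coeff k x) \<le> (1 / max 1 \<bar>of_int m\<bar>)\<^sup>2" using main[of 2] that False by simp
    also have "\<dots> \<le> 2 * quad_decay (of_int m)" using max_sq_quad_decay[of "of_int m"] by (simp add: power2_eq_square)
    finally show ?thesis .
  qed
qed

text \<open>Dominated convergence for sums: the majorant makes the finite partial sums converge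
  uniformly in n, so the two limits may be exchanged.\<close>

lemma tendsto_infsum_dominated:
  fixes f :: "nat \<Rightarrow> 'i \<Rightarrow> complex"
  assumes bd: "\<And>n i. i \<in> I \<Longrightarrow> norm (f n i) \<le> M i" and M: "M summable_on I"
    and lim: "\<And>i. i \<in> I \<Longrightarrow> (\<lambda>n. f n i) \<longlonglongrightarrow> g i"
  shows "(\<lambda>n. infsum (f n) I) \<longlonglongrightarrow> infsum g I"
proof (rule swap_uniform_limit')
  have gM: "norm (g i) \<le> M i" if "i \<in> I" for i
    by (rule tendsto_upperbound[OF tendsto_norm[OF lim[OF that]]]) (use bd that in auto)
  have "g summable_on I"
    by (rule abs_summable_summable, rule Infinite_Sum.abs_summable_on_comparison_test'[OF M gM])
  then show "((\<lambda>F. \<Sum>i\<in>F. g i) \<longlongrightarrow> infsum g I) (finite_subsets_at_top I)"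
    by (rule infsum_tendsto)
  show "uniform_limit UNIV (\<lambda>F n. \<Sum>i\<in>F. f n i) (\<lambda>n. infsum (f n) I) (finite_subsets_at_top I)"
    by (rule Weierstrass_m_test_general[OF _ M]) (use bd in auto)
  show "eventually (\<lambda>F. (\<lambda>n. \<Sum>i\<in>F. f n i) \<longlonglongrightarrow> (\<Sum>i\<in>F. g i)) (finite_subsets_at_top I)"
    by (rule eventually_finite_subsets_at_top_weakI) (auto intro!: tendsto_sum lim)
qed auto

section \<open>Bounded families and uniform limits\<close>

lemma bounded_image_mult:
  fixes f g :: "'t \<Rightarrow> complex"
  assumes "bounded (f ` T)" "bounded (g ` T)"
  shows "bounded ((\<lambda>t. f t * g t) ` T)"
proof -
  obtain A B where A: "\<And>t. t \<in> T \<Longrightarrow> norm (f t) \<le> A" and B: "\<And>t. t \<in> T \<Longrightarrow> norm (g t) \<le> B"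
    using assms unfolding bounded_iff by auto
  have "norm (f t * g t) \<le> \<bar>A\<bar> * \<bar>B\<bar>" if "t \<in> T" for t
    unfolding norm_mult using A[OF that] B[OF that] by (intro mult_mono) auto
  then show ?thesis unfolding bounded_iff by blast
qed

lemma bounded_image_const: "bounded ((\<lambda>t. c :: complex) ` T)"
  unfolding bounded_iff by blast

lemma bounded_image_sum:
  fixes f :: "'j \<Rightarrow> 't \<Rightarrow> complex"
  assumes "\<And>j. j \<in> J \<Longrightarrow> bounded (f j ` T)"
  shows "bounded ((\<lambda>t. \<Sum>j\<in>J. f j t) ` T)"
  using assms
proof (induction J rule: infinite_finite_induct)
  case (insert j J)
  then have "bounded ((\<lambda>t. f j t + (\<Sum>j\<in>J. f j t)) ` T)" by (intro bounded_plus_comp) auto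
  then show ?case using insert.hyps by simp
qed (use bounded_image_const[of 0] in simp_all)

lemma bounded_image_prod:
  fixes f :: "'j \<Rightarrow> 't \<Rightarrow> complex"
  assumes "\<And>j. j \<in> J \<Longrightarrow> bounded (f j ` T)"
  shows "bounded ((\<lambda>t. \<Prod>j\<in>J. f j t) ` T)"
  using assms
proof (induction J rule: infinite_finite_induct)
  case (insert j J)
  then have "bounded ((\<lambda>t. f j t * (\<Prod>j\<in>J. f j t)) ` T)" by (intro bounded_image_mult) auto
  then show ?case using insert.hyps by simp
qed (use bounded_image_const[of 1] in simp_all)

lemma uniform_limit_finite_sum:
  fixes f :: "'j \<Rightarrow> 'n \<Rightarrow> 't \<Rightarrow> complex"
  assumes "\<And>j. j \<in> J \<Longrightarrow> uniform_limit T (f j) (g j) F"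
  shows "uniform_limit T (\<lambda>n t. \<Sum>j\<in>J. f j n t) (\<lambda>t. \<Sum>j\<in>J. g j t) F"
  using assms
proof (induction J rule: infinite_finite_induct)
  case (insert j J)
  then have "uniform_limit T (\<lambda>n t. f j n t + (\<Sum>j\<in>J. f j n t)) (\<lambda>t. g j t + (\<Sum>j\<in>J. g j t)) F"
    by (intro uniform_limit_add) auto
  then show ?case using insert.hyps by simp
qed (simp_all add: uniform_limit_const)

section \<open>Absolutely convergent expansion of the smoothed function\<close>

context root_sum begin

lemma wpair_int:
  assumes "\<alpha> \<in> X" "l \<in> weights"
  obtains m :: int where "rs_coroot \<alpha> \<bullet> l = of_int m" "wpair l \<alpha> = 2 * pi * \<i> * of_int m"
proof -
  have "rs_coroot \<alpha> \<bullet> l \<in> \<int>" using coroot_weight_int XD assms by blast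
  then obtain m :: int where "rs_coroot \<alpha> \<bullet> l = of_int m" by (rule Ints_cases)
  then show ?thesis using that by (simp add: wpair_def)
qed

definition decay_majorant :: "'a \<Rightarrow> real" where
  "decay_majorant l = (\<Prod>\<alpha>\<in>X. quad_decay (rs_coroot \<alpha> \<bullet> l))"

lemma decay_majorant_pos: "decay_majorant l > 0"
  unfolding decay_majorant_def using quad_decay_pos by (intro prod_pos) auto

text \<open>X contains a basis B. The integer pairings with its coroots embed the weights into the
  integer functions on B, where the product of the one-variable bounds is summable; the remaining
  factors are at most 1.\<close>

lemma decay_majorant_summable: "decay_majorant summable_on weights"
proof -
  obtain B where B: "B \<subseteq> X" "independent B" "X \<subseteq> span B"
    using maximal_independent_subset[of X] by blast
  have spB: "span B = UNIV" using B(3) spX by (metis span_minimal subspace_span top.extremum_uniqueI)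
  have finB: "finite B" using B(2) by (rule finite_independent)
  define h where "h = (\<lambda>l. restrict (\<lambda>\<beta>. \<lfloor>rs_coroot \<beta> \<bullet> l\<rfloor>) B)"
  have hfl: "of_int (h l \<beta>) = rs_coroot \<beta> \<bullet> l" if "l \<in> weights" "\<beta> \<in> B" for l \<beta>
  proof -
    have "rs_coroot \<beta> \<bullet> l \<in> \<int>" using coroot_weight_int XD B that by blast
    then show ?thesis using that by (auto simp: h_def elim: Ints_cases)
  qed
  have inj: "inj_on h weights"
  proof (rule inj_onI)
    fix l l' assume l: "l \<in> weights" "l' \<in> weights" "h l = h l'"
    then have "rs_coroot \<beta> \<bullet> l = rs_coroot \<beta> \<bullet> l'" if "\<beta> \<in> B" for \<beta>
      using hfl[OF l(1) that] hfl[OF l(2) that] by simp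
    then show "l = l'" using mu_V_expand(2)[OF B(2) spB, of l] mu_V_expand(2)[OF B(2) spB, of l'] by simp
  qed
  have "(\<lambda>m. \<Prod>\<beta>\<in>B. quad_decay (of_int (m \<beta>))) summable_on PiE B (\<lambda>_. UNIV :: int set)"
    by (rule summable_prod_PiE[OF finB quad_decay_summable]) (simp add: less_imp_le[OF quad_decay_pos])
  then have "(\<lambda>m. \<Prod>\<beta>\<in>B. quad_decay (of_int (m \<beta>))) summable_on h ` weights"
    by (rule summable_on_subset) (auto simp: h_def)
  then have "(\<lambda>l. \<Prod>\<beta>\<in>B. quad_decay (of_int (h l \<beta>))) summable_on weights"
    by (subst (asm) summable_on_reindex[OF inj]) (simp add: o_def)
  then show ?thesis
  proof (rule summable_on_comparison_test)
    fix l assume l: "l \<in> weights"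
    have "decay_majorant l = (\<Prod>\<alpha>\<in>X - B. quad_decay (rs_coroot \<alpha> \<bullet> l)) * (\<Prod>\<alpha>\<in>B. quad_decay (rs_coroot \<alpha> \<bullet> l))"
      unfolding decay_majorant_def by (rule prod.subset_diff[OF B(1) finX])
    also have "\<dots> \<le> 1 * (\<Prod>\<alpha>\<in>B. quad_decay (rs_coroot \<alpha> \<bullet> l))"
      using quad_decay_le_1 less_imp_le[OF quad_decay_pos] by (intro mult_right_mono prod_le_1 prod_nonneg) auto
    also have "\<dots> = (\<Prod>\<beta>\<in>B. quad_decay (of_int (h l \<beta>)))" using hfl[OF l] by simp
    finally show "decay_majorant l \<le> (\<Prod>\<beta>\<in>B. quad_decay (of_int (h l \<beta>)))" .
  qed (simp add: less_imp_le[OF decay_majorant_pos])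
qed

definition weighted_char :: "'a \<Rightarrow> complex" where
  "weighted_char l = (-1) ^ card (set ns) * (if \<forall>\<nu>\<in>set ns. \<nu> \<bullet> l \<noteq> 0 then 1 else 0) * ee (y \<bullet> l)"

lemma norm_weighted_char: "norm (weighted_char l) \<le> 1"
  by (simp add: weighted_char_def norm_mult norm_power)

text \<open>Per direction, 1 + 1/(\<epsilon> \<delta>) comes from
  \<open>norm_exp_mean_int_le\<close> on an interval of length \<epsilon> \<delta>, and 2 from
  \<open>max_sq_quad_decay\<close>. The bound is uniform in k but blows up as \<epsilon> tends to
  0.\<close>

definition coef_bound :: "real \<Rightarrow> real" where
  "coef_bound \<epsilon> = (\<Prod>\<alpha>\<in>X. 2 * (1 + 1 / (\<epsilon> * \<delta>)))"

lemma hi_lo: "hi \<epsilon> \<alpha> - lo \<epsilon> \<alpha> = \<epsilon> * \<delta>"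
  by (simp add: hi_def lo_def algebra_simps)

lemma term_bound:
  assumes \<epsilon>: "\<epsilon> > 0" and l: "l \<in> weights"
  shows "norm (weighted_char l * box_exp_mean \<epsilon> (wpair l) * (\<Prod>\<alpha>\<in>X. pole_coeff (k \<alpha>) (wpair l \<alpha>))) \<le> coef_bound \<epsilon> * decay_majorant l"
proof -
  have "norm (box_exp_mean \<epsilon> (wpair l) * (\<Prod>\<alpha>\<in>X. pole_coeff (k \<alpha>) (wpair l \<alpha>))) =
      (\<Prod>\<alpha>\<in>X. norm (exp_mean (lo \<epsilon> \<alpha>) (hi \<epsilon> \<alpha>) (wpair l \<alpha>)) * norm (pole_coeff (k \<alpha>) (wpair l \<alpha>)))"
    by (simp add: box_exp_mean_def norm_mult prod_norm prod.distrib)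
  also have "\<dots> \<le> (\<Prod>\<alpha>\<in>X. 2 * (1 + 1 / (\<epsilon> * \<delta>)) * quad_decay (rs_coroot \<alpha> \<bullet> l))"
  proof (rule prod_mono, intro conjI)
    fix \<alpha> assume \<alpha>: "\<alpha> \<in> X"
    obtain m :: int where m: "rs_coroot \<alpha> \<bullet> l = of_int m" "wpair l \<alpha> = 2 * pi * \<i> * of_int m" using wpair_int[OF \<alpha> l] .
    have pos: "0 \<le> 1 + 1 / (\<epsilon> * \<delta>)" using \<epsilon> delta(1) by simp
    have "norm (exp_mean (lo \<epsilon> \<alpha>) (hi \<epsilon> \<alpha>) (wpair l \<alpha>)) * norm (pole_coeff (k \<alpha>) (wpair l \<alpha>)) \<le>
       ((1 + 1 / (\<epsilon> * \<delta>)) / max 1 \<bar>of_int m\<bar>) * (1 / max 1 \<bar>of_int m\<bar>)"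
      using norm_exp_mean_int_le[OF lo_less_hi[OF \<epsilon>], of \<alpha> m] norm_pole_coeff_le(1)[OF m(2), of "k \<alpha>"] pos
      unfolding m(2) hi_lo by (intro mult_mono) auto
    also have "\<dots> = (1 + 1 / (\<epsilon> * \<delta>)) * (1 / max 1 \<bar>of_int m\<bar> * (1 / max 1 \<bar>of_int m\<bar>))" by simp
    also have "\<dots> \<le> (1 + 1 / (\<epsilon> * \<delta>)) * (2 * quad_decay (of_int m))"
      using max_sq_quad_decay pos by (intro mult_left_mono) auto
    finally show "norm (exp_mean (lo \<epsilon> \<alpha>) (hi \<epsilon> \<alpha>) (wpair l \<alpha>)) * norm (pole_coeff (k \<alpha>) (wpair l \<alpha>)) \<le> 2 * (1 + 1 / (\<epsilon> * \<delta>)) * quad_decay (rs_coroot \<alpha> \<bullet> l)"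
      by (simp only: m(1) mult_ac)
  qed simp
  also have "\<dots> = coef_bound \<epsilon> * decay_majorant l" by (simp only: coef_bound_def decay_majorant_def prod.distrib)
  finally have "norm (box_exp_mean \<epsilon> (wpair l) * (\<Prod>\<alpha>\<in>X. pole_coeff (k \<alpha>) (wpair l \<alpha>))) \<le> coef_bound \<epsilon> * decay_majorant l" .
  moreover have "norm (weighted_char l * box_exp_mean \<epsilon> (wpair l) * (\<Prod>\<alpha>\<in>X. pole_coeff (k \<alpha>) (wpair l \<alpha>))) \<le>
     1 * norm (box_exp_mean \<epsilon> (wpair l) * (\<Prod>\<alpha>\<in>X. pole_coeff (k \<alpha>) (wpair l \<alpha>)))"
    unfolding mult.assoc norm_mult[of "weighted_char l"] using norm_weighted_char by (intro mult_right_mono) auto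
  ultimately show ?thesis by simp
qed

definition coef :: "real \<Rightarrow> ('a \<Rightarrow> nat) \<Rightarrow> complex" where
  "coef \<epsilon> k = (\<Sum>\<^sub>\<infinity>l\<in>weights. weighted_char l * box_exp_mean \<epsilon> (wpair l) * (\<Prod>\<alpha>\<in>X. pole_coeff (k \<alpha>) (wpair l \<alpha>)))"

lemma coef_bound_nonneg: "\<epsilon> > 0 \<Longrightarrow> coef_bound \<epsilon> \<ge> 0"
  unfolding coef_bound_def using delta(1) by (intro prod_nonneg) auto

lemma coef_has_sum:
  assumes "\<epsilon> > 0"
  shows "((\<lambda>l. weighted_char l * box_exp_mean \<epsilon> (wpair l) * (\<Prod>\<alpha>\<in>X. pole_coeff (k \<alpha>) (wpair l \<alpha>))) has_sum coef \<epsilon> k) weights"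
  unfolding coef_def
  by (rule has_sum_infsum, rule abs_summable_summable,
      rule Infinite_Sum.abs_summable_on_comparison_test'[OF summable_on_cmult_right[OF decay_majorant_summable]])
     (rule term_bound[OF assms])

lemma norm_coef: "\<epsilon> > 0 \<Longrightarrow> norm (coef \<epsilon> k) \<le> coef_bound \<epsilon> * infsum decay_majorant weights"
  using norm_infsum_le[OF coef_has_sum has_sum_cmult_right[OF has_sum_infsum[OF decay_majorant_summable]] term_bound] by blast

lemma coef_summable:
  assumes \<epsilon>: "\<epsilon> > 0" and \<rho>: "\<And>x. x \<in> X \<Longrightarrow> 0 < \<rho> x \<and> \<rho> x < 1"
  shows "(\<lambda>k. norm (coef \<epsilon> k) * (\<Prod>x\<in>X. \<rho> x ^ k x)) summable_on multi_indices X"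
proof (rule summable_on_comparison_test)
  show "(\<lambda>k. (coef_bound \<epsilon> * infsum decay_majorant weights) * (\<Prod>x\<in>X. \<rho> x ^ k x)) summable_on multi_indices X"
    by (intro summable_on_cmult_right geometric_multi_summable finX) (use \<rho> in \<open>auto simp: less_imp_le\<close>)
  fix k
  have "0 \<le> (\<Prod>x\<in>X. \<rho> x ^ k x)" using \<rho> by (intro prod_nonneg) (auto simp: less_imp_le)
  then show "norm (coef \<epsilon> k) * (\<Prod>x\<in>X. \<rho> x ^ k x) \<le> (coef_bound \<epsilon> * infsum decay_majorant weights) * (\<Prod>x\<in>X. \<rho> x ^ k x)"
    "0 \<le> norm (coef \<epsilon> k) * (\<Prod>x\<in>X. \<rho> x ^ k x)"
    using norm_coef[OF \<epsilon>, of k] by (auto intro: mult_right_mono)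
qed

text \<open>Every factor t/(t - x) is expanded in powers of t. The family over weights and
  multi-indices is dominated by a multiple of \<open>decay_majorant\<close> times a geometric term,
  which justifies exchanging the two summations.\<close>

lemma F_smooth_power_series:
  assumes \<epsilon>: "\<epsilon> > 0" "cell_ok \<epsilon>"
    and t: "\<And>\<alpha>. \<alpha> \<in> X \<Longrightarrow> norm (t \<alpha>) < 1" and reg: "F_regular D S ns X t"
  shows "((\<lambda>k. coef \<epsilon> k * (\<Prod>\<alpha>\<in>X. t \<alpha> ^ k \<alpha>)) has_sum F_smooth \<epsilon> t) (multi_indices X)"
proof -
  let ?M = "multi_indices X"
  have t0: "t \<alpha> \<noteq> 0" if "\<alpha> \<in> X" for \<alpha> using reg that by (auto simp: F_regular_def)
  define f where "f = (\<lambda>(l, k). (weighted_char l * box_exp_mean \<epsilon> (wpair l)) * (\<Prod>\<alpha>\<in>X. pole_coeff (k \<alpha>) (wpair l \<alpha>) * t \<alpha> ^ k \<alpha>))"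
  have rows: "((\<lambda>k. f (l, k)) has_sum (weighted_char l * box_exp_mean \<epsilon> (wpair l) * (\<Prod>\<alpha>\<in>X. t \<alpha> / (t \<alpha> - wpair l \<alpha>)))) ?M"
    if l: "l \<in> weights" for l
    unfolding f_def prod.case
  proof (intro has_sum_cmult_right has_sum_prod_multi_indices[OF finX, where f = "\<lambda>\<alpha> n. pole_coeff n (wpair l \<alpha>) * t \<alpha> ^ n"])
    fix \<alpha> assume \<alpha>: "\<alpha> \<in> X"
    obtain m :: int where m: "wpair l \<alpha> = 2 * pi * \<i> * of_int m" using wpair_int[OF \<alpha> l] .
    show "((\<lambda>n. pole_coeff n (wpair l \<alpha>) * t \<alpha> ^ n) has_sum (t \<alpha> / (t \<alpha> - wpair l \<alpha>))) UNIV"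
      by (rule pole_coeff_has_sum[OF t[OF \<alpha>] t0[OF \<alpha>] m])
  qed
  have tot: "((\<lambda>l. weighted_char l * box_exp_mean \<epsilon> (wpair l) * (\<Prod>\<alpha>\<in>X. t \<alpha> / (t \<alpha> - wpair l \<alpha>))) has_sum F_smooth \<epsilon> t) weights"
    using F_smooth_has_sum[OF \<epsilon> t reg] by (simp only: weighted_char_def)
  define Q where "Q = (\<lambda>k. \<Prod>\<alpha>\<in>X. norm (t \<alpha>) ^ k \<alpha>)"
  have Q: "Q summable_on ?M" unfolding Q_def by (rule geometric_multi_summable[OF finX]) (use t in auto)
  have Q0: "Q k \<ge> 0" for k unfolding Q_def by (intro prod_nonneg) auto
  have fb: "norm (f (l, k)) \<le> (coef_bound \<epsilon> * decay_majorant l) * Q k" if l: "l \<in> weights" for l k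
  proof -
    have "f (l, k) = (weighted_char l * box_exp_mean \<epsilon> (wpair l) * (\<Prod>\<alpha>\<in>X. pole_coeff (k \<alpha>) (wpair l \<alpha>))) * (\<Prod>\<alpha>\<in>X. t \<alpha> ^ k \<alpha>)"
      by (simp add: f_def prod.distrib)
    then have "norm (f (l, k)) = norm (weighted_char l * box_exp_mean \<epsilon> (wpair l) * (\<Prod>\<alpha>\<in>X. pole_coeff (k \<alpha>) (wpair l \<alpha>))) * Q k"
      by (simp only: norm_mult Q_def prod_norm[symmetric] norm_power)
    also have "\<dots> \<le> (coef_bound \<epsilon> * decay_majorant l) * Q k" by (rule mult_right_mono[OF term_bound[OF \<epsilon>(1) l] Q0])
    finally show ?thesis .
  qed
  have "(\<lambda>p. (coef_bound \<epsilon> * decay_majorant (fst p)) * Q (snd p)) summable_on weights \<times> ?M"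
  proof (rule summable_on_SigmaI)
    show "((\<lambda>k. (coef_bound \<epsilon> * decay_majorant (fst (l, k))) * Q (snd (l, k))) has_sum ((coef_bound \<epsilon> * decay_majorant l) * infsum Q ?M)) ?M" for l
      using has_sum_cmult_right[OF has_sum_infsum[OF Q], of "coef_bound \<epsilon> * decay_majorant l"] by simp
    show "(\<lambda>l. (coef_bound \<epsilon> * decay_majorant l) * infsum Q ?M) summable_on weights"
      by (intro summable_on_cmult_left summable_on_cmult_right decay_majorant_summable)
    show "0 \<le> (coef_bound \<epsilon> * decay_majorant (fst (l, k))) * Q (snd (l, k))" for l k
      using coef_bound_nonneg[OF \<epsilon>(1)] Q0 less_imp_le[OF decay_majorant_pos] by simp
  qed
  then have "(\<lambda>p. norm (f p)) summable_on weights \<times> ?M"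
    by (rule Infinite_Sum.abs_summable_on_comparison_test') (use fb in auto)
  then have "f summable_on weights \<times> ?M" by (rule abs_summable_summable)
  from has_sum_SigmaI[OF rows tot this] have "(f has_sum F_smooth \<epsilon> t) (weights \<times> ?M)" by simp
  then have "((\<lambda>(k, l). f (l, k)) has_sum F_smooth \<epsilon> t) (?M \<times> weights)" by (rule has_sum_swap[THEN iffD1])
  then show ?thesis
  proof (rule has_sum_SigmaD)
    fix k
    have "((\<lambda>l. (weighted_char l * box_exp_mean \<epsilon> (wpair l) * (\<Prod>\<alpha>\<in>X. pole_coeff (k \<alpha>) (wpair l \<alpha>))) * (\<Prod>\<alpha>\<in>X. t \<alpha> ^ k \<alpha>)) has_sum
       (coef \<epsilon> k * (\<Prod>\<alpha>\<in>X. t \<alpha> ^ k \<alpha>))) weights"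
      by (rule has_sum_cmult_left[OF coef_has_sum[OF \<epsilon>(1)]])
    then show "((\<lambda>l. (\<lambda>(k, l). f (l, k)) (k, l)) has_sum (coef \<epsilon> k * (\<Prod>\<alpha>\<in>X. t \<alpha> ^ k \<alpha>))) weights"
      by (simp add: f_def prod.distrib mult.assoc)
  qed
qed

section \<open>Removal of the smoothing\<close>

lemma box_exp_mean_uniform:
  assumes en: "\<And>n. en n > 0" "en \<longlonglongrightarrow> (0::real)"
  shows "uniform_limit {z. \<forall>\<alpha>\<in>X. norm (z \<alpha>) \<le> Z} (\<lambda>n z. box_exp_mean (en n) z) (\<lambda>_. 1) sequentially"
proof -
  let ?T = "{z :: 'a \<Rightarrow> complex. \<forall>\<alpha>\<in>X. norm (z \<alpha>) \<le> Z}"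
  have single: "uniform_limit ?T (\<lambda>n z. exp_mean (lo (en n) \<alpha>) (hi (en n) \<alpha>) (z \<alpha>)) (\<lambda>_. 1) sequentially" if \<alpha>: "\<alpha> \<in> X" for \<alpha>
  proof (rule uniform_limitI)
    fix e :: real assume "e > 0"
    then obtain d where d: "d > 0"
      "\<And>p q z. p < q \<Longrightarrow> norm (of_real p * z) < d \<Longrightarrow> norm (of_real (q - p) * z) < d \<Longrightarrow> norm (exp_mean p q z - 1) < e"
      using exp_mean_tendsto_1 by blast
    \<comment> \<open>The corner and the edge of the box are both of order \<open>en n\<close>, so
      the bound Z brings the exponents for all z in the set below the threshold d at once.\<close>
    have "(\<lambda>n. en n * ((\<bar>a \<alpha>\<bar> + \<delta>) * \<bar>Z\<bar>)) \<longlonglongrightarrow> 0 * ((\<bar>a \<alpha>\<bar> + \<delta>) * \<bar>Z\<bar>)" by (intro tendsto_intros en)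
    then have "eventually (\<lambda>n. en n * ((\<bar>a \<alpha>\<bar> + \<delta>) * \<bar>Z\<bar>) < d) sequentially"
      by (rule order_tendstoD) (use d in simp)
    then show "eventually (\<lambda>n. \<forall>z\<in>?T. dist (exp_mean (lo (en n) \<alpha>) (hi (en n) \<alpha>) (z \<alpha>)) 1 < e) sequentially"
    proof eventually_elim
      case (elim n)
      show ?case
      proof
        fix z assume "z \<in> ?T"
        then have z: "norm (z \<alpha>) \<le> \<bar>Z\<bar>" using \<alpha> by force
        have "norm (of_real (lo (en n) \<alpha>) * z \<alpha>) = en n * (\<bar>a \<alpha>\<bar> * norm (z \<alpha>))"
          using en(1)[of n] by (simp add: lo_def norm_mult abs_mult)
        also have "\<dots> \<le> en n * ((\<bar>a \<alpha>\<bar> + \<delta>) * \<bar>Z\<bar>)"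
          using en(1)[of n] z delta(1) by (intro mult_left_mono mult_mono) auto
        finally have 1: "norm (of_real (lo (en n) \<alpha>) * z \<alpha>) < d" using elim by simp
        have "norm (of_real (hi (en n) \<alpha> - lo (en n) \<alpha>) * z \<alpha>) = en n * (\<delta> * norm (z \<alpha>))"
          unfolding hi_lo using en(1)[of n] delta(1) by (simp add: norm_mult abs_mult)
        also have "\<dots> \<le> en n * ((\<bar>a \<alpha>\<bar> + \<delta>) * \<bar>Z\<bar>)"
          using en(1)[of n] z delta(1) by (intro mult_left_mono mult_mono) auto
        finally have 2: "norm (of_real (hi (en n) \<alpha> - lo (en n) \<alpha>) * z \<alpha>) < d" using elim by simp
        show "dist (exp_mean (lo (en n) \<alpha>) (hi (en n) \<alpha>) (z \<alpha>)) 1 < e"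
          unfolding dist_norm by (rule d(2)[OF lo_less_hi[OF en(1)] 1 2])
      qed
    qed
  qed
  have "uniform_limit ?T (\<lambda>n z. \<Prod>\<alpha>\<in>Y. exp_mean (lo (en n) \<alpha>) (hi (en n) \<alpha>) (z \<alpha>)) (\<lambda>_. 1) sequentially"
    if "finite Y" "Y \<subseteq> X" for Y
    using that
  proof (induction Y rule: finite_induct)
    case (insert \<alpha> Y)
    then have "uniform_limit ?T (\<lambda>n z. exp_mean (lo (en n) \<alpha>) (hi (en n) \<alpha>) (z \<alpha>) * (\<Prod>\<alpha>\<in>Y. exp_mean (lo (en n) \<alpha>) (hi (en n) \<alpha>) (z \<alpha>)))
       (\<lambda>_. 1 * 1) sequentially"
      by (intro uniform_lim_mult single bounded_image_const) auto
    then show ?case using insert.hyps by simp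
  qed (simp add: uniform_limit_const)
  from this[OF finX order_refl] show ?thesis unfolding box_exp_mean_def .
qed

definition F_summand :: "'a set \<Rightarrow> ('a \<Rightarrow> complex) \<Rightarrow> complex" where
  "F_summand B t = (-1) ^ card (set ns - B) *
     (\<Prod>\<gamma>\<in>pos_roots D S - (B \<union> set ns). t \<gamma> / (t \<gamma> - tau B t \<gamma>)) *
     (1 / of_nat (card (cosets_V S B))) *
     (\<Sum>C\<in>cosets_V S B. coset_prod B C t)"

lemma F_smooth_F_summand: "F_smooth \<epsilon> t = (\<Sum>B\<in>bases_VA D S ns. F_summand B t * box_exp_mean \<epsilon> (tau B t))"
  by (simp only: F_smooth_def F_summand_def)

lemma F_gen_F_summand: "F_gen D S ns \<phi> t y = (\<Sum>B\<in>bases_VA D S ns. F_summand B t)"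
  by (simp only: F_gen_tau F_summand_def)

definition tau_bound :: "'a set \<Rightarrow> real" where
  "tau_bound B = (\<Sum>\<alpha>\<in>X. \<Sum>\<beta>\<in>B - set ns. \<bar>rs_coroot \<alpha> \<bullet> mu_V B \<beta>\<bar>)"

lemma bases_VA_sub: "B \<in> bases_VA D S ns \<Longrightarrow> B - set ns \<subseteq> X"
  using ns by (auto simp: bases_VA_def bases_V_def)

lemma norm_tau:
  assumes B: "B \<in> bases_VA D S ns" and t: "\<And>\<alpha>. \<alpha> \<in> X \<Longrightarrow> norm (t \<alpha>) \<le> 1" and \<alpha>: "\<alpha> \<in> X"
  shows "norm (tau B t \<alpha>) \<le> tau_bound B"
proof -
  have "norm (tau B t \<alpha>) \<le> (\<Sum>\<beta>\<in>B - set ns. norm (t \<beta> * complex_of_real (rs_coroot \<alpha> \<bullet> mu_V B \<beta>)))"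
    unfolding tau_def by (rule norm_sum)
  also have "\<dots> \<le> (\<Sum>\<beta>\<in>B - set ns. \<bar>rs_coroot \<alpha> \<bullet> mu_V B \<beta>\<bar>)"
  proof (rule sum_mono)
    fix \<beta> assume "\<beta> \<in> B - set ns"
    then have "norm (t \<beta>) \<le> 1" using t bases_VA_sub[OF B] by blast
    then show "norm (t \<beta> * complex_of_real (rs_coroot \<alpha> \<bullet> mu_V B \<beta>)) \<le> \<bar>rs_coroot \<alpha> \<bullet> mu_V B \<beta>\<bar>"
      by (simp add: norm_mult mult_left_le_one_le)
  qed
  also have "\<dots> \<le> tau_bound B"
    unfolding tau_bound_def using finX \<alpha>
    by (intro member_le_sum[of \<alpha> X "\<lambda>\<alpha>. \<Sum>\<beta>\<in>B - set ns. \<bar>rs_coroot \<alpha> \<bullet> mu_V B \<beta>\<bar>"]) (auto intro: sum_nonneg)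
  finally show ?thesis .
qed

text \<open>\<open>generic_torus\<close> is applied to the finitely many denominators, each a
  nonzero form because \<open>t \<gamma>\<close> occurs with coefficient 1. The lower bounds make
  every summand of F bounded on the torus, as the uniform limit of the products with box means
  requires.\<close>

lemma regular_torus:
  assumes r: "r > 0"
  obtains \<rho> where "\<And>x. x \<in> X \<Longrightarrow> 0 < \<rho> x \<and> \<rho> x < r \<and> \<rho> x < 1"
    and "{t. \<forall>x\<in>X. norm (t x) = \<rho> x} \<subseteq> Collect (F_regular D S ns X)"
    and "\<And>B. B \<in> bases_VA D S ns \<Longrightarrow> bounded (F_summand B ` {t. \<forall>x\<in>X. norm (t x) = \<rho> x})"
proof -
  define form where "form = (\<lambda>(B, \<gamma>) x. if x = \<gamma> then 1 else if x \<in> B - set ns then - complex_of_real (rs_coroot \<gamma> \<bullet> mu_V B x) else 0)"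
  define P where "P = Sigma (bases_VA D S ns) (\<lambda>B. pos_roots D S - (B \<union> set ns))"
  have Psub: "\<gamma> \<in> X" "\<gamma> \<notin> B - set ns" if "(B, \<gamma>) \<in> P" for B \<gamma> using that ns by (auto simp: P_def)
  have finL: "finite (form ` P)" unfolding P_def using finite_bases_VA finP by auto
  have nzL: "\<exists>x\<in>X. c x \<noteq> 0" if cL: "c \<in> form ` P" for c
  proof -
    obtain B \<gamma> where "(B, \<gamma>) \<in> P" "c = form (B, \<gamma>)" using cL by auto
    then show ?thesis using Psub by (intro bexI[of _ \<gamma>]) (auto simp: form_def)
  qed
  have "min r 1 > 0" using r by simp
  from generic_torus[OF finX finL nzL this] obtain \<rho> where
    \<rho>: "\<forall>x\<in>X. 0 < \<rho> x \<and> \<rho> x < min r 1"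
    and \<eta>: "\<forall>c\<in>form ` P. \<exists>\<eta>>0. \<forall>t. (\<forall>x\<in>X. norm (t x) = \<rho> x) \<longrightarrow> norm (\<Sum>x\<in>X. c x * t x) \<ge> \<eta>" by blast
  let ?T = "{t :: 'a \<Rightarrow> complex. \<forall>x\<in>X. norm (t x) = \<rho> x}"
  have form_sum: "(\<Sum>x\<in>X. form (B, \<gamma>) x * t x) = t \<gamma> - tau B t \<gamma>" if P: "(B, \<gamma>) \<in> P" for B \<gamma> t
  proof -
    have sub: "B - set ns \<subseteq> X" using P bases_VA_sub by (auto simp: P_def)
    have "(\<Sum>x\<in>X. form (B, \<gamma>) x * t x) = (\<Sum>x\<in>insert \<gamma> (B - set ns). form (B, \<gamma>) x * t x)"
      using finX sub Psub[OF P] by (intro sum.mono_neutral_right) (auto simp: form_def)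
    also have "\<dots> = t \<gamma> + (\<Sum>x\<in>B - set ns. form (B, \<gamma>) x * t x)"
      using finite_subset[OF sub finX] Psub[OF P] by (subst sum.insert) (auto simp: form_def)
    also have "(\<Sum>x\<in>B - set ns. form (B, \<gamma>) x * t x) = (\<Sum>x\<in>B - set ns. - (t x * complex_of_real (rs_coroot \<gamma> \<bullet> mu_V B x)))"
      using Psub[OF P] by (intro sum.cong) (auto simp: form_def)
    finally show ?thesis by (simp add: tau_def sum_negf)
  qed
  have low: "\<exists>\<eta>>0. \<forall>t\<in>?T. norm (t \<gamma> - tau B t \<gamma>) \<ge> \<eta>" if P: "(B, \<gamma>) \<in> P" for B \<gamma>
    using \<eta>[rule_format, OF imageI[OF P]] unfolding form_sum[OF P] by auto
  show ?thesis
  proof (rule that)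
    show "0 < \<rho> x \<and> \<rho> x < r \<and> \<rho> x < 1" if "x \<in> X" for x using \<rho> that by auto
    show "?T \<subseteq> Collect (F_regular D S ns X)"
    proof
      fix t assume t: "t \<in> ?T"
      have t1: "t \<alpha> \<noteq> 0" "norm (t \<alpha>) < 1" if "\<alpha> \<in> X" for \<alpha>
      proof -
        have "norm (t \<alpha>) = \<rho> \<alpha>" "0 < \<rho> \<alpha>" "\<rho> \<alpha> < 1" using t \<rho> that by auto
        then show "t \<alpha> \<noteq> 0" "norm (t \<alpha>) < 1" by auto
      qed
      have "t \<gamma> - tau B t \<gamma> \<noteq> 0" if B: "B \<in> bases_VA D S ns" "\<gamma> \<in> pos_roots D S - (B \<union> set ns)" for B \<gamma>
      proof -
        have "(B, \<gamma>) \<in> P" using B by (simp add: P_def)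
        from low[OF this] obtain \<eta> where "\<eta> > 0" "norm (t \<gamma> - tau B t \<gamma>) \<ge> \<eta>" using t by blast
        then show ?thesis by auto
      qed
      then show "t \<in> Collect (F_regular D S ns X)"
        using t1 exp_minus_1_nonzero unfolding F_regular_def tau_def by auto
    qed
    fix B assume B: "B \<in> bases_VA D S ns"
    have b1: "bounded ((\<lambda>t. t \<gamma> / (t \<gamma> - tau B t \<gamma>)) ` ?T)" if \<gamma>: "\<gamma> \<in> pos_roots D S - (B \<union> set ns)" for \<gamma>
    proof -
      have P: "(B, \<gamma>) \<in> P" using B \<gamma> by (simp add: P_def)
      from low[OF P] obtain \<eta> where \<eta>: "\<eta> > 0" "\<And>t. t \<in> ?T \<Longrightarrow> norm (t \<gamma> - tau B t \<gamma>) \<ge> \<eta>" by blast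
      have "norm (t \<gamma> / (t \<gamma> - tau B t \<gamma>)) \<le> 1 / \<eta>" if t: "t \<in> ?T" for t
      proof -
        have "norm (t \<gamma>) \<le> 1" using t \<rho> Psub(1)[OF P] by (auto simp: less_imp_le)
        then show ?thesis unfolding norm_divide using \<eta>(1) \<eta>(2)[OF t] by (intro frac_le) auto
      qed
      then show ?thesis unfolding bounded_iff by blast
    qed
    have b2: "bounded ((\<lambda>t. t \<beta> * exp (t \<beta> * complex_of_real u) / (exp (t \<beta>) - 1)) ` ?T)" if \<beta>: "\<beta> \<in> B - set ns" for \<beta> u
    proof -
      have \<beta>X: "\<beta> \<in> X" using \<beta> bases_VA_sub[OF B] by blast
      have "continuous_on (sphere 0 (\<rho> \<beta>)) (\<lambda>s. s * exp (s * complex_of_real u) / (exp s - 1))"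
      proof (intro continuous_intros ballI)
        fix s :: complex assume "s \<in> sphere 0 (\<rho> \<beta>)"
        then have "norm s < 1" "s \<noteq> 0" using \<rho> \<beta>X by auto
        then show "exp s - 1 \<noteq> 0" by (rule exp_minus_1_nonzero)
      qed
      then have "bounded ((\<lambda>s. s * exp (s * complex_of_real u) / (exp s - 1)) ` sphere 0 (\<rho> \<beta>))"
        by (intro compact_imp_bounded compact_continuous_image compact_sphere)
      then show ?thesis by (rule bounded_subset) (use \<beta>X in auto)
    qed
    show "bounded (F_summand B ` ?T)"
      unfolding F_summand_def[abs_def]
      by (intro bounded_image_mult bounded_image_const bounded_image_sum bounded_image_prod b1 b2)
  qed
qed

text \<open>Existence comes from \<open>power_series_limit\<close> along a sequence of shrinking
  boxes. A competing family of coefficients has its own radius, but both series represent F on a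
  regular torus inside both polydiscs, so they agree; this resolves the definite description in
  \<open>P_coeffs\<close>.\<close>

lemma P_coeffs_limit:
  "\<exists>c en. (\<forall>n. en n > 0) \<and> en \<longlonglongrightarrow> (0::real) \<and>
    (\<forall>k\<in>multi_indices X. (\<lambda>n. coef (en n) k) \<longlonglongrightarrow> c k) \<and>
    P_coeffs D S X ns \<phi> y = (\<lambda>k. if k \<in> multi_indices X then c k * (\<Prod>\<alpha>\<in>X. fact (k \<alpha>)) else 0)"
proof -
  obtain b where b: "b > 0" "\<And>\<epsilon>. 0 < \<epsilon> \<Longrightarrow> \<epsilon> < b \<Longrightarrow> cell_ok \<epsilon>"
    using eventually_cell_ok unfolding eventually_at_right_field by auto
  \<comment> \<open>Two successors keep even the term n = 0 strictly below b, where
    \<open>cell_ok\<close> is known.\<close>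
  define en where "en = (\<lambda>n. b * inverse (of_nat (Suc (Suc n))))"
  have en: "en n > 0" "en n < b" for n
  proof -
    have "inverse (real (Suc (Suc n))) < 1" by (simp add: inverse_less_1_iff)
    then show "en n > 0" "en n < b" using b(1) mult_strict_left_mono[of _ 1 b] by (simp_all add: en_def)
  qed
  have en0: "en \<longlonglongrightarrow> 0"
    unfolding en_def using tendsto_mult_right_zero[OF LIMSEQ_Suc[OF LIMSEQ_inverse_real_of_nat], of b] by simp
  obtain \<rho> where \<rho>: "\<And>x. x \<in> X \<Longrightarrow> 0 < \<rho> x \<and> \<rho> x < 1 \<and> \<rho> x < 1"
    and TR: "{t. \<forall>x\<in>X. norm (t x) = \<rho> x} \<subseteq> Collect (F_regular D S ns X)"
    and bT: "\<And>B. B \<in> bases_VA D S ns \<Longrightarrow> bounded (F_summand B ` {t. \<forall>x\<in>X. norm (t x) = \<rho> x})"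
    using regular_torus[of 1] by auto
  let ?T = "{t :: 'a \<Rightarrow> complex. \<forall>x\<in>X. norm (t x) = \<rho> x}"
  have boxlim: "uniform_limit {t. \<forall>\<alpha>\<in>X. norm (t \<alpha>) \<le> 1} (\<lambda>n t. box_exp_mean (en n) (tau B t)) (\<lambda>_. 1) sequentially"
    if B: "B \<in> bases_VA D S ns" for B
    by (rule uniform_limit_compose'[OF box_exp_mean_uniform[OF en(1) en0, of "tau_bound B"], where h = "tau B"])
       (use norm_tau[OF B] in auto)
  have "\<exists>c. (\<forall>k\<in>multi_indices X. (\<lambda>n. coef (en n) k) \<longlonglongrightarrow> c k) \<and>
     (\<forall>t\<in>Collect (F_regular D S ns X). (\<forall>x\<in>X. norm (t x) < \<rho> x) \<longrightarrow>
        ((\<lambda>k. c k * (\<Prod>x\<in>X. t x ^ k x)) has_sum F_gen D S ns \<phi> t y) (multi_indices X))"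
  proof (rule power_series_limit[OF finX, where a = "\<lambda>n. coef (en n)" and F = "\<lambda>n. F_smooth (en n)"
        and G = "\<lambda>t. F_gen D S ns \<phi> t y" and R = "Collect (F_regular D S ns X)" and \<rho> = \<rho>])
    show "0 < \<rho> x" if "x \<in> X" for x using \<rho> that by blast
    show "(\<lambda>k. norm (coef (en n) k) * (\<Prod>x\<in>X. \<rho> x ^ k x)) summable_on multi_indices X" for n
      by (rule coef_summable[OF en(1)]) (use \<rho> in blast)
    show "((\<lambda>k. coef (en n) k * (\<Prod>x\<in>X. t x ^ k x)) has_sum F_smooth (en n) t) (multi_indices X)"
      if "t \<in> Collect (F_regular D S ns X)" "\<And>x. x \<in> X \<Longrightarrow> norm (t x) \<le> \<rho> x" for n t
    proof (rule F_smooth_power_series[OF en(1) b(2)[OF en]])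
      show "norm (t \<alpha>) < 1" if "\<alpha> \<in> X" for \<alpha> using \<open>\<And>x. x \<in> X \<Longrightarrow> norm (t x) \<le> \<rho> x\<close>[OF that] \<rho>[OF that] by simp
    qed (use that in simp)
    show "?T \<subseteq> Collect (F_regular D S ns X)" by (rule TR)
    show "uniform_limit ?T (\<lambda>n. F_smooth (en n)) (\<lambda>t. F_gen D S ns \<phi> t y) sequentially"
    proof -
      have "uniform_limit ?T (\<lambda>n t. \<Sum>B\<in>bases_VA D S ns. F_summand B t * box_exp_mean (en n) (tau B t)) (\<lambda>t. \<Sum>B\<in>bases_VA D S ns. F_summand B t * 1) sequentially"
        by (intro uniform_limit_finite_sum uniform_lim_mult uniform_limit_const bT bounded_image_const uniform_limit_on_subset[OF boxlim])
           (use \<rho> in \<open>auto simp: less_imp_le\<close>)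
      then show ?thesis by (simp add: F_smooth_F_summand[abs_def] F_gen_F_summand)
    qed
    show "(\<lambda>n. F_smooth (en n) t) \<longlonglongrightarrow> F_gen D S ns \<phi> t y"
      if "t \<in> Collect (F_regular D S ns X)" "\<And>x. x \<in> X \<Longrightarrow> norm (t x) < \<rho> x" for t
    proof -
      have "t \<in> {t. \<forall>\<alpha>\<in>X. norm (t \<alpha>) \<le> 1}" using that(2) \<rho> by (force intro: less_imp_le order.strict_trans)
      then have "(\<lambda>n. \<Sum>B\<in>bases_VA D S ns. F_summand B t * box_exp_mean (en n) (tau B t)) \<longlonglongrightarrow> (\<Sum>B\<in>bases_VA D S ns. F_summand B t * 1)"
        by (intro tendsto_sum tendsto_mult tendsto_const tendsto_uniform_limitI[OF boxlim])
      then show ?thesis by (simp add: F_smooth_F_summand F_gen_F_summand)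
    qed
  qed blast
  then obtain c where c_all: "\<forall>k\<in>multi_indices X. (\<lambda>n. coef (en n) k) \<longlonglongrightarrow> c k"
    and cs_all: "\<forall>t\<in>Collect (F_regular D S ns X). (\<forall>x\<in>X. norm (t x) < \<rho> x) \<longrightarrow>
        ((\<lambda>k. c k * (\<Prod>x\<in>X. t x ^ k x)) has_sum F_gen D S ns \<phi> t y) (multi_indices X)" by blast
  have c: "(\<lambda>n. coef (en n) k) \<longlonglongrightarrow> c k" if "k \<in> multi_indices X" for k
    using c_all that by blast
  have cs: "((\<lambda>k. c k * (\<Prod>x\<in>X. t x ^ k x)) has_sum F_gen D S ns \<phi> t y) (multi_indices X)"
    if "F_regular D S ns X t" "\<And>x. x \<in> X \<Longrightarrow> norm (t x) < \<rho> x" for t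
    using cs_all that by blast
  \<comment> \<open>\<open>P_coeffs\<close> refers to monomials divided by factorials, so the
    factorials move into the coefficients.\<close>
  define c' where "c' = (\<lambda>k. if k \<in> multi_indices X then c k * (\<Prod>\<alpha>\<in>X. fact (k \<alpha>)) else 0)"
  have fct: "z * (\<Prod>\<alpha>\<in>X. t \<alpha> ^ k \<alpha> / fact (k \<alpha>)) = z / (\<Prod>\<alpha>\<in>X. fact (k \<alpha>)) * (\<Prod>\<alpha>\<in>X. t \<alpha> ^ k \<alpha>)"
    for z and t :: "'a \<Rightarrow> complex" and k :: "'a \<Rightarrow> nat" by (simp add: prod_dividef)
  have f0: "(\<Prod>\<alpha>\<in>X. fact (k \<alpha>)) \<noteq> (0::complex)" for k :: "'a \<Rightarrow> nat" using finX by simp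
  have "P_coeffs D S X ns \<phi> y = c'"
    unfolding P_coeffs_def
  proof (rule the_equality)
    define r where "r = Min (insert 1 (\<rho> ` X))"
    have r: "r > 0" "\<And>x. x \<in> X \<Longrightarrow> r \<le> \<rho> x" using finX \<rho> by (auto simp: r_def)
    have "((\<lambda>k. c' k * (\<Prod>\<alpha>\<in>X. t \<alpha> ^ k \<alpha> / fact (k \<alpha>))) has_sum F_gen D S ns \<phi> t y) (multi_indices X)"
      if t: "\<forall>\<alpha>\<in>X. norm (t \<alpha>) < r" "F_regular D S ns X t" for t
    proof -
      have "((\<lambda>k. c k * (\<Prod>x\<in>X. t x ^ k x)) has_sum F_gen D S ns \<phi> t y) (multi_indices X)"
        using t r(2) by (intro cs) (auto intro: less_le_trans)
      moreover have "((\<lambda>k. c k * (\<Prod>x\<in>X. t x ^ k x)) has_sum F_gen D S ns \<phi> t y) (multi_indices X) \<longleftrightarrow> ?thesis"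
        by (rule has_sum_cong) (simp add: c'_def fct f0)
      ultimately show ?thesis by simp
    qed
    then show "(\<forall>k. k \<notin> multi_indices X \<longrightarrow> c' k = 0) \<and> (\<exists>r>0. \<forall>t. (\<forall>\<alpha>\<in>X. norm (t \<alpha>) < r) \<and> F_regular D S ns X t \<longrightarrow>
        ((\<lambda>k. c' k * (\<Prod>\<alpha>\<in>X. t \<alpha> ^ k \<alpha> / fact (k \<alpha>))) has_sum F_gen D S ns \<phi> t y) (multi_indices X))"
      using r(1) by (auto simp: c'_def)
    fix d assume d: "(\<forall>k. k \<notin> multi_indices X \<longrightarrow> d k = 0) \<and> (\<exists>r>0. \<forall>t. (\<forall>\<alpha>\<in>X. norm (t \<alpha>) < r) \<and> F_regular D S ns X t \<longrightarrow>
        ((\<lambda>k. d k * (\<Prod>\<alpha>\<in>X. t \<alpha> ^ k \<alpha> / fact (k \<alpha>))) has_sum F_gen D S ns \<phi> t y) (multi_indices X))"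
    then obtain r' where r': "r' > 0" "\<And>t. (\<forall>\<alpha>\<in>X. norm (t \<alpha>) < r') \<Longrightarrow> F_regular D S ns X t \<Longrightarrow>
        ((\<lambda>k. d k * (\<Prod>\<alpha>\<in>X. t \<alpha> ^ k \<alpha> / fact (k \<alpha>))) has_sum F_gen D S ns \<phi> t y) (multi_indices X)" by blast
    \<comment> \<open>A new torus is chosen within the reach of both expansions.\<close>
    have "min r r' > 0" using r r' by simp
    then have "\<exists>\<sigma>. (\<forall>x\<in>X. 0 < \<sigma> x \<and> \<sigma> x < min r r' \<and> \<sigma> x < 1) \<and>
      {t. \<forall>x\<in>X. norm (t x) = \<sigma> x} \<subseteq> Collect (F_regular D S ns X)"
      by (rule regular_torus) blast
    then obtain \<sigma> where \<sigma>: "\<And>x. x \<in> X \<Longrightarrow> 0 < \<sigma> x \<and> \<sigma> x < min r r' \<and> \<sigma> x < 1"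
      and \<sigma>R: "{t. \<forall>x\<in>X. norm (t x) = \<sigma> x} \<subseteq> Collect (F_regular D S ns X)"
      by blast
    have "d k / (\<Prod>\<alpha>\<in>X. fact (k \<alpha>)) = c k" if k: "k \<in> multi_indices X" for k
    proof (rule power_series_unique[OF finX, of \<sigma> "\<lambda>k. d k / (\<Prod>\<alpha>\<in>X. fact (k \<alpha>))" "\<lambda>t. F_gen D S ns \<phi> t y" c, OF _ _ _ k])
      fix t :: "'a \<Rightarrow> complex" assume t: "\<And>x. x \<in> X \<Longrightarrow> norm (t x) = \<sigma> x"
      then have reg: "F_regular D S ns X t" using \<sigma>R by auto
      show "((\<lambda>k. d k / (\<Prod>\<alpha>\<in>X. fact (k \<alpha>)) * (\<Prod>x\<in>X. t x ^ k x)) has_sum F_gen D S ns \<phi> t y) (multi_indices X)"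
        using r'(2)[OF _ reg] t \<sigma> unfolding fct by auto
      show "((\<lambda>k. c k * (\<Prod>x\<in>X. t x ^ k x)) has_sum F_gen D S ns \<phi> t y) (multi_indices X)"
      proof (rule cs[OF reg])
        fix x assume x: "x \<in> X"
        show "norm (t x) < \<rho> x" using t[OF x] \<sigma>[OF x] r(2)[OF x] by simp
      qed
    qed (use \<sigma> in blast)
    then have dc: "d k / (\<Prod>\<alpha>\<in>X. fact (k \<alpha>)) = c k" if "k \<in> multi_indices X" for k using that by blast
    have "d k = c' k" if "k \<in> multi_indices X" for k
      using dc[OF that, symmetric] f0[of k] that by (simp add: c'_def)
    moreover have "d k = c' k" if "k \<notin> multi_indices X" for k using d that by (auto simp: c'_def)
    ultimately show "d = c'" by blast
  qed
  then show ?thesis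
    using en(1) en0 c unfolding c'_def by (intro exI[of _ c] exI[of _ en] conjI) auto
qed

end

section \<open>The value of the zeta function\<close>

context root_sum begin

lemma coweight_root_int:
  assumes \<nu>: "\<nu> \<in> coweight_lattice S" and s: "s \<in> S"
  shows "\<nu> \<bullet> s \<in> \<int>"
proof -
  obtain m :: "'a \<Rightarrow> int" where m: "\<nu> = (\<Sum>s\<in>S. of_int (m s) *\<^sub>R fund_coweight S s)"
    using \<nu> by (auto simp: coweight_lattice_def)
  show ?thesis
    unfolding m inner_sum_left using fund_coweight_inner[OF _ s] by (intro Ints_sum) auto
qed

text \<open>The simple root $s$ is the only positive root whose image under its reflection is negative; the resulting sign disappears because $k$ is even.\<close>

lemma zeta_term_refl:
  assumes inv: "\<And>s \<alpha>. s \<in> S \<Longrightarrow> \<alpha> \<in> X \<Longrightarrow> \<alpha> \<noteq> s \<Longrightarrow> rs_refl s \<alpha> \<in> X"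
    and \<nu>: "\<nu> \<in> coweight_lattice S" and k: "even k" and s: "s \<in> S" and l: "l \<in> weights"
  shows "zeta_term X (\<lambda>_. k) \<nu> (rs_refl s l) = zeta_term X (\<lambda>_. k) \<nu> l"
proof -
  have sD: "s \<in> D" and s0: "s \<noteq> 0" using s SD nz by auto
  have "ee (\<nu> \<bullet> rs_refl s l) = ee (\<nu> \<bullet> l)"
  proof -
    have "\<nu> \<bullet> rs_refl s l = \<nu> \<bullet> l + - ((rs_coroot s \<bullet> l) * (\<nu> \<bullet> s))" by (simp add: rs_refl_def inner_diff_right)
    moreover have "- ((rs_coroot s \<bullet> l) * (\<nu> \<bullet> s)) \<in> \<int>"
      using coroot_weight_int[OF sD l] coweight_root_int[OF \<nu> s] by (intro Ints_minus Ints_mult)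
    ultimately show ?thesis
      using exp_2pi_int by (simp only: of_real_add distrib_left exp_add) simp
  qed
  moreover have "(\<Prod>\<alpha>\<in>X. 1 / (complex_of_real (rs_coroot \<alpha> \<bullet> rs_refl s l)) ^ k) = (\<Prod>\<alpha>\<in>X. 1 / (complex_of_real (rs_coroot \<alpha> \<bullet> l)) ^ k)"
  proof -
    define \<sigma> where "\<sigma> = (\<lambda>\<alpha>. if \<alpha> = s then s else rs_refl s \<alpha>)"
    have \<sigma>\<sigma>: "\<sigma> (\<sigma> \<alpha>) = \<alpha>" if "\<alpha> \<in> X" for \<alpha>
    proof (cases "\<alpha> = s")
      case False
      have "rs_refl s \<alpha> \<noteq> s"
      proof
        assume e: "rs_refl s \<alpha> = s"
        have "\<alpha> = rs_refl s (rs_refl s \<alpha>)" using refl_refl[OF s0] by simp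
        then have "\<alpha> = - s" using refl_self[OF s0] e by simp
        then show False using that X not_pos_neg[OF simple_pos[OF s]] by auto
      qed
      then show ?thesis using False refl_refl[OF s0] by (simp add: \<sigma>_def)
    qed (simp add: \<sigma>_def)
    have \<sigma>X: "\<sigma> \<alpha> \<in> X" if "\<alpha> \<in> X" for \<alpha> using inv[OF s that] that by (auto simp: \<sigma>_def)
    have "bij_betw \<sigma> X X"
      by (rule bij_betwI[where g = \<sigma>]) (use \<sigma>\<sigma> \<sigma>X in auto)
    then have "(\<Prod>\<alpha>\<in>X. 1 / (complex_of_real (rs_coroot \<alpha> \<bullet> l)) ^ k) = (\<Prod>\<alpha>\<in>X. 1 / (complex_of_real (rs_coroot (\<sigma> \<alpha>) \<bullet> l)) ^ k)"
      by (rule prod.reindex_bij_betw[symmetric])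
    also have "\<dots> = (\<Prod>\<alpha>\<in>X. 1 / (complex_of_real (rs_coroot \<alpha> \<bullet> rs_refl s l)) ^ k)"
    proof (rule prod.cong)
      fix \<alpha>
      have e: "rs_coroot (rs_refl s \<beta>) \<bullet> l = rs_coroot \<beta> \<bullet> rs_refl s l" for \<beta>
        unfolding coroot_inner refl_inner[OF s0] refl_inner_swap[OF s0, of \<beta> l] ..
      show "1 / (complex_of_real (rs_coroot (\<sigma> \<alpha>) \<bullet> l)) ^ k = 1 / (complex_of_real (rs_coroot \<alpha> \<bullet> rs_refl s l)) ^ k"
      proof (cases "\<alpha> = s")
        case True
        have "rs_coroot s \<bullet> rs_refl s l = - (rs_coroot s \<bullet> l)"
          using e[of s] refl_self[OF s0] by (simp add: coroot_inner)
        then show ?thesis using True k by (simp add: \<sigma>_def)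
      next
        case False
        then show ?thesis using e by (simp add: \<sigma>_def)
      qed
    qed simp
    finally show ?thesis by simp
  qed
  ultimately show ?thesis by (simp add: zeta_term_def)
qed

lemma zeta_term_weyl:
  assumes inv: "\<And>s \<alpha>. s \<in> S \<Longrightarrow> \<alpha> \<in> X \<Longrightarrow> \<alpha> \<noteq> s \<Longrightarrow> rs_refl s \<alpha> \<in> X"
    and \<nu>: "\<nu> \<in> coweight_lattice S" and k: "even k" and w: "w \<in> weyl_group D" and l: "l \<in> weights"
  shows "zeta_term X (\<lambda>_. k) \<nu> (w l) = zeta_term X (\<lambda>_. k) \<nu> l"
proof -
  obtain xs where xs: "xs \<in> lists S" "w = word_map xs" using w weyl_iff_word by blast
  have "zeta_term X (\<lambda>_. k) \<nu> (word_map xs l) = zeta_term X (\<lambda>_. k) \<nu> l"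
    using xs(1)
  proof (induction xs rule: list.induct)
    case (Cons s xs)
    then have "s \<in> S" "xs \<in> lists S" by auto
    then show ?case
      using Cons.IH zeta_term_refl[OF inv \<nu> k _ weights_word[OF _ l], of s xs] by simp
  qed simp
  then show ?thesis using xs(2) by simp
qed

text \<open>For k \<ge> 2 the pole coefficients alone decay quadratically. As the box means have
  modulus at most 1 and tend to 1, the majorant is free of \<epsilon> and dominated convergence
  applies.\<close>

lemma coef_limit:
  assumes k: "k \<ge> 2" and en: "\<And>n. en n > 0" "en \<longlonglongrightarrow> (0::real)"
  shows "(\<lambda>n. coef (en n) (\<lambda>\<alpha>. if \<alpha> \<in> X then k else 0)) \<longlonglongrightarrow> infsum (\<lambda>l. weighted_char l * (\<Prod>\<alpha>\<in>X. pole_coeff k (wpair l \<alpha>))) weights"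
    and "(\<lambda>l. weighted_char l * (\<Prod>\<alpha>\<in>X. pole_coeff k (wpair l \<alpha>))) summable_on weights"
proof -
  define C where "C = (\<Prod>\<alpha>\<in>X. 2::real)"
  have bd: "norm (weighted_char l * (\<Prod>\<alpha>\<in>X. pole_coeff k (wpair l \<alpha>))) \<le> C * decay_majorant l" if l: "l \<in> weights" for l
  proof -
    have "norm (\<Prod>\<alpha>\<in>X. pole_coeff k (wpair l \<alpha>)) \<le> (\<Prod>\<alpha>\<in>X. 2 * quad_decay (rs_coroot \<alpha> \<bullet> l))"
      unfolding prod_norm[symmetric]
    proof (rule prod_mono, intro conjI)
      fix \<alpha> assume \<alpha>: "\<alpha> \<in> X"
      obtain m :: int where m: "rs_coroot \<alpha> \<bullet> l = of_int m" "wpair l \<alpha> = 2 * pi * \<i> * of_int m" using wpair_int[OF \<alpha> l] .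
      show "norm (pole_coeff k (wpair l \<alpha>)) \<le> 2 * quad_decay (rs_coroot \<alpha> \<bullet> l)" using norm_pole_coeff_le(2)[OF m(2) k] m(1) by simp
    qed simp
    also have "\<dots> = C * decay_majorant l" by (simp only: C_def decay_majorant_def prod.distrib)
    finally have "norm (\<Prod>\<alpha>\<in>X. pole_coeff k (wpair l \<alpha>)) \<le> C * decay_majorant l" .
    moreover have "norm (weighted_char l * (\<Prod>\<alpha>\<in>X. pole_coeff k (wpair l \<alpha>))) \<le> 1 * norm (\<Prod>\<alpha>\<in>X. pole_coeff k (wpair l \<alpha>))"
      unfolding norm_mult[of "weighted_char l"] using norm_weighted_char by (intro mult_right_mono) auto
    ultimately show ?thesis by simp
  qed
  have Cs: "(\<lambda>l. C * decay_majorant l) summable_on weights" by (intro summable_on_cmult_right decay_majorant_summable)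
  show "(\<lambda>l. weighted_char l * (\<Prod>\<alpha>\<in>X. pole_coeff k (wpair l \<alpha>))) summable_on weights"
    by (rule abs_summable_summable, rule Infinite_Sum.abs_summable_on_comparison_test'[OF Cs bd])
  have box1: "norm (box_exp_mean (en n) (wpair l)) \<le> 1" for n l
    unfolding box_exp_mean_def prod_norm[symmetric]
    by (rule prod_le_1) (use norm_exp_mean_le_1[OF lo_less_hi[OF en(1)]] in \<open>auto simp: wpair_def\<close>)
  have "(\<lambda>n. infsum (\<lambda>l. weighted_char l * box_exp_mean (en n) (wpair l) * (\<Prod>\<alpha>\<in>X. pole_coeff k (wpair l \<alpha>))) weights) \<longlonglongrightarrow>
      infsum (\<lambda>l. weighted_char l * (\<Prod>\<alpha>\<in>X. pole_coeff k (wpair l \<alpha>))) weights"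
  proof (rule tendsto_infsum_dominated[OF _ Cs])
    fix n l assume l: "l \<in> weights"
    have "norm (weighted_char l * box_exp_mean (en n) (wpair l) * (\<Prod>\<alpha>\<in>X. pole_coeff k (wpair l \<alpha>))) =
       norm (box_exp_mean (en n) (wpair l)) * norm (weighted_char l * (\<Prod>\<alpha>\<in>X. pole_coeff k (wpair l \<alpha>)))"
      by (simp add: norm_mult mult_ac)
    also have "\<dots> \<le> 1 * norm (weighted_char l * (\<Prod>\<alpha>\<in>X. pole_coeff k (wpair l \<alpha>)))"
      using box1 by (intro mult_right_mono) auto
    finally show "norm (weighted_char l * box_exp_mean (en n) (wpair l) * (\<Prod>\<alpha>\<in>X. pole_coeff k (wpair l \<alpha>))) \<le> C * decay_majorant l"
      using bd[OF l] by simp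
  next
    fix l assume l: "l \<in> weights"
    define Z where "Z = (\<Sum>\<alpha>\<in>X. norm (wpair l \<alpha>))"
    have "wpair l \<in> {z. \<forall>\<alpha>\<in>X. norm (z \<alpha>) \<le> Z}"
      unfolding Z_def using finX by (auto intro: member_le_sum[of _ X "\<lambda>\<alpha>. norm (wpair l \<alpha>)"])
    then have "(\<lambda>n. box_exp_mean (en n) (wpair l)) \<longlonglongrightarrow> 1"
      by (rule tendsto_uniform_limitI[OF box_exp_mean_uniform[OF en]])
    then have "(\<lambda>n. weighted_char l * box_exp_mean (en n) (wpair l) * (\<Prod>\<alpha>\<in>X. pole_coeff k (wpair l \<alpha>))) \<longlonglongrightarrow> weighted_char l * 1 * (\<Prod>\<alpha>\<in>X. pole_coeff k (wpair l \<alpha>))"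
      by (intro tendsto_intros)
    then show "(\<lambda>n. weighted_char l * box_exp_mean (en n) (wpair l) * (\<Prod>\<alpha>\<in>X. pole_coeff k (wpair l \<alpha>))) \<longlonglongrightarrow> weighted_char l * (\<Prod>\<alpha>\<in>X. pole_coeff k (wpair l \<alpha>))" by simp
  qed
  then show "(\<lambda>n. coef (en n) (\<lambda>\<alpha>. if \<alpha> \<in> X then k else 0)) \<longlonglongrightarrow> infsum (\<lambda>l. weighted_char l * (\<Prod>\<alpha>\<in>X. pole_coeff k (wpair l \<alpha>))) weights"
    by (simp add: coef_def)
qed

lemma regular_weights_iff:
  assumes l: "l \<in> weights"
  shows "l \<in> regular_weights \<longleftrightarrow> (\<forall>\<nu>\<in>set ns. \<nu> \<bullet> l \<noteq> 0) \<and> (\<forall>\<alpha>\<in>X. rs_coroot \<alpha> \<bullet> l \<noteq> 0)"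
proof -
  have P: "pos_roots D S = X \<union> set ns" using X ns by auto
  have c: "rs_coroot \<alpha> \<bullet> l \<noteq> 0 \<longleftrightarrow> \<alpha> \<bullet> l \<noteq> 0" if "\<alpha> \<in> D" for \<alpha> using coroot_inner_sgn(2)[OF nz[OF that]] by blast
  have "(\<forall>\<alpha>\<in>D. \<alpha> \<bullet> l \<noteq> 0) \<longleftrightarrow> (\<forall>\<alpha>\<in>pos_roots D S. \<alpha> \<bullet> l \<noteq> 0)"
  proof
    assume *: "\<forall>\<alpha>\<in>pos_roots D S. \<alpha> \<bullet> l \<noteq> 0"
    show "\<forall>\<alpha>\<in>D. \<alpha> \<bullet> l \<noteq> 0"
    proof
      fix \<alpha> assume "\<alpha> \<in> D"
      then show "\<alpha> \<bullet> l \<noteq> 0" using pos_or_neg[of \<alpha>] * by force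
    qed
  qed (use PD in auto)
  moreover have "(\<forall>\<alpha>\<in>D. rs_coroot \<alpha> \<bullet> l \<noteq> 0) \<longleftrightarrow> (\<forall>\<alpha>\<in>D. \<alpha> \<bullet> l \<noteq> 0)" using c by auto
  moreover have "(\<forall>\<alpha>\<in>X. rs_coroot \<alpha> \<bullet> l \<noteq> 0) \<longleftrightarrow> (\<forall>\<alpha>\<in>X. \<alpha> \<bullet> l \<noteq> 0)" using c XD by auto
  ultimately show ?thesis using l by (auto simp: regular_weights_def P)
qed

text \<open>The limit coefficient is a sum over all weights, but the terms at singular weights
  vanish: either the indicator for the list is 0, or some pairing with X is 0 and
  \<open>pole_coeff k 0 = 0\<close> as k is positive. On regular weights each pole coefficient
  carries a factor -1, which joins the sign from the list to a sign counting all positive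
  roots.\<close>

theorem zeta_has_sum:
  assumes inv: "\<And>s \<alpha>. s \<in> S \<Longrightarrow> \<alpha> \<in> X \<Longrightarrow> \<alpha> \<noteq> s \<Longrightarrow> rs_refl s \<alpha> \<in> X"
    and y: "y \<in> coweight_lattice S" and k: "even k" "k \<ge> 2"
  shows "((\<lambda>l. zeta_term X (\<lambda>_. k) y l) has_sum
     ((-1) ^ card (pos_roots D S) / of_nat (card (weyl_group D)) *
      P_coeffs D S X ns \<phi> y (\<lambda>\<alpha>. if \<alpha> \<in> X then k else 0) *
      (\<Prod>\<alpha>\<in>X. (2 * pi * \<i>) ^ k / fact k))) (P_pp S)"
proof -
  define kk where "kk = (\<lambda>\<alpha>. if \<alpha> \<in> X then k else 0)"
  have kkM: "kk \<in> multi_indices X" by (simp add: kk_def multi_indices_def)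
  obtain c en where en: "\<And>n. en n > 0" "en \<longlonglongrightarrow> (0::real)"
    and c: "\<forall>k\<in>multi_indices X. (\<lambda>n. coef (en n) k) \<longlonglongrightarrow> c k"
    and P: "P_coeffs D S X ns \<phi> y = (\<lambda>k. if k \<in> multi_indices X then c k * (\<Prod>\<alpha>\<in>X. fact (k \<alpha>)) else 0)"
    using P_coeffs_limit by blast
  define f where "f = (\<lambda>l. weighted_char l * (\<Prod>\<alpha>\<in>X. pole_coeff k (wpair l \<alpha>)))"
  have ckk: "c kk = infsum f weights"
    using LIMSEQ_unique[OF c[rule_format, OF kkM] coef_limit(1)[OF k(2) en, folded kk_def]] by (simp add: f_def)
  have "(f has_sum c kk) weights"
    using coef_limit(2)[OF k(2) en] by (simp add: ckk f_def)
  moreover have "(f has_sum c kk) weights \<longleftrightarrow> (f has_sum c kk) regular_weights"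
  proof (rule has_sum_cong_neutral)
    show "f l = 0" if "l \<in> weights - regular_weights" for l
    proof -
      have "(\<exists>\<nu>\<in>set ns. \<nu> \<bullet> l = 0) \<or> (\<exists>\<alpha>\<in>X. rs_coroot \<alpha> \<bullet> l = 0)" using that regular_weights_iff by auto
      then show ?thesis
      proof
        assume "\<exists>\<nu>\<in>set ns. \<nu> \<bullet> l = 0"
        then show ?thesis by (auto simp: f_def weighted_char_def)
      next
        assume "\<exists>\<alpha>\<in>X. rs_coroot \<alpha> \<bullet> l = 0"
        then have "\<exists>\<alpha>\<in>X. pole_coeff k (wpair l \<alpha>) = 0" using k(2) by (auto simp: pole_coeff_def wpair_def)
        then show ?thesis using finX by (auto simp: f_def intro: prod_zero)
      qed
    qed
  qed (auto simp: regular_weights_def)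
  ultimately have fr: "(f has_sum c kk) regular_weights" by simp
  \<comment> \<open>The ratio of \<open>zeta_term\<close> to the Fourier term: the powers of 2 pi i
    clear the denominators of the pole coefficients, and the sign is its own inverse.\<close>
  define K where "K = (-1) ^ card (pos_roots D S) * (\<Prod>\<alpha>\<in>X. (2 * pi * \<i>) ^ k)"
  have cardP: "card (pos_roots D S) = card (set ns) + card X"
  proof -
    have "pos_roots D S = set ns \<union> X" "set ns \<inter> X = {}" using X ns by auto
    then show ?thesis using card_Un_disjoint[of "set ns" X] finX by simp
  qed
  have zf: "zeta_term X (\<lambda>_. k) y l = K * f l" if l: "l \<in> regular_weights" for l
  proof -
    have lw: "l \<in> weights" using l by (simp add: regular_weights_def)
    have r: "\<forall>\<nu>\<in>set ns. \<nu> \<bullet> l \<noteq> 0" "\<And>\<alpha>. \<alpha> \<in> X \<Longrightarrow> rs_coroot \<alpha> \<bullet> l \<noteq> 0"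
      using l regular_weights_iff[OF lw] by auto
    have "(2 * pi * \<i>) ^ k * pole_coeff k (wpair l \<alpha>) = - 1 * (1 / complex_of_real (rs_coroot \<alpha> \<bullet> l) ^ k)" if "\<alpha> \<in> X" for \<alpha>
      using r(2)[OF that] k(2) by (simp add: pole_coeff_def wpair_def power_mult_distrib)
    then have "(\<Prod>\<alpha>\<in>X. (2 * pi * \<i>) ^ k * pole_coeff k (wpair l \<alpha>)) = (\<Prod>\<alpha>\<in>X. - 1 * (1 / complex_of_real (rs_coroot \<alpha> \<bullet> l) ^ k))"
      by (intro prod.cong) auto
    then have e1: "(\<Prod>\<alpha>\<in>X. (2 * pi * \<i>) ^ k) * (\<Prod>\<alpha>\<in>X. pole_coeff k (wpair l \<alpha>)) = (-1) ^ card X * (\<Prod>\<alpha>\<in>X. 1 / complex_of_real (rs_coroot \<alpha> \<bullet> l) ^ k)"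
      unfolding prod.distrib by (simp only: prod_constant)
    have sq: "(-1::complex) ^ n * (-1) ^ n = 1" for n by (simp flip: power_mult_distrib)
    have "K * f l = ((-1) ^ card (set ns) * (-1) ^ card (set ns)) * (-1) ^ card X *
       ee (y \<bullet> l) * ((\<Prod>\<alpha>\<in>X. (2 * pi * \<i>) ^ k) * (\<Prod>\<alpha>\<in>X. pole_coeff k (wpair l \<alpha>)))"
      unfolding K_def f_def weighted_char_def cardP power_add if_P[OF r(1)] by (simp only: mult_ac mult_1_left mult_1_right)
    also have "\<dots> = ((-1) ^ card X * (-1) ^ card X) * ee (y \<bullet> l) * (\<Prod>\<alpha>\<in>X. 1 / complex_of_real (rs_coroot \<alpha> \<bullet> l) ^ k)"
      unfolding e1 sq[of "card (set ns)"] by (simp only: mult_ac mult_1_left)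
    also have "\<dots> = zeta_term X (\<lambda>_. k) y l" unfolding sq zeta_term_def by simp
    finally show ?thesis by simp
  qed
  have "((\<lambda>l. zeta_term X (\<lambda>_. k) y l) has_sum (K * c kk)) regular_weights"
    using has_sum_cong[THEN iffD2, OF zf has_sum_cmult_right[OF fr, of K]] by simp
  then have "((\<lambda>l. zeta_term X (\<lambda>_. k) y l) has_sum (K * c kk / of_nat (card (weyl_group D)))) (P_pp S)"
  proof (rule has_sum_chamber[rotated])
    show "zeta_term X (\<lambda>_. k) y (w l) = zeta_term X (\<lambda>_. k) y l" if "w \<in> weyl_group D" "l \<in> P_pp S" for w l
      by (rule zeta_term_weyl[OF inv y k(1) that(1)]) (use that(2) P_pp_eq in auto)
  qed
  moreover have "K * c kk / of_nat (card (weyl_group D)) =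
      (-1) ^ card (pos_roots D S) / of_nat (card (weyl_group D)) *
      P_coeffs D S X ns \<phi> y kk * (\<Prod>\<alpha>\<in>X. (2 * pi * \<i>) ^ k / fact k)"
  proof -
    have P1: "P_coeffs D S X ns \<phi> y kk = c kk * (\<Prod>\<alpha>\<in>X. fact k)"
      using kkM by (simp add: P kk_def)
    have P2: "(\<Prod>\<alpha>\<in>X. fact k) * (\<Prod>\<alpha>\<in>X. (2 * pi * \<i>) ^ k / fact k) = (\<Prod>\<alpha>\<in>X. (2 * pi * \<i>) ^ k)"
      unfolding prod.distrib[symmetric] by simp
    show ?thesis
      unfolding P1 K_def P2[symmetric] by (simp only: mult_ac times_divide_eq_left times_divide_eq_right)
  qed
  ultimately show ?thesis by (simp only: kk_def)
qed

end

text \<open>\<phi> has coordinates in X because X spans. Finitely many pairings of \<phi> with dual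
  vectors have to dominate, all nonzero by genericity, so a small \<delta> works.\<close>

lemma (in based_root_system) box_parameters:
  assumes X: "X \<subseteq> pos_roots D S" "span X = UNIV" and g: "generic_phi D S \<phi>"
  shows "\<exists>a \<delta>. \<phi> = (\<Sum>\<alpha>\<in>X. a \<alpha> *\<^sub>R rs_coroot \<alpha>) \<and> \<delta> > 0 \<and>
    (\<forall>B\<in>bases_V D S. \<forall>\<beta>\<in>B. \<delta> * (\<Sum>\<alpha>\<in>X. \<bar>rs_coroot \<alpha> \<bullet> mu_V B \<beta>\<bar>) < \<bar>\<phi> \<bullet> mu_V B \<beta>\<bar>)"
proof -
  have finX: "finite X" using X finP finite_subset by blast
  have "\<phi> \<in> span X" using X by simp
  then obtain u where u: "\<phi> = (\<Sum>\<alpha>\<in>X. u \<alpha> *\<^sub>R \<alpha>)" using span_finite[OF finX] by auto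
  \<comment> \<open>Passing from roots to coroots rescales the coordinates by half the squared
    length.\<close>
  have "(u \<alpha> * ((\<alpha> \<bullet> \<alpha>) / 2)) *\<^sub>R rs_coroot \<alpha> = u \<alpha> *\<^sub>R \<alpha>" if "\<alpha> \<in> X" for \<alpha>
    using nz X PD that by (auto simp: rs_coroot_def)
  then have a: "\<phi> = (\<Sum>\<alpha>\<in>X. (u \<alpha> * ((\<alpha> \<bullet> \<alpha>) / 2)) *\<^sub>R rs_coroot \<alpha>)" unfolding u by (intro sum.cong) auto
  have fB: "finite (bases_V D S)"
    by (rule finite_subset[of _ "Pow (pos_roots D S)"]) (use finP in \<open>auto simp: bases_V_def\<close>)
  have "eventually (\<lambda>\<delta>. \<forall>B\<in>bases_V D S. \<forall>\<beta>\<in>B. \<delta> * (\<Sum>\<alpha>\<in>X. \<bar>rs_coroot \<alpha> \<bullet> mu_V B \<beta>\<bar>) < \<bar>\<phi> \<bullet> mu_V B \<beta>\<bar>) (at_right 0)"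
  proof (intro eventually_ball_finite ballI fB)
    fix B \<beta> assume B: "B \<in> bases_V D S"
    show "finite B" by (rule bases_V_props(3)[OF B])
    assume \<beta>: "\<beta> \<in> B"
    have "((\<lambda>\<delta>. \<delta> * (\<Sum>\<alpha>\<in>X. \<bar>rs_coroot \<alpha> \<bullet> mu_V B \<beta>\<bar>)) \<longlongrightarrow> 0 * (\<Sum>\<alpha>\<in>X. \<bar>rs_coroot \<alpha> \<bullet> mu_V B \<beta>\<bar>)) (at_right 0)"
      by (intro tendsto_intros)
    then show "eventually (\<lambda>\<delta>. \<delta> * (\<Sum>\<alpha>\<in>X. \<bar>rs_coroot \<alpha> \<bullet> mu_V B \<beta>\<bar>) < \<bar>\<phi> \<bullet> mu_V B \<beta>\<bar>) (at_right 0)"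
      by (rule order_tendstoD) (use g B \<beta> in \<open>auto simp: generic_phi_def\<close>)
  qed
  then obtain b where b: "b > 0" "\<And>\<delta>. 0 < \<delta> \<Longrightarrow> \<delta> < b \<Longrightarrow>
     \<forall>B\<in>bases_V D S. \<forall>\<beta>\<in>B. \<delta> * (\<Sum>\<alpha>\<in>X. \<bar>rs_coroot \<alpha> \<bullet> mu_V B \<beta>\<bar>) < \<bar>\<phi> \<bullet> mu_V B \<beta>\<bar>"
    unfolding eventually_at_right_field by auto
  show ?thesis
    using a b(1) b(2)[of "b / 2"]
    by (intro exI[of _ "\<lambda>\<alpha>. u \<alpha> * ((\<alpha> \<bullet> \<alpha>) / 2)"] exI[of _ "b / 2"] conjI) auto
qed

theorem theorem3p10:
  fixes D S D1 D2 :: "'a::euclidean_space set"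
  assumes "root_system D" and "reduced_rs D" and "irreducible_rs D"
    and "fundamental_system D S"
    and "\<not> simply_laced D"
    and "(D1, D2) = (long_roots D, short_roots D) \<or> (D1, D2) = (short_roots D, long_roots D)"
  shows "root_set D S (D1 \<inter> pos_roots D S) \<and> root_set D S (D2 \<inter> pos_roots D S) \<and>
    (\<forall>(k::nat) \<nu> \<phi> ns.
       even k \<and> k \<ge> 2 \<and> \<nu> \<in> coweight_lattice S \<and> generic_phi D S \<phi> \<and>
       distinct ns \<and> set ns = pos_roots D S - D1 \<inter> pos_roots D S \<longrightarrow>
       ((\<lambda>l. zeta_term (D1 \<inter> pos_roots D S) (\<lambda>_. k) \<nu> l) has_sum
          ((-1) ^ card (pos_roots D S) / of_nat (card (weyl_group D)) *
           P_coeffs D S (D1 \<inter> pos_roots D S) ns \<phi> \<nu>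
             (\<lambda>\<alpha>. if \<alpha> \<in> D1 \<inter> pos_roots D S then k else 0) *
           (\<Prod>\<alpha>\<in>D1 \<inter> pos_roots D S. (2 * pi * \<i>) ^ k / fact k)))
        (P_pp S))"
proof -
  interpret based_root_system D S by unfold_locales (use assms in auto)
  \<comment> \<open>Both classes of roots are stable under all reflections, and reflecting a root in
    itself gives stability under negation. Irreducibility then yields spanning, already by the
    positive members.\<close>
  have inv: "E \<subseteq> D" "\<And>a b. a \<in> D \<Longrightarrow> b \<in> E \<Longrightarrow> rs_refl a b \<in> E" "span (E \<inter> pos_roots D S) = UNIV"
    if E: "E = long_roots D \<or> E = short_roots D" for E
  proof -
    note LS = long_short_invariant[OF E]
    show "E \<subseteq> D" by (rule LS(1))
    show refl: "rs_refl a b \<in> E" if "a \<in> D" "b \<in> E" for a b by (rule LS(3)[OF that])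
    have "- b \<in> E" if b: "b \<in> E" for b
    proof -
      have "b \<in> D" using b LS(1) by auto
      then show ?thesis using refl[of b b] refl_self[of b] nz b by simp
    qed
    then show "span (E \<inter> pos_roots D S) = UNIV"
      by (intro invariant_pos_spans invariant_spans[OF assms(3) LS] LS(1))
  qed
  have E1: "D1 = long_roots D \<or> D1 = short_roots D" and E2: "D2 = long_roots D \<or> D2 = short_roots D"
    using assms(6) by auto
  have "((\<lambda>l. zeta_term (D1 \<inter> pos_roots D S) (\<lambda>_. k) \<nu> l) has_sum
          ((-1) ^ card (pos_roots D S) / of_nat (card (weyl_group D)) *
           P_coeffs D S (D1 \<inter> pos_roots D S) ns \<phi> \<nu>
             (\<lambda>\<alpha>. if \<alpha> \<in> D1 \<inter> pos_roots D S then k else 0) *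
           (\<Prod>\<alpha>\<in>D1 \<inter> pos_roots D S. (2 * pi * \<i>) ^ k / fact k)))
        (P_pp S)"
    if k: "even k" "k \<ge> 2" and \<nu>: "\<nu> \<in> coweight_lattice S" and \<phi>: "generic_phi D S \<phi>"
      and ns: "distinct ns" "set ns = pos_roots D S - D1 \<inter> pos_roots D S" for k \<nu> \<phi> ns
  proof -
    obtain a \<delta> where ad: "\<phi> = (\<Sum>\<alpha>\<in>D1 \<inter> pos_roots D S. a \<alpha> *\<^sub>R rs_coroot \<alpha>)" "\<delta> > 0"
      "\<forall>B\<in>bases_V D S. \<forall>\<beta>\<in>B.
        \<delta> * (\<Sum>\<alpha>\<in>D1 \<inter> pos_roots D S. \<bar>rs_coroot \<alpha> \<bullet> mu_V B \<beta>\<bar>) < \<bar>\<phi> \<bullet> mu_V B \<beta>\<bar>"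
      using box_parameters[OF _ inv(3)[OF E1] \<phi>] by blast
    interpret root_sum D S "D1 \<inter> pos_roots D S" ns \<phi> \<nu> a \<delta>
      by unfold_locales (use inv(3)[OF E1] ns \<phi> ad in auto)
    show ?thesis
    proof (rule zeta_has_sum[OF _ \<nu> k])
      \<comment> \<open>Stability of D1 keeps the image in D1, and a simple reflection keeps every
        positive root other than its own positive.\<close>
      fix s \<alpha> assume "s \<in> S" "\<alpha> \<in> D1 \<inter> pos_roots D S" "\<alpha> \<noteq> s"
      then show "rs_refl s \<alpha> \<in> D1 \<inter> pos_roots D S"
        using simple_refl_pos inv(2)[OF E1] SD by blast
    qed
  qed
  then show ?thesis
    using spanning_root_set[OF inv(3)[OF E1]] spanning_root_set[OF inv(3)[OF E2]] by simp
qed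

end
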